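(* Let $d>0$ be an integer, let $t_1<t_2<\cdots<t_{d+2}$ be real numbers, and let $\{n_{c,i}\}_{i=1}^{d}$ be a sequence of integers greater than $1$. Let $\overrightarrow{G}$ be the digraph obtained as follows: take a balanced tree of type $(\{n_{c,i}\}_{i=1}^{d},d)$, and add one new vertex together with one new oriented edge which departs from the new vertex and enters the root of the balanced tree. Put $l:=\sum_{i=1}^{d}(n_{c,i}+1)+2$. Then there exists a real number $R_0>0$ such that for every real number $R>R_0$ there exist an integer $k\ge 2$ and an RA-region $(D,\{S_j\}_{j=1}^{l})$ of $\mathbb{R}^k$, with $\overline{D}$ compact, such that: (i) each $S_j$ ($1\le j\le l$) is a cylinder in $\mathbb{R}^k$ of the circle $C_R:=\{x=(x_1,x_2)\in\mathbb{R}^2 \mid \|x\|=R\}$; (ii) the Poincaré-Reeb digraph of $(D,\{S_j\}_{j=1}^{l})$ is isomorphic, as a digraph, to $\overrightarrow{G}$; (iii) the image of the vertex set of the Poincaré-Reeb graph $PR_{(D,\{S_j\}_{j=1}^l)}$ under the induced function $\overline{\pi_{(D,\{S_j\}_{j=1}^l)}}:PR_{(D,\{S_j\}_{j=1}^l)}\to\mathbb{R}$ is exactly $\{t_1,\dots,t_{d+2}\}$.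
   Context: **Graphs and digraphs.** A graph is a finite connected $1$-dimensional CW complex such that the closure of each $1$-cell is homeomorphic to $D^1=[-1,1]$; its vertices are the $0$-cells and its edges are the $1$-cells. A digraph is a graph all of whose edges are oriented. Two digraphs are isomorphic if there is a homeomorphism between them mapping vertex set onto vertex set and preserving the orientations of edges. **Balanced trees.** A rooted tree is a tree (a graph with first Betti number $0$ and more than one vertex) with a chosen vertex $v_0$ (the root), regarded as a digraph by orienting every edge away from $v_0$; thus $v_0$ is the unique source and every other vertex has indegree $1$. Its leaves are the sinks (vertices of outdegree $0$). The depth of a vertex $v$ is the number of edges in the unique path from $v_0$ to $v$ (so $v_0$ has depth $0$). The number of children of a non-leaf vertex is its outdegree. A balanced tree of type $(\{n_{c,i}\}_{i=1}^{d},d)$ is a rooted tree in which every leaf has depth $d$ and, for each $0\le i\le d-1$, every vertex of depth $i$ has exactly $n_{c,i+1}$ children. **Cylinders of a circle.** For $k\ge 2$, a cylinder in $\mathbb{R}^k$ of a circle $C\subset\mathbb{R}^2$ is any subset of $\mathbb{R}^k$ obtained from $C\times\mathbb{R}^{k-2}\subset\mathbb{R}^2\times\mathbb{R}^{k-2}=\mathbb{R}^k$ by a finite composition of translations, rotations around points, and reflections (i.e. by a Euclidean isometry of $\mathbb{R}^k$). It is a non-singular real algebraic hypersurface, the zero set of a real polynomial of degree $2$. **RA-regions.** Let $\overline{D}$ denote the closure of $D$ in $\mathbb{R}^k$. An RA-region of $\mathbb{R}^k$ is a pair $(D,\{S_j\}_{j=1}^{l})$ where $D\subset\mathbb{R}^k$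 is a non-empty connected open set and each $S_j$ is a non-singular real algebraic hypersurface of $\mathbb{R}^k$, which is a union of some connected components of the zero set of a real polynomial $f_j$, with $S_j\cap\overline{D}\neq\emptyset$ for all $j$, such that: (1) there is an open neighborhood $U_D$ of $\overline{D}$ with $D=U_D\cap\bigcap_{j=1}^{l}\{x\mid f_j(x)>0\}$ and $U_D\cap S_j=U_D\cap\{x\mid f_j(x)=0\}$ for every $j$; (2) (transversality) for all indices $1\le i_1<\cdots<i_{l'}\le l$ and every point $p\in\overline{D}\cap\bigcap_{j=1}^{l'}S_{i_j}$, one has $\dim\bigcap_{j=1}^{l'}T_pS_{i_j}=k-l'$. **Poincaré-Reeb digraph.** Let $(D,\{S_j\}_{j=1}^l)$ be an RA-region of $\mathbb{R}^k$ with $\overline{D}$ compact, and let $\pi_{k,1}:\mathbb{R}^k\to\mathbb{R}$ be the projection to the first coordinate. Declare two points of $\overline{D}$ equivalent if they lie in the same connected component of some level set of $\pi_{k,1}|_{\overline{D}}$. Let $PR_{(D,\{S_j\}_{j=1}^l)}$ be the quotient space, $q:\overline{D}\to PR_{(D,\{S_j\}_{j=1}^l)}$ the quotient map, and $\overline{\pi_{(D,\{S_j\}_{j=1}^l)}}:PR_{(D,\{S_j\}_{j=1}^l)}\to\mathbb{R}$ the unique continuous function with $\pi_{k,1}|_{\overline{D}}=\overline{\pi_{(D,\{S_j\}_{j=1}^l)}}\circ q$. A point $p\in\overline{D}$ is called singular if either (a) $p$ lies in exactly $l'<k$ of the hypersurfaces, say $S_{i_1},\dots,S_{i_{l'}}$,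 and $p$ is a critical point of the restriction of $\pi_{k,1}$ to the $(k-l')$-dimensional manifold consisting of all points of $\overline{D}$ contained in $S_{i_1},\dots,S_{i_{l'}}$ and in no other $S_j$; or (b) $p$ lies in $k$ of the hypersurfaces $S_j$. The space $PR_{(D,\{S_j\}_{j=1}^l)}$ has the structure of a graph whose vertices are exactly the points corresponding to components of level sets containing at least one singular point; this is the Poincaré-Reeb graph. The function $\overline{\pi_{(D,\{S_j\}_{j=1}^l)}}$ is injective on each edge; orienting each edge from its endpoint with the smaller value to its endpoint with the larger value gives the Poincaré-Reeb digraph. *)

theory Defs
  imports "HOL-Analysis.Analysis" "HOL-Library.Function_Algebras"
begin

text \<open>
  The dimension \<open>k\<close> is quantified inside the theorem, so \<open>\<real>\<^sup>k\<close> is the library space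
  \<^term>\<open>Euclidean_space k\<close>: functions \<open>nat \<Rightarrow> real\<close> vanishing outside \<open>{..<k}\<close>. The
  coordinates are numbered from \<open>0\<close>, so the first coordinate of \<open>x\<close> is \<open>x 0\<close>.
  The pointwise vector space structure makes the library's \<^const>\<open>dim\<close> available.
\<close>

instantiation "fun" :: (type, real_vector) real_vector
begin

definition scaleR_fun :: "real \<Rightarrow> ('a \<Rightarrow> 'b) \<Rightarrow> 'a \<Rightarrow> 'b"
  where "scaleR_fun c f = (\<lambda>x. c *\<^sub>R f x)"

instance
  by standard (simp_all add: scaleR_fun_def fun_eq_iff scaleR_add_right scaleR_add_left)

end

section \<open>Topological graphs and digraphs\<close>

text \<open>
  The open 1-cells of a finite 1-dimensional CW complex are the connected components of the
  complement of its vertex set.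
\<close>

definition edges :: "'a topology \<Rightarrow> 'a set \<Rightarrow> 'a set set"
  where "edges X V = connected_components_of (subtopology X (topspace X - V))"

definition endpoints :: "'a topology \<Rightarrow> 'a set \<Rightarrow> 'a set"
  where "endpoints X e = X closure_of e - e"

text \<open>The map \<open>\<phi>\<close> is the characteristic map of the cell \<open>e\<close>.\<close>

definition one_cell :: "'a topology \<Rightarrow> 'a set \<Rightarrow> 'a set \<Rightarrow> bool"
  where "one_cell X V e \<longleftrightarrow>
    (\<exists>\<phi>. continuous_map (top_of_set {-1..1::real}) X \<phi> \<and> inj_on \<phi> {-1<..<1} \<and>
         \<phi> ` {-1<..<1} = e \<and> \<phi> ` {-1, 1} \<subseteq> V)"

text \<open>For finitely many cells the closure-finiteness and weak topology axioms are automatic.\<close>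

definition graph :: "'a topology \<Rightarrow> 'a set \<Rightarrow> bool"
  where "graph X V \<longleftrightarrow>
    Hausdorff_space X \<and> connected_space X \<and> finite V \<and> V \<subseteq> topspace X \<and>
    finite (edges X V) \<and> edges X V \<noteq> {} \<and>
    (\<forall>e \<in> edges X V. one_cell X V e \<and>
       subtopology X (X closure_of e) homeomorphic_space top_of_set {-1..1::real})"

text \<open>
  A triple \<open>(u, e, w)\<close> in \<open>garcs\<close> says that the edge \<open>e\<close> is oriented from its endpoint \<open>u\<close> to
  its endpoint \<open>w\<close>.
\<close>

record 'a tdigraph =
  gspace :: "'a topology"
  gverts :: "'a set"
  garcs :: "('a \<times> 'a set \<times> 'a) set"

abbreviation gedges :: "'a tdigraph \<Rightarrow> 'a set set"
  where "gedges G \<equiv> edges (gspace G) (gverts G)"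

definition digraph :: "'a tdigraph \<Rightarrow> bool"
  where "digraph G \<longleftrightarrow>
    graph (gspace G) (gverts G) \<and>
    (\<forall>(u, e, w) \<in> garcs G. e \<in> gedges G \<and> endpoints (gspace G) e = {u, w}) \<and>
    (\<forall>e \<in> gedges G. \<exists>!(u, w). (u, e, w) \<in> garcs G)"

definition digraph_isomorphic :: "'a tdigraph \<Rightarrow> 'b tdigraph \<Rightarrow> bool"
  where "digraph_isomorphic G H \<longleftrightarrow>
    (\<exists>h. homeomorphic_map (gspace G) (gspace H) h \<and> h ` gverts G = gverts H \<and>
         (\<lambda>(u, e, w). (h u, h ` e, h w)) ` garcs G = garcs H)"

section \<open>Balanced trees\<close>

text \<open>The first Betti number of a connected finite graph, by its Euler characteristic.\<close>

definition betti1 :: "'a tdigraph \<Rightarrow> int"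
  where "betti1 G = int (card (gedges G)) - int (card (gverts G)) + 1"

definition outdegree :: "'a tdigraph \<Rightarrow> 'a \<Rightarrow> nat"
  where "outdegree G v = card {(u, e, w) \<in> garcs G. u = v}"

definition adjacent :: "'a tdigraph \<Rightarrow> 'a rel"
  where "adjacent G = {(u, w). \<exists>e. (u, e, w) \<in> garcs G \<or> (w, e, u) \<in> garcs G}"

text \<open>In a tree the unique path from \<open>r\<close> to \<open>v\<close> is the shortest walk from \<open>r\<close> to \<open>v\<close>.\<close>

definition depth :: "'a tdigraph \<Rightarrow> 'a \<Rightarrow> 'a \<Rightarrow> nat"
  where "depth G r v = (LEAST m. (r, v) \<in> adjacent G ^^ m)"

definition rooted_tree :: "'a tdigraph \<Rightarrow> 'a \<Rightarrow> bool"
  where "rooted_tree G r \<longleftrightarrow>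
    digraph G \<and> betti1 G = 0 \<and> card (gverts G) > 1 \<and> r \<in> gverts G \<and>
    (\<forall>(u, e, w) \<in> garcs G. depth G r w = Suc (depth G r u))"

definition balanced_tree :: "'a tdigraph \<Rightarrow> 'a \<Rightarrow> (nat \<Rightarrow> nat) \<Rightarrow> nat \<Rightarrow> bool"
  where "balanced_tree G r n d \<longleftrightarrow>
    rooted_tree G r \<and>
    (\<forall>v \<in> gverts G. outdegree G v = 0 \<longrightarrow> depth G r v = d) \<and>
    (\<forall>i<d. \<forall>v \<in> gverts G. depth G r v = i \<longrightarrow> outdegree G v = n (i + 1))"

text \<open>
  \<open>G\<close> arises from \<open>T\<close> by adding one new vertex \<open>w\<close> and one new edge \<open>e\<close> from \<open>w\<close> to \<open>r\<close>.
\<close>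

definition adds_source :: "'a tdigraph \<Rightarrow> 'a \<Rightarrow> 'a tdigraph \<Rightarrow> bool"
  where "adds_source T r G \<longleftrightarrow>
    digraph G \<and>
    (\<exists>w e. w \<notin> gverts T \<and> gverts G = insert w (gverts T) \<and>
           garcs G = insert (w, e, r) (garcs T) \<and>
           gspace T = subtopology (gspace G) (topspace (gspace G) - insert w e))"

section \<open>Cylinders of a circle\<close>

definition euclidean_isometry :: "nat \<Rightarrow> ((nat \<Rightarrow> real) \<Rightarrow> (nat \<Rightarrow> real)) \<Rightarrow> bool"
  where "euclidean_isometry k T \<longleftrightarrow>
    T ` topspace (Euclidean_space k) = topspace (Euclidean_space k) \<and>
    (\<forall>x \<in> topspace (Euclidean_space k). \<forall>y \<in> topspace (Euclidean_space k).
       L2_set (\<lambda>i. T x i - T y i) {..<k} = L2_set (\<lambda>i. x i - y i) {..<k})"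

definition cylinder :: "nat \<Rightarrow> (real \<times> real) set \<Rightarrow> (nat \<Rightarrow> real) set \<Rightarrow> bool"
  where "cylinder k C S \<longleftrightarrow>
    (\<exists>T. euclidean_isometry k T \<and> S = T ` {x \<in> topspace (Euclidean_space k). (x 0, x 1) \<in> C})"

section \<open>RA-regions\<close>

inductive real_polynomial :: "nat \<Rightarrow> ((nat \<Rightarrow> real) \<Rightarrow> real) \<Rightarrow> bool" for k :: nat where
  const: "real_polynomial k (\<lambda>x. c)"
| var: "i < k \<Longrightarrow> real_polynomial k (\<lambda>x. x i)"
| add: "real_polynomial k f \<Longrightarrow> real_polynomial k g \<Longrightarrow> real_polynomial k (\<lambda>x. f x + g x)"
| mult: "real_polynomial k f \<Longrightarrow> real_polynomial k g \<Longrightarrow> real_polynomial k (\<lambda>x. f x * g x)"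

definition partial_deriv :: "nat \<Rightarrow> ((nat \<Rightarrow> real) \<Rightarrow> real) \<Rightarrow> (nat \<Rightarrow> real) \<Rightarrow> real"
  where "partial_deriv i f p = deriv (\<lambda>s. f (p(i := s))) (p i)"

definition nonsingular_hypersurface ::
    "nat \<Rightarrow> ((nat \<Rightarrow> real) \<Rightarrow> real) \<Rightarrow> (nat \<Rightarrow> real) set \<Rightarrow> bool"
  where "nonsingular_hypersurface k f S \<longleftrightarrow>
    real_polynomial k f \<and>
    (\<exists>\<C> \<subseteq> connected_components_of
             (subtopology (Euclidean_space k) {x \<in> topspace (Euclidean_space k). f x = 0}).
       S = \<Union>\<C>) \<and>
    (\<forall>p \<in> S. \<exists>i<k. partial_deriv i f p \<noteq> 0)"

text \<open>The velocities at \<open>p\<close> of \<open>C\<^sup>1\<close> curves in the submanifold \<open>M\<close> passing through \<open>p\<close>.\<close>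

definition tangent_space :: "(nat \<Rightarrow> real) set \<Rightarrow> (nat \<Rightarrow> real) \<Rightarrow> (nat \<Rightarrow> real) set"
  where "tangent_space M p =
    {v. \<exists>\<gamma> \<gamma>' \<epsilon>. \<epsilon> > 0 \<and> \<gamma> 0 = p \<and> \<gamma>' 0 = v \<and>
          (\<forall>s \<in> {-\<epsilon><..<\<epsilon>::real}. \<gamma> s \<in> M) \<and>
          (\<forall>i. \<forall>s \<in> {-\<epsilon><..<\<epsilon>}. ((\<lambda>s. \<gamma> s i) has_real_derivative \<gamma>' s i) (at s)) \<and>
          (\<forall>i. continuous_on {-\<epsilon><..<\<epsilon>} (\<lambda>s. \<gamma>' s i))}"

definition ra_region ::
    "nat \<Rightarrow> nat \<Rightarrow> (nat \<Rightarrow> real) set \<Rightarrow> (nat \<Rightarrow> (nat \<Rightarrow> real) set) \<Rightarrow> bool"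
  where "ra_region k l D S \<longleftrightarrow>
    D \<noteq> {} \<and> openin (Euclidean_space k) D \<and> connectedin (Euclidean_space k) D \<and>
    (\<exists>f. (\<forall>j \<in> {1..l}. nonsingular_hypersurface k (f j) (S j) \<and>
                       S j \<inter> Euclidean_space k closure_of D \<noteq> {}) \<and>
         (\<exists>U. openin (Euclidean_space k) U \<and> Euclidean_space k closure_of D \<subseteq> U \<and>
              D = U \<inter> {x. \<forall>j \<in> {1..l}. f j x > 0} \<and>
              (\<forall>j \<in> {1..l}. U \<inter> S j = U \<inter> {x. f j x = 0}))) \<and>
    (\<forall>I p. I \<subseteq> {1..l} \<and> I \<noteq> {} \<and> p \<in> Euclidean_space k closure_of D \<inter> (\<Inter>j\<in>I. S j) \<longrightarrow>
       int (dim (\<Inter>j\<in>I. tangent_space (S j) p)) = int k - int (card I))"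

section \<open>Poincare-Reeb digraphs\<close>

definition quotient_topology :: "'a topology \<Rightarrow> ('a \<Rightarrow> 'b) \<Rightarrow> 'b topology"
  where "quotient_topology X q =
    topology (\<lambda>W. W \<subseteq> q ` topspace X \<and> openin X {x \<in> topspace X. q x \<in> W})"

lemma openin_quotient_topology:
  "openin (quotient_topology X q) W \<longleftrightarrow>
     W \<subseteq> q ` topspace X \<and> openin X {x \<in> topspace X. q x \<in> W}"
proof -
  have "istopology (\<lambda>W. W \<subseteq> q ` topspace X \<and> openin X {x \<in> topspace X. q x \<in> W})"
    unfolding istopology_def
  proof (intro conjI allI impI; (elim conjE)?)
    fix S T
    assume S: "openin X {x \<in> topspace X. q x \<in> S}" and T: "openin X {x \<in> topspace X. q x \<in> T}"
    have "{x \<in> topspace X. q x \<in> S \<inter> T} =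
        {x \<in> topspace X. q x \<in> S} \<inter> {x \<in> topspace X. q x \<in> T}" by blast
    then show "openin X {x \<in> topspace X. q x \<in> S \<inter> T}"
      using openin_Int[OF S T] by (rule ssubst)
  next
    fix \<K> assume *: "\<forall>K\<in>\<K>. K \<subseteq> q ` topspace X \<and> openin X {x \<in> topspace X. q x \<in> K}"
    have eq: "{x \<in> topspace X. q x \<in> \<Union>\<K>} = (\<Union>K\<in>\<K>. {x \<in> topspace X. q x \<in> K})" by blast
    have "openin X (\<Union>K\<in>\<K>. {x \<in> topspace X. q x \<in> K})"
      by (rule openin_Union) (use * in blast)
    with eq show "openin X {x \<in> topspace X. q x \<in> \<Union>\<K>}" by (rule ssubst)
  qed blast+
  then show ?thesis
    by (simp add: quotient_topology_def topology_inverse')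
qed

lemma topspace_quotient_topology: "topspace (quotient_topology X q) = q ` topspace X"
proof
  show "topspace (quotient_topology X q) \<subseteq> q ` topspace X"
    using openin_quotient_topology[of X q] openin_topspace by blast
  have "{x \<in> topspace X. q x \<in> q ` topspace X} = topspace X" by blast
  then have "openin (quotient_topology X q) (q ` topspace X)"
    by (simp add: openin_quotient_topology)
  then show "q ` topspace X \<subseteq> topspace (quotient_topology X q)"
    by (rule openin_subset)
qed

lemma quotient_map_quotient_topology: "quotient_map X (quotient_topology X q) q"
  by (simp add: quotient_map_def topspace_quotient_topology openin_quotient_topology)

text \<open>
  A point of the Poincare-Reeb space is an equivalence class, that is, a connected component of
  a level set of the first coordinate on the closure of \<open>D\<close>.
\<close>

definition reeb_class :: "nat \<Rightarrow> (nat \<Rightarrow> real) set \<Rightarrow> (nat \<Rightarrow> real) \<Rightarrow> (nat \<Rightarrow> real) set"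
  where "reeb_class k D x =
    connected_component_of_set
      (subtopology (Euclidean_space k) {y \<in> Euclidean_space k closure_of D. y 0 = x 0}) x"

definition reeb_space :: "nat \<Rightarrow> (nat \<Rightarrow> real) set \<Rightarrow> (nat \<Rightarrow> real) set topology"
  where "reeb_space k D =
    quotient_topology (subtopology (Euclidean_space k) (Euclidean_space k closure_of D))
      (reeb_class k D)"

definition reeb_value :: "(nat \<Rightarrow> real) set \<Rightarrow> real"
  where "reeb_value c = the_elem ((\<lambda>x. x 0) ` c)"

lemma reeb_value_reeb_class:
  assumes "x \<in> Euclidean_space k closure_of D"
  shows "reeb_value (reeb_class k D x) = x 0"
proof -
  let ?Y = "subtopology (Euclidean_space k) {y \<in> Euclidean_space k closure_of D. y 0 = x 0}"
  have "x \<in> topspace ?Y"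
    using assms closure_of_subset_topspace[of "Euclidean_space k" D] by auto
  then have "x \<in> reeb_class k D x"
    by (simp add: reeb_class_def connected_component_of_refl)
  moreover have "reeb_class k D x \<subseteq> topspace ?Y"
    unfolding reeb_class_def by (rule connected_component_of_subset_topspace)
  ultimately have "(\<lambda>y. y 0) ` reeb_class k D x = {x 0}" by auto
  then show ?thesis by (simp add: reeb_value_def)
qed

definition incident :: "nat \<Rightarrow> (nat \<Rightarrow> (nat \<Rightarrow> real) set) \<Rightarrow> (nat \<Rightarrow> real) \<Rightarrow> nat set"
  where "incident l S p = {j \<in> {1..l}. p \<in> S j}"

definition stratum ::
    "nat \<Rightarrow> nat \<Rightarrow> (nat \<Rightarrow> real) set \<Rightarrow> (nat \<Rightarrow> (nat \<Rightarrow> real) set) \<Rightarrow> nat set \<Rightarrow> (nat \<Rightarrow> real) set"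
  where "stratum k l D S I = {x \<in> Euclidean_space k closure_of D. incident l S x = I}"

text \<open>
  The differential at \<open>p\<close> of the first coordinate restricted to \<open>M\<close> is \<open>v \<mapsto> v 0\<close> on the
  tangent space of \<open>M\<close>.
\<close>

definition critical_point :: "(nat \<Rightarrow> real) set \<Rightarrow> (nat \<Rightarrow> real) \<Rightarrow> bool"
  where "critical_point M p \<longleftrightarrow> p \<in> M \<and> (\<forall>v \<in> tangent_space M p. v 0 = 0)"

definition singular_point ::
    "nat \<Rightarrow> nat \<Rightarrow> (nat \<Rightarrow> real) set \<Rightarrow> (nat \<Rightarrow> (nat \<Rightarrow> real) set) \<Rightarrow> (nat \<Rightarrow> real) \<Rightarrow> bool"
  where "singular_point k l D S p \<longleftrightarrow>
    p \<in> Euclidean_space k closure_of D \<and>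
    (card (incident l S p) < k \<and> critical_point (stratum k l D S (incident l S p)) p \<or>
     card (incident l S p) \<ge> k)"

definition reeb_vertices ::
    "nat \<Rightarrow> nat \<Rightarrow> (nat \<Rightarrow> real) set \<Rightarrow> (nat \<Rightarrow> (nat \<Rightarrow> real) set) \<Rightarrow> (nat \<Rightarrow> real) set set"
  where "reeb_vertices k l D S =
    {c \<in> topspace (reeb_space k D). \<exists>p \<in> c. singular_point k l D S p}"

definition reeb_digraph ::
    "nat \<Rightarrow> nat \<Rightarrow> (nat \<Rightarrow> real) set \<Rightarrow> (nat \<Rightarrow> (nat \<Rightarrow> real) set) \<Rightarrow> (nat \<Rightarrow> real) set tdigraph"
  where "reeb_digraph k l D S =
    \<lparr> gspace = reeb_space k D,
      gverts = reeb_vertices k l D S,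
      garcs = {(u, e, w). e \<in> edges (reeb_space k D) (reeb_vertices k l D S) \<and>
                          endpoints (reeb_space k D) e = {u, w} \<and> reeb_value u < reeb_value w} \<rparr>"

end

theory Submission
  imports Defs
begin

text \<open>
  Write \<open>u i = t (i + 1)\<close>. In \<open>\<real>\<^sup>d\<^sup>+\<^sup>2\<close> every cylinder is a circle of radius \<open>R\<close> in the plane of the
  coordinates \<open>0\<close> and \<open>i\<close>, for some \<open>1 \<le> i \<le> d + 1\<close>, so each level set of the first coordinate is a
  product of subsets of \<open>\<real>\<close>, and its components are boxes. For \<open>i \<le> d\<close> the \<open>i\<close>-th factor is a single
  interval up to the level \<open>u i\<close>, where \<open>n i - 1\<close> removed discs begin and cut it into \<open>n i\<close>
  intervals; for large \<open>R\<close> these discs stay thin and disjoint on the whole range of levels. The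
  last factor is an interval which shrinks to a point over \<open>u 0\<close> and \<open>u (d + 1)\<close>. Hence a component
  of the level set over \<open>s\<close> is given by the branches chosen at the levels \<open>u i < s\<close>, which is also
  the description of the points of the tree. Singular points occur exactly at the leftmost points
  of the removed discs and over \<open>u 0\<close> and \<open>u (d + 1)\<close>.
\<close>

section \<open>Edges of topological graphs\<close>

text \<open>The count of cylinders dictates the design: a plane with \<open>n i\<close> branches
  uses its \<open>n i - 1\<close> removed discs and two large discs that bound the factor, and the
  last plane uses two more. In every plane but the last the admissible set shrinks as the height
  grows, so sliding a point down turns its weak inequalities into strict ones. This gives both the
  density of the open region in its closure and its connectedness. Transversality could fail only
  where two walls through a point share a plane, or where a circle has its tangent perpendicular to
  the first axis. The former happens only over the two ends, the latter only over the levels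
  \<open>u 1\<close>, ..., \<open>u d\<close>. The levels are distinct, so the two never meet, and
  no two planes have such a tangent at the same point. The digraph \<open>G\<close> is an arbitrary
  topological model of the tree, and the Reeb space is never analysed as a graph by hand. Both are
  exhibited as quotients of one compact set with the same fibres, hence are homeomorphic; vertices
  and edges are then carried over, and orientations are compared by height.\<close>

lemma Union_edges: "\<Union>(edges X V) = topspace X - V"
  by (auto simp: edges_def Union_connected_components_of)

lemma edges_disjoint:
  assumes "e \<in> edges X V" "e' \<in> edges X V" "x \<in> e" "x \<in> e'"
  shows "e = e'"
  using assms connected_components_of_overlap[of e _ e'] unfolding edges_def by blast

text \<open>Compactness of the interval and the Hausdorff property make the image of the closed
  interval closed, so it is the closure of \<open>e\<close>. Since \<open>e\<close> misses
  \<open>V\<close>, what the closure adds to \<open>e\<close> is exactly the images of -1 and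
  1.\<close>

lemma graph_edge_parametrization:
  assumes "graph X V" "e \<in> edges X V"
  obtains \<phi> where "continuous_map (top_of_set {-1..1::real}) X \<phi>" "inj_on \<phi> {-1<..<1}"
    "\<phi> ` {-1<..<1} = e" "endpoints X e = {\<phi> (-1), \<phi> 1}" "{\<phi> (-1), \<phi> 1} \<subseteq> V"
proof -
  have "one_cell X V e" using assms unfolding graph_def by blast
  then obtain \<phi> where \<phi>: "continuous_map (top_of_set {-1..1::real}) X \<phi>"
    "inj_on \<phi> {-1<..<1}" "\<phi> ` {-1<..<1} = e" "\<phi> ` {-1, 1} \<subseteq> V"
    unfolding one_cell_def by (elim exE conjE)
  have eV: "e \<inter> V = {}" using Union_edges[of X V] assms(2) by blast
  have "compactin X (\<phi> ` {-1..1})"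
    by (rule image_compactin[OF _ \<phi>(1)]) (simp add: compactin_subtopology)
  then have "closedin X (\<phi> ` {-1..1})"
    using assms(1) compactin_imp_closedin unfolding graph_def by blast
  moreover have "e \<subseteq> \<phi> ` {-1..1}" unfolding \<phi>(3)[symmetric] by (intro image_mono) auto
  ultimately have sub: "X closure_of e \<subseteq> \<phi> ` {-1..1}" by (rule closure_of_minimal[rotated])
  have "\<phi> ` (top_of_set {-1..1} closure_of {-1<..<1}) \<subseteq> X closure_of e"
    using continuous_map_image_closure_subset[OF \<phi>(1), of "{-1<..<1}"] \<phi>(3) by simp
  moreover have "top_of_set {-1..1::real} closure_of {-1<..<1} = {-1..1}"
  proof -
    have "{-1..1::real} \<inter> {-1<..<1} = {-1<..<1}" by auto
    then show ?thesis by (subst closure_of_subtopology) simp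
  qed
  ultimately have cl: "X closure_of e = \<phi> ` {-1..1}" using sub by auto
  have "{-1..1::real} = {-1<..<1} \<union> {-1,1}" by auto
  then have "\<phi> ` {-1..1} = e \<union> {\<phi> (-1), \<phi> 1}" using \<phi>(3) by (simp add: image_Un)
  then have "endpoints X e = {\<phi> (-1), \<phi> 1}"
    unfolding endpoints_def cl using eV \<phi>(4) by auto
  moreover have "{\<phi> (-1), \<phi> 1} \<subseteq> V" using \<phi>(4) by simp
  ultimately show thesis by (rule that[OF \<phi>(1-3)])
qed

lemma endpoints_subset_vertices: "graph X V \<Longrightarrow> e \<in> edges X V \<Longrightarrow> endpoints X e \<subseteq> V"
  using graph_edge_parametrization by metis

lemma closure_of_edge:
  assumes "graph X V" "e \<in> edges X V"
  shows "X closure_of e = e \<union> endpoints X e"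
proof -
  have "e \<subseteq> topspace X" using Union_edges[of X V] assms(2) by blast
  then show ?thesis unfolding endpoints_def using closure_of_subset by blast
qed

lemma digraph_arc:
  assumes "digraph G" "(u, e, w) \<in> garcs G"
  shows "e \<in> gedges G" "endpoints (gspace G) e = {u, w}" "u \<in> gverts G" "w \<in> gverts G"
proof -
  show e: "e \<in> gedges G" and ep: "endpoints (gspace G) e = {u, w}"
    using assms unfolding digraph_def by blast+
  show "u \<in> gverts G" "w \<in> gverts G"
    using endpoints_subset_vertices[OF _ e] assms(1) ep unfolding digraph_def by auto
qed

lemma digraph_arc_unique:
  assumes "digraph G" "(u, e, w) \<in> garcs G" "(u', e, w') \<in> garcs G"
  shows "u = u'" "w = w'"
proof -
  have "\<exists>!(u, w). (u, e, w) \<in> garcs G"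
    using assms(1) digraph_arc(1)[OF assms(1,2)] unfolding digraph_def by simp
  then show "u = u'" "w = w'" using assms(2,3) by auto
qed

lemma digraph_edge_arc:
  assumes "digraph G" "e \<in> gedges G"
  obtains u w where "(u, e, w) \<in> garcs G"
proof -
  have "\<exists>!(u, w). (u, e, w) \<in> garcs G" using assms unfolding digraph_def by simp
  then show thesis using that by auto
qed

text \<open>Lets arcs be counted by the Euler characteristic, which speaks of edges.\<close>

lemma bij_betw_arcs_edges:
  assumes "digraph G"
  shows "bij_betw (\<lambda>(u, e, w). e) (garcs G) (gedges G)"
  unfolding bij_betw_def inj_on_def
  using digraph_arc(1)[OF assms] digraph_arc_unique[OF assms] digraph_edge_arc[OF assms]
  by (auto simp: image_iff) (metis (mono_tags, lifting) case_prod_conv)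

lemma finite_garcs: "digraph G \<Longrightarrow> finite (garcs G)"
  using bij_betw_finite[OF bij_betw_arcs_edges] unfolding digraph_def graph_def by blast

text \<open>Distinct ends outside the open edge extend injectivity of the characteristic map to the
  closed interval.\<close>

lemma digraph_arc_parametrization:
  assumes "digraph G" "(u, e, w) \<in> garcs G" "u \<noteq> w"
  obtains \<phi> where "continuous_map (top_of_set {0..1::real}) (gspace G) \<phi>" "inj_on \<phi> {0..1}"
    "\<phi> ` {0<..<1} = e" "\<phi> 0 = u" "\<phi> 1 = w"
proof -
  have gr: "graph (gspace G) (gverts G)" using assms(1) unfolding digraph_def by blast
  note arc = digraph_arc[OF assms(1,2)]
  obtain \<psi> where \<psi>: "continuous_map (top_of_set {-1..1::real}) (gspace G) \<psi>"
    "inj_on \<psi> {-1<..<1}" "\<psi> ` {-1<..<1} = e" "{u, w} = {\<psi> (-1), \<psi> 1}"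
    using graph_edge_parametrization[OF gr arc(1)] arc(2) by metis
  have uwe: "u \<notin> e" "w \<notin> e" using arc Union_edges[of "gspace G" "gverts G"] by blast+
  have inj: "inj_on \<psi> {-1..1}"
  proof -
    have *: "{-1..1::real} = insert (-1) (insert 1 {-1<..<1})" by auto
    show ?thesis unfolding *
      using \<psi>(2) \<psi>(3) uwe \<psi>(4) assms(3)
      by (auto simp: inj_on_insert doubleton_eq_iff image_iff)
  qed
  note result = that
  \<comment> \<open>The characteristic map may run against the orientation of the arc;
    \<open>c = -1\<close> reverses it.\<close>
  have lin: thesis
    if c: "c = 1 \<or> c = -1" and ends: "\<psi> (-c) = u" "\<psi> c = w" for c :: real
  proof (rule result)
    let ?h = "\<lambda>x::real. c * (2 * x - 1)"
    have h: "?h ` {0..1} \<subseteq> {-1..1}" using c by auto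
    have "continuous_map (top_of_set {0..1}) (top_of_set {-1..1}) ?h"
      using h by (auto intro!: continuous_intros simp: continuous_map_in_subtopology image_subset_iff)
    then show "continuous_map (top_of_set {0..1::real}) (gspace G) (\<psi> \<circ> ?h)"
      using continuous_map_compose \<psi>(1) by blast
    have "inj_on ?h {0..1}" using c by (auto simp: inj_on_def)
    then show "inj_on (\<psi> \<circ> ?h) {0..1}"
      using comp_inj_on inj_on_subset[OF inj h] by blast
    have "?h ` {0<..<1} = {-1<..<1}"
    proof (intro equalityI subsetI)
      fix y :: real assume "y \<in> {-1<..<1}"
      then show "y \<in> ?h ` {0<..<1}"
        using c by (intro image_eqI[of _ _ "(c * y + 1) / 2"]) (auto simp: field_simps)
    qed (use c in auto)
    then show "(\<psi> \<circ> ?h) ` {0<..<1} = e" unfolding image_comp[symmetric] using \<psi>(3) by simp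
    show "(\<psi> \<circ> ?h) 0 = u" "(\<psi> \<circ> ?h) 1 = w" using ends by auto
  qed
  from \<psi>(4) have "(\<psi> (-1) = u \<and> \<psi> 1 = w) \<or> (\<psi> 1 = u \<and> \<psi> (-1) = w)"
    by (auto simp: doubleton_eq_iff)
  then show thesis using lin[of 1] lin[of "-1"] by auto
qed

text \<open>Transfers connectedness from the space to the combinatorial graph: the vertices
  reachable from \<open>r\<close> and the other vertices, each with the edges between them, would
  split the space into two nonempty closed sets.\<close>

lemma digraph_vertices_connected:
  assumes "digraph G" "r \<in> gverts G" "v \<in> gverts G"
  shows "(r, v) \<in> (adjacent G)\<^sup>*"
proof (rule ccontr)
  assume nv: "(r, v) \<notin> (adjacent G)\<^sup>*"
  let ?X = "gspace G" and ?V = "gverts G"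
  have gr: "graph ?X ?V" using assms(1) unfolding digraph_def by blast
  define A where "A = {x \<in> ?V. (r, x) \<in> (adjacent G)\<^sup>*}"
  have dich: "endpoints ?X e \<subseteq> A \<or> endpoints ?X e \<subseteq> ?V - A" if e: "e \<in> gedges G" for e
  proof -
    obtain x y where xy: "(x, e, y) \<in> garcs G" by (rule digraph_edge_arc[OF assms(1) e])
    then have "(x, y) \<in> adjacent G" "(y, x) \<in> adjacent G" unfolding adjacent_def by blast+
    then have "(r, x) \<in> (adjacent G)\<^sup>* \<longleftrightarrow> (r, y) \<in> (adjacent G)\<^sup>*"
      by (meson rtrancl.rtrancl_into_rtrancl)
    then show ?thesis using digraph_arc[OF assms(1) xy] unfolding A_def by auto
  qed
  have ne: "endpoints ?X e \<noteq> {}" if "e \<in> gedges G" for e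
    using graph_edge_parametrization[OF gr that] by (metis insert_not_empty)
  \<comment> \<open>\<open>P B\<close> is closed because it is a finite union of points and of
    closures of edges. No edge lies in both pieces, as every edge has an endpoint.\<close>
  define P where "P B = B \<union> \<Union>{e \<in> gedges G. endpoints ?X e \<subseteq> B}" for B
  have clP: "closedin ?X (P B)" if "B \<subseteq> ?V" for B
  proof -
    have "P B = B \<union> (\<Union>e\<in>{e \<in> gedges G. endpoints ?X e \<subseteq> B}. ?X closure_of e)"
      unfolding P_def using closure_of_edge[OF gr] by auto
    moreover have "closedin ?X B"
    proof (rule compactin_imp_closedin)
      show "Hausdorff_space ?X" using gr unfolding graph_def by blast
      have "finite B" "B \<subseteq> topspace ?X"
        using gr that finite_subset unfolding graph_def by blast+
      then show "compactin ?X B" by (simp add: finite_imp_compactin)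
    qed
    moreover have "finite {e \<in> gedges G. endpoints ?X e \<subseteq> B}"
      using gr unfolding graph_def by simp
    ultimately show ?thesis by (auto intro!: closedin_Un closedin_Union)
  qed
  have un: "P A \<union> P (?V - A) = topspace ?X"
  proof -
    have "P A \<union> P (?V - A) = ?V \<union> \<Union>(gedges G)"
      unfolding P_def using dich A_def by blast
    also have "\<dots> = topspace ?X"
      using gr unfolding graph_def Union_edges by blast
    finally show ?thesis .
  qed
  have "P A \<inter> P (?V - A) = {}"
  proof (rule ccontr)
    assume "P A \<inter> P (?V - A) \<noteq> {}"
    then obtain x where x: "x \<in> P A" "x \<in> P (?V - A)" by blast
    have AV: "A \<subseteq> ?V" unfolding A_def by blast
    show False
    proof (cases "x \<in> ?V")
      case True
      then have "x \<notin> e" if "e \<in> gedges G" for e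
        using Union_edges[of ?X ?V] that by blast
      then show False using x AV unfolding P_def by blast
    next
      case False
      then obtain e e' where "e \<in> gedges G" "e' \<in> gedges G" "x \<in> e" "x \<in> e'"
        "endpoints ?X e \<subseteq> A" "endpoints ?X e' \<subseteq> ?V - A"
        using x AV unfolding P_def by blast
      then show False using edges_disjoint[of e ?X ?V e' x] ne[of e] by blast
    qed
  qed
  moreover have "r \<in> P A" "v \<in> P (?V - A)"
    using nv assms unfolding P_def A_def by auto
  moreover have "connected_space ?X" using gr unfolding graph_def by blast
  moreover have "closedin ?X (P A)" "closedin ?X (P (?V - A))"
    by (auto intro: clP simp: A_def)
  ultimately show False using un unfolding connected_space_closedin_eq by blast
qed

section \<open>Balanced trees\<close>

lemma rooted_tree_depth:
  assumes "rooted_tree G r" "v \<in> gverts G"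
  shows "(r, v) \<in> adjacent G ^^ depth G r v"
proof -
  have "(r, v) \<in> (adjacent G)\<^sup>*"
    using digraph_vertices_connected assms unfolding rooted_tree_def by metis
  then obtain m where "(r, v) \<in> adjacent G ^^ m" using rtrancl_power by blast
  then show ?thesis unfolding depth_def by (rule LeastI)
qed

lemma depth_le: "(r, v) \<in> adjacent G ^^ m \<Longrightarrow> depth G r v \<le> m"
  unfolding depth_def by (rule Least_le)

lemma depth_root: "depth G r r = 0"
  using depth_le[of r r 0 G] by simp

lemma rooted_tree_depth_0:
  assumes "rooted_tree G r" "v \<in> gverts G" "depth G r v = 0"
  shows "v = r"
  using rooted_tree_depth[OF assms(1,2)] assms(3) by simp

lemma rooted_tree_arc_depth:
  "rooted_tree G r \<Longrightarrow> (u, e, w) \<in> garcs G \<Longrightarrow> depth G r w = Suc (depth G r u)"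
  unfolding rooted_tree_def by blast

text \<open>The last step of a shortest walk from the root goes along an arc and not against one:
  arcs raise the depth by one, so a step against an arc would start at a vertex deeper than
  \<open>v\<close>.\<close>

lemma rooted_tree_incoming_arc:
  assumes "rooted_tree G r" "v \<in> gverts G" "v \<noteq> r"
  obtains u e where "(u, e, v) \<in> garcs G"
proof -
  obtain m where m: "depth G r v = Suc m"
    using rooted_tree_depth_0[OF assms(1,2)] assms(3) not0_implies_Suc by blast
  have "(r, v) \<in> adjacent G ^^ Suc m" using rooted_tree_depth[OF assms(1,2)] m by simp
  then obtain x where x: "(r, x) \<in> adjacent G ^^ m" "(x, v) \<in> adjacent G" by auto
  have "depth G r x \<le> m" using depth_le[OF x(1)] .
  then have "(v, e, x) \<notin> garcs G" for e
    using rooted_tree_arc_depth[OF assms(1), of v e x] m by auto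
  then show thesis using x(2) that unfolding adjacent_def by blast
qed

text \<open>The heads of the arcs cover all vertices but the root, and by the Euler characteristic
  there are exactly as many arcs as such vertices.\<close>

lemma rooted_tree_incoming_arc_unique:
  assumes G: "rooted_tree G r" and arcs: "(u, e, w) \<in> garcs G" "(u', e', w) \<in> garcs G"
  shows "(u, e, w) = (u', e', w)"
proof -
  have di: "digraph G" and b: "betti1 G = 0" and r: "r \<in> gverts G"
    using G unfolding rooted_tree_def by auto
  have fin: "finite (gverts G)" using di unfolding digraph_def graph_def by blast
  let ?h = "\<lambda>(u, e, w). w"
  have "card (garcs G) = card (gedges G)" using bij_betw_same_card[OF bij_betw_arcs_edges[OF di]] .
  moreover have "card (gverts G) > 0" using r fin card_gt_0_iff by blast
  ultimately have card: "card (garcs G) = card (gverts G - {r})"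
    using b r fin unfolding betti1_def by simp
  have img: "?h ` garcs G = gverts G - {r}"
  proof (intro equalityI subsetI)
    fix v assume "v \<in> ?h ` garcs G"
    then obtain x e where xe: "(x, e, v) \<in> garcs G" by auto
    show "v \<in> gverts G - {r}"
      using digraph_arc(4)[OF di xe] rooted_tree_arc_depth[OF G xe] depth_root[of G r] by auto
  next
    fix v assume "v \<in> gverts G - {r}"
    then obtain x e where "(x, e, v) \<in> garcs G" using rooted_tree_incoming_arc[OF G, of v] by auto
    then show "v \<in> ?h ` garcs G" by force
  qed
  have "inj_on ?h (garcs G)"
    by (rule eq_card_imp_inj_on[OF finite_garcs[OF di]]) (simp only: img card)
  then show ?thesis using arcs unfolding inj_on_def by fastforce
qed

text \<open>Sinks occur only at depth \<open>d\<close>, so a vertex below that depth would have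
  descendants at every greater depth, against finiteness.\<close>

lemma balanced_tree_depth_le:
  assumes "balanced_tree G r n d" "v \<in> gverts G"
  shows "depth G r v \<le> d"
proof (rule ccontr)
  have G: "rooted_tree G r" using assms(1) unfolding balanced_tree_def by blast
  have di: "digraph G" using G unfolding rooted_tree_def by blast
  have fin: "finite (gverts G)" using di unfolding digraph_def graph_def by blast
  assume "\<not> depth G r v \<le> d"
  then have v: "depth G r v > d" by simp
  have "\<exists>w\<in>gverts G. depth G r w = depth G r v + m" for m
  proof (induction m)
    case (Suc m)
    then obtain w where w: "w \<in> gverts G" "depth G r w = depth G r v + m" by blast
    then have "outdegree G w \<noteq> 0" using assms(1) v unfolding balanced_tree_def by force
    then have "{(u, e, w') \<in> garcs G. u = w} \<noteq> {}"
      unfolding outdegree_def by (metis card.empty)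
    then obtain e x where "(w, e, x) \<in> garcs G" by blast
    then show ?case
      using digraph_arc(4)[OF di] rooted_tree_arc_depth[OF G] w(2) by fastforce
  qed (use assms in auto)
  then have "range (\<lambda>m. depth G r v + m) \<subseteq> depth G r ` gverts G"
    by (metis (no_types, lifting) image_iff image_subset_iff)
  then have "finite (range (\<lambda>m. depth G r v + m))" using fin finite_surj by blast
  moreover have "inj (\<lambda>m. depth G r v + m)" by (simp add: inj_on_def)
  ultimately show False using finite_imageD by fastforce
qed

text \<open>An address lists the branches taken on the way from the root to a leaf. The arc \<open>B a j\<close> is
  the one at depth \<open>j\<close> on that way, where \<open>B a 0\<close> is the arc into the root.\<close>

locale augmented_balanced_tree =
  fixes T G :: "'a tdigraph" and r :: 'a and n :: "nat \<Rightarrow> nat" and d :: nat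
    and z :: 'a and e0 :: "'a set"
  assumes T: "balanced_tree T r n d" and n_pos: "\<And>i. i \<in> {1..d} \<Longrightarrow> n i > 0"
    and G: "digraph G" and z: "z \<notin> gverts T" and verts: "gverts G = insert z (gverts T)"
    and arcs: "garcs G = insert (z, e0, r) (garcs T)"
begin

lemma rooted: "rooted_tree T r"
  using T unfolding balanced_tree_def by blast

lemma digraph_T: "digraph T" and root: "r \<in> gverts T"
  using rooted unfolding rooted_tree_def by auto

definition address :: "(nat \<Rightarrow> nat) \<Rightarrow> bool"
  where "address a \<longleftrightarrow> (\<forall>i\<in>{1..d}. a i < n i)"

text \<open>Any numbering of the arcs leaving \<open>v\<close> will do; fixing one turns paths from
  the root into sequences of numbers.\<close>

definition branch :: "'a \<Rightarrow> nat \<Rightarrow> 'a \<times> 'a set \<times> 'a"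
  where "branch v = (SOME f. bij_betw f {..<outdegree T v} {(u, e, w) \<in> garcs T. u = v})"

lemma bij_betw_branch: "bij_betw (branch v) {..<outdegree T v} {(u, e, w) \<in> garcs T. u = v}"
proof -
  have "finite {(u, e, w) \<in> garcs T. u = v}"
    by (rule finite_subset[OF _ finite_garcs[OF digraph_T]]) auto
  then have "\<exists>f. bij_betw f {..<outdegree T v} {(u, e, w) \<in> garcs T. u = v}"
    unfolding outdegree_def using ex_bij_betw_nat_finite by (simp add: lessThan_atLeast0)
  then show ?thesis unfolding branch_def by (rule someI_ex)
qed

abbreviation tail :: "'a \<times> 'a set \<times> 'a \<Rightarrow> 'a" where "tail x \<equiv> fst x"
abbreviation head :: "'a \<times> 'a set \<times> 'a \<Rightarrow> 'a" where "head x \<equiv> snd (snd x)"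
abbreviation edge :: "'a \<times> 'a set \<times> 'a \<Rightarrow> 'a set" where "edge x \<equiv> fst (snd x)"

primrec B :: "(nat \<Rightarrow> nat) \<Rightarrow> nat \<Rightarrow> 'a \<times> 'a set \<times> 'a" where
  "B a 0 = (z, e0, r)"
| "B a (Suc j) = branch (head (B a j)) (a (Suc j))"

lemma head_B:
  assumes "address a" "j \<le> d"
  shows "head (B a j) \<in> gverts T \<and> depth T r (head (B a j)) = j"
    and "j > 0 \<Longrightarrow> B a j \<in> garcs T \<and> tail (B a j) = head (B a (j - 1))"
proof -
  have "head (B a j) \<in> gverts T \<and> depth T r (head (B a j)) = j \<and>
    (j > 0 \<longrightarrow> B a j \<in> garcs T \<and> tail (B a j) = head (B a (j - 1)))"
    using assms(2)
  proof (induction j)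
    case 0
    then show ?case using root depth_root by simp
  next
    case (Suc j)
    let ?v = "head (B a j)"
    have v: "?v \<in> gverts T" "depth T r ?v = j" using Suc by auto
    then have "outdegree T ?v = n (Suc j)" using T Suc.prems unfolding balanced_tree_def by simp
    moreover have "a (Suc j) < n (Suc j)" using assms(1) Suc.prems unfolding address_def by simp
    ultimately have "branch ?v (a (Suc j)) \<in> {(u, e, w) \<in> garcs T. u = ?v}"
      using bij_betwE[OF bij_betw_branch[of ?v]] by simp
    then obtain e w where ew: "branch ?v (a (Suc j)) = (?v, e, w)" "(?v, e, w) \<in> garcs T"
      by auto
    then show ?case
      using digraph_arc(4)[OF digraph_T ew(2)] rooted_tree_arc_depth[OF rooted ew(2)] v by simp
  qed
  then show "head (B a j) \<in> gverts T \<and> depth T r (head (B a j)) = j"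
    and "j > 0 \<Longrightarrow> B a j \<in> garcs T \<and> tail (B a j) = head (B a (j - 1))" by auto
qed

lemma B_in_garcs: "address a \<Longrightarrow> j \<le> d \<Longrightarrow> B a j \<in> garcs G"
  using head_B(2)[of a j] arcs by (cases j) auto

lemma B_cong: "(\<And>i. i \<in> {1..j} \<Longrightarrow> a i = a' i) \<Longrightarrow> B a j = B a' j"
  by (induction j) auto

text \<open>Going back towards the root: a head determines its only incoming arc, hence the previous
  head, and by injectivity of the numbering the branch number chosen there.\<close>

lemma head_B_eq_iff:
  assumes a: "address a" "address a'" and j: "j \<le> d" "j' \<le> d"
  shows "head (B a j) = head (B a' j') \<longleftrightarrow> j = j' \<and> (\<forall>i\<in>{1..j}. a i = a' i)"
proof
  assume eq: "head (B a j) = head (B a' j')"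
  then have jj: "j = j'" using head_B(1)[OF a(1) j(1)] head_B(1)[OF a(2) j(2)] by simp
  have "\<forall>i\<in>{1..j}. a i = a' i" using eq j(1) unfolding jj[symmetric]
  proof (induction j)
    case (Suc j)
    have 1: "B a (Suc j) \<in> garcs T" "tail (B a (Suc j)) = head (B a j)"
      using head_B(2)[OF a(1) Suc.prems(2)] by auto
    have 2: "B a' (Suc j) \<in> garcs T" "tail (B a' (Suc j)) = head (B a' j)"
      using head_B(2)[OF a(2) Suc.prems(2)] by auto
    have B: "B a (Suc j) = B a' (Suc j)"
      using rooted_tree_incoming_arc_unique[OF rooted, of "tail (B a (Suc j))" "edge (B a (Suc j))"
        "head (B a (Suc j))" "tail (B a' (Suc j))" "edge (B a' (Suc j))"] 1 2 Suc.prems(1)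
      by (metis prod.collapse)
    then have hd: "head (B a j) = head (B a' j)" using 1(2) 2(2) by (metis)
    then have IH: "\<forall>i\<in>{1..j}. a i = a' i" using Suc by simp
    let ?v = "head (B a j)"
    have "outdegree T ?v = n (Suc j)"
      using T Suc.prems(2) head_B(1)[OF a(1), of j] unfolding balanced_tree_def by simp
    moreover have "a (Suc j) < n (Suc j)" "a' (Suc j) < n (Suc j)"
      using a Suc.prems(2) unfolding address_def by auto
    moreover have "branch ?v (a (Suc j)) = branch ?v (a' (Suc j))" using B hd by simp
    ultimately have "a (Suc j) = a' (Suc j)"
      using bij_betw_imp_inj_on[OF bij_betw_branch[of ?v]] unfolding inj_on_def by simp
    then show ?case using IH by (auto simp: le_Suc_eq)
  qed simp
  with jj show "j = j' \<and> (\<forall>i\<in>{1..j}. a i = a' i)" by blast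
next
  assume "j = j' \<and> (\<forall>i\<in>{1..j}. a i = a' i)"
  then show "head (B a j) = head (B a' j')" using B_cong[of j a a'] by simp
qed

lemma B_eq_iff:
  assumes a: "address a" "address a'" and j: "j \<le> d" "j' \<le> d"
  shows "B a j = B a' j' \<longleftrightarrow> j = j' \<and> (\<forall>i\<in>{1..j}. a i = a' i)"
  using head_B_eq_iff[OF assms] B_cong[of j a a'] by auto

lemma vertex_is_head_B:
  assumes "v \<in> gverts T"
  obtains a where "address a" "v = head (B a (depth T r v))"
proof -
  have "depth T r v = j \<Longrightarrow> v \<in> gverts T \<Longrightarrow> \<exists>a. address a \<and> v = head (B a j)" for j
  proof (induction j arbitrary: v)
    case 0
    have "address (\<lambda>_. 0)" using n_pos unfolding address_def by simp
    moreover have "v = r" using rooted_tree_depth_0[OF rooted] 0 by blast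
    ultimately show ?case by auto
  next
    case (Suc j)
    have jd: "Suc j \<le> d" using balanced_tree_depth_le[OF T Suc.prems(2)] Suc.prems(1) by simp
    have "v \<noteq> r" using Suc.prems(1) depth_root[of T r] by auto
    then obtain u e where ue: "(u, e, v) \<in> garcs T"
      using rooted_tree_incoming_arc[OF rooted Suc.prems(2)] by blast
    have u: "u \<in> gverts T" "depth T r u = j"
      using digraph_arc(3)[OF digraph_T ue] rooted_tree_arc_depth[OF rooted ue] Suc.prems(1) by auto
    then obtain a where a: "address a" "u = head (B a j)" using Suc.IH by blast
    have od: "outdegree T u = n (Suc j)" using T u jd unfolding balanced_tree_def by simp
    have "(u, e, v) \<in> branch u ` {..<n (Suc j)}"
      using bij_betw_imp_surj_on[OF bij_betw_branch[of u]] ue od by auto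
    then obtain b where b: "b < n (Suc j)" "branch u b = (u, e, v)" by force
    let ?a = "a(Suc j := b)"
    have "B ?a j = B a j" by (rule B_cong) auto
    then have "v = head (B ?a (Suc j))" using a(2) b(2) by simp
    moreover have "address ?a" using a(1) b(1) unfolding address_def by auto
    ultimately show ?case by blast
  qed
  then show thesis using assms that by blast
qed

lemma arc_is_B:
  assumes "x \<in> garcs G"
  obtains a j where "address a" "j \<le> d" "x = B a j"
proof -
  obtain u e w where x: "x = (u, e, w)" by (cases x)
  consider "x = (z, e0, r)" | "(u, e, w) \<in> garcs T" using assms arcs x by auto
  then show thesis
  proof cases
    case 1
    have "address (\<lambda>_. 0)" using n_pos unfolding address_def by simp
    then show thesis using that[of _ 0] 1 by auto
  next
    case 2
    have w: "w \<in> gverts T" using digraph_arc(4)[OF digraph_T 2] .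
    obtain a where a: "address a" "w = head (B a (depth T r w))" by (rule vertex_is_head_B[OF w])
    let ?j = "depth T r w"
    have j: "0 < ?j" "?j \<le> d"
      using rooted_tree_arc_depth[OF rooted 2] balanced_tree_depth_le[OF T w] by auto
    have "B a ?j \<in> garcs T" using head_B(2)[OF a(1) j(2)] j(1) by blast
    then have "B a ?j = (u, e, w)"
      using rooted_tree_incoming_arc_unique[OF rooted 2, of "tail (B a ?j)" "edge (B a ?j)"] a(2)
      by (metis prod.collapse)
    then show thesis using that[OF a(1) j(2)] x by simp
  qed
qed

end

section \<open>Points of the tree as pairs of an address and a height\<close>

lemma ordered_levels_cover:
  fixes u :: "nat \<Rightarrow> real"
  assumes "s \<in> {u 0..u (Suc d)}"
  obtains j where "j \<le> d" "s \<in> {u j..u (Suc j)}"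
proof -
  have "s \<in> {u 0..u (Suc m)} \<Longrightarrow> \<exists>j\<le>m. s \<in> {u j..u (Suc j)}" for m
  proof (induction m)
    case (Suc m)
    then show ?case by (cases "s \<le> u (Suc m)") (auto intro: le_SucI)
  qed simp
  then show thesis using assms that by blast
qed

locale levelled_tree = augmented_balanced_tree +
  fixes u :: "nat \<Rightarrow> real"
  assumes u_less: "\<And>i j. i < j \<Longrightarrow> j \<le> Suc d \<Longrightarrow> u i < u j"
begin

lemma u_less_iff: "i \<le> Suc d \<Longrightarrow> j \<le> Suc d \<Longrightarrow> u i < u j \<longleftrightarrow> i < j"
  using u_less by (metis less_asym linorder_less_linear)

lemma u_le: "i \<le> j \<Longrightarrow> j \<le> Suc d \<Longrightarrow> u i \<le> u j"
  using u_less by (metis less_eq_real_def order_le_less)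

lemma u_eq_iff: "i \<le> Suc d \<Longrightarrow> j \<le> Suc d \<Longrightarrow> u i = u j \<longleftrightarrow> i = j"
  using u_less by (metis less_irrefl linorder_less_linear)

text \<open>Indices are levels, one more than depths in \<open>T\<close>: the added source has level
  0 and the root has level 1.\<close>

definition vertex :: "(nat \<Rightarrow> nat) \<Rightarrow> nat \<Rightarrow> 'a"
  where "vertex a j = (case j of 0 \<Rightarrow> z | Suc i \<Rightarrow> head (B a i))"

definition param :: "'a \<times> 'a set \<times> 'a \<Rightarrow> real \<Rightarrow> 'a"
  where "param x = (SOME \<phi>. continuous_map (top_of_set {0..1}) (gspace G) \<phi> \<and>
    inj_on \<phi> {0..1} \<and> \<phi> ` {0<..<1} = edge x \<and> \<phi> 0 = tail x \<and> \<phi> 1 = head x)"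

lemma tail_B: "address a \<Longrightarrow> j \<le> d \<Longrightarrow> tail (B a j) = vertex a j"
  using head_B(2)[of a j] unfolding vertex_def by (cases j) auto

lemma vertex_Suc [simp]: "vertex a (Suc j) = head (B a j)"
  by (simp add: vertex_def)

lemma vertex_eq_iff:
  assumes a: "address a" "address a'" and j: "j \<le> Suc d" "j' \<le> Suc d"
  shows "vertex a j = vertex a' j' \<longleftrightarrow> j = j' \<and> (\<forall>i\<in>{1..<j}. a i = a' i)"
proof (cases j)
  case 0
  have "z \<noteq> head (B a' i)" if "i \<le> d" for i
    using head_B(1)[OF a(2) that] z by auto
  then show ?thesis using 0 j unfolding vertex_def by (cases j') auto
next
  case (Suc i)
  have ne: "head (B a i) \<noteq> z" using head_B(1)[OF a(1), of i] z Suc j(1) by auto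
  show ?thesis
  proof (cases j')
    case 0
    then show ?thesis using Suc ne unfolding vertex_def by auto
  next
    case (Suc i')
    then show ?thesis using \<open>j = Suc i\<close> j head_B_eq_iff[OF a, of i i']
      by (simp add: atLeastLessThanSuc_atLeastAtMost)
  qed
qed

lemma vertex_in_gverts: "address a \<Longrightarrow> j \<le> Suc d \<Longrightarrow> vertex a j \<in> gverts G"
  using head_B(1)[of a "j - 1"] verts unfolding vertex_def by (cases j) auto

lemma param:
  assumes "address a" "j \<le> d"
  shows "continuous_map (top_of_set {0..1}) (gspace G) (param (B a j))"
    "inj_on (param (B a j)) {0..1}" "param (B a j) ` {0<..<1} = edge (B a j)"
    "param (B a j) 0 = vertex a j" "param (B a j) 1 = vertex a (Suc j)"
proof -
  let ?x = "B a j"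
  have "vertex a j \<noteq> vertex a (Suc j)"
    by (subst vertex_eq_iff) (use assms in auto)
  then have ne: "tail ?x \<noteq> head ?x" using tail_B[OF assms] by simp
  have "(tail ?x, edge ?x, head ?x) \<in> garcs G" using B_in_garcs[OF assms] by simp
  then obtain \<phi> where "continuous_map (top_of_set {0..1::real}) (gspace G) \<phi>" "inj_on \<phi> {0..1}"
    "\<phi> ` {0<..<1} = edge ?x" "\<phi> 0 = tail ?x" "\<phi> 1 = head ?x"
    using ne by (rule digraph_arc_parametrization[OF G])
  then have "\<exists>\<phi>. continuous_map (top_of_set {0..1::real}) (gspace G) \<phi> \<and>
    inj_on \<phi> {0..1} \<and> \<phi> ` {0<..<1} = edge ?x \<and> \<phi> 0 = tail ?x \<and> \<phi> 1 = head ?x" by blast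
  from someI_ex[OF this, folded param_def]
  show "continuous_map (top_of_set {0..1}) (gspace G) (param (B a j))"
    "inj_on (param (B a j)) {0..1}" "param (B a j) ` {0<..<1} = edge (B a j)"
    "param (B a j) 0 = vertex a j" "param (B a j) 1 = vertex a (Suc j)"
    using tail_B[OF assms] by auto
qed

text \<open>At a height \<open>u j\<close> with \<open>j > 0\<close> this selects the arc below the
  vertex; \<open>way_on\<close> shows that the arc above gives the same point.\<close>

definition level :: "real \<Rightarrow> nat"
  where "level s = (LEAST j. s \<le> u (Suc j))"

definition way :: "(nat \<Rightarrow> nat) \<Rightarrow> real \<Rightarrow> 'a"
  where "way a s = param (B a (level s)) ((s - u (level s)) / (u (Suc (level s)) - u (level s)))"

lemma level_eq:
  assumes "j \<le> d" "u j < s \<or> j = 0" "s \<le> u (Suc j)"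
  shows "level s = j"
  unfolding level_def
proof (rule Least_equality)
  fix i assume i: "s \<le> u (Suc i)"
  show "j \<le> i"
  proof (rule ccontr)
    assume "\<not> j \<le> i"
    then have "u (Suc i) \<le> u j" "j \<noteq> 0" using u_le[of "Suc i" j] assms(1) by auto
    then show False using i assms(2) by simp
  qed
qed fact

lemma way_on:
  assumes "address a" "j \<le> d" "s \<in> {u j..u (Suc j)}"
  shows "way a s = param (B a j) ((s - u j) / (u (Suc j) - u j))"
proof (cases "u j < s \<or> j = 0")
  case True
  then show ?thesis using level_eq[OF assms(2)] assms(3) unfolding way_def by simp
next
  case False
  then have "j \<noteq> 0" and s: "s = u j" using assms(3) by auto
  then obtain i where "j = Suc i" using not0_implies_Suc by blast
  with s have i: "j = Suc i" "s = u (Suc i)" by auto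
  have less: "u i < u (Suc i)" using u_less assms(2) i by simp
  then have "level s = i" using level_eq[of i s] i assms(2) by simp
  then have "way a s = vertex a j"
    unfolding way_def using less i param(5)[OF assms(1), of i] assms(2) by simp
  then show ?thesis using i param(4)[OF assms(1,2)] by simp
qed

lemma way_vertex: "address a \<Longrightarrow> j \<le> Suc d \<Longrightarrow> way a (u j) = vertex a j"
proof (cases j)
  case 0
  assume "address a"
  then show ?thesis using 0 way_on[of a 0 "u 0"] param(4)[of a 0] u_less[of 0 1] by simp
next
  case (Suc i)
  assume a: "address a" "j \<le> Suc d"
  then have "u i < u (Suc i)" using u_less Suc by simp
  then show ?thesis using a Suc way_on[of a i "u j"] param(5)[of a i] by simp
qed

lemma way_edge:
  assumes "address a" "j \<le> d" "u j < s" "s < u (Suc j)"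
  shows "way a s \<in> edge (B a j)"
proof -
  have "(s - u j) / (u (Suc j) - u j) \<in> {0<..<1}" using assms by (simp add: field_simps)
  then show ?thesis using way_on[of a j s] param(3)[OF assms(1,2)] assms by auto
qed

lemma continuous_way:
  assumes "address a"
  shows "continuous_map (top_of_set {u 0..u (Suc d)}) (gspace G) (way a)"
proof (rule pasting_lemma_closed[where I = "{..d}" and T = "\<lambda>j. {u j..u (Suc j)}"
      and f = "\<lambda>j. way a"])
  fix j assume j: "j \<in> {..d}"
  then have sub: "{u j..u (Suc j)} \<subseteq> {u 0..u (Suc d)}"
    using u_le[of 0 j] u_le[of "Suc j" "Suc d"] by auto
  then show "closedin (top_of_set {u 0..u (Suc d)}) {u j..u (Suc j)}"
    by (intro closed_subset) auto
  have less: "u j < u (Suc j)" using u_less j by simp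
  have "continuous_map (top_of_set {u j..u (Suc j)}) (gspace G)
      (param (B a j) \<circ> (\<lambda>s. (s - u j) / (u (Suc j) - u j)))"
  proof (rule continuous_map_compose)
    show "continuous_map (top_of_set {u j..u (Suc j)}) (top_of_set {0..1})
        (\<lambda>s. (s - u j) / (u (Suc j) - u j))"
      using less by (auto simp: continuous_map_in_subtopology intro!: continuous_intros)
    show "continuous_map (top_of_set {0..1}) (gspace G) (param (B a j))"
      using param(1) assms j by simp
  qed
  then have "continuous_map (top_of_set {u j..u (Suc j)}) (gspace G) (way a)"
    by (rule continuous_map_eq) (use way_on assms j in auto)
  then show "continuous_map (subtopology (top_of_set {u 0..u (Suc d)}) {u j..u (Suc j)})
      (gspace G) (way a)"
    unfolding subtopology_subtopology Int_absorb1[OF sub] .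
next
  fix s assume "s \<in> topspace (top_of_set {u 0..u (Suc d)})"
  then have "s \<in> {u 0..u (Suc d)}" by simp
  then obtain j where "j \<le> d" "s \<in> {u j..u (Suc j)}" by (rule ordered_levels_cover)
  then show "\<exists>j. j \<in> {..d} \<and> s \<in> {u j..u (Suc j)} \<and> way a s = way a s" by auto
qed auto

lemma level_cases:
  assumes "s \<in> {u 0..u (Suc d)}"
  obtains (vertex) j where "j \<le> Suc d" "s = u j"
    | (edge) j where "j \<le> d" "u j < s" "s < u (Suc j)"
proof -
  obtain j where j: "j \<le> d" "s \<in> {u j..u (Suc j)}" using ordered_levels_cover[OF assms] .
  then consider "s = u j" | "s = u (Suc j)" | "u j < s \<and> s < u (Suc j)" by force
  then show thesis using that j(1) by cases (auto intro: le_SucI)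
qed

text \<open>The tree side of the comparison: a point is its height together with the branches chosen
  strictly below it, since a branching at \<open>u i\<close> separates points only above
  \<open>u i\<close>. The same condition describes components of level sets in
  \<open>cell_iff_label\<close>.\<close>

lemma way_eq_iff:
  assumes a: "address a" "address a'" and s: "s \<in> {u 0..u (Suc d)}" "s' \<in> {u 0..u (Suc d)}"
  shows "way a s = way a' s' \<longleftrightarrow> s = s' \<and> (\<forall>i\<in>{1..d}. u i < s \<longrightarrow> a i = a' i)"
proof -
  have edge_not_vertex: "way b x \<notin> gverts G"
    if "address b" "j \<le> d" "u j < x" "x < u (Suc j)" for b x j
  proof -
    have "edge (B b j) \<in> gedges G"
      using digraph_arc(1)[OF G, of "tail (B b j)" _ "head (B b j)"] B_in_garcs that by simp
    then show ?thesis
      using way_edge[OF that] Union_edges[of "gspace G" "gverts G"] by blast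
  qed
  have ix: "{i \<in> {1..d}. u i < u j} = {1..<j}" if "j \<le> Suc d" for j
    using that u_less_iff by (auto simp: Suc_le_eq)
  show ?thesis
    using s(1)
  proof (cases rule: level_cases)
    case (vertex j)
    show ?thesis using s(2)
    proof (cases rule: level_cases)
      case v': (vertex j')
      have "way a s = way a' s' \<longleftrightarrow> j = j' \<and> (\<forall>i\<in>{1..<j}. a i = a' i)"
        using way_vertex vertex v' a vertex_eq_iff by simp
      then show ?thesis using vertex v' u_eq_iff[of j j'] ix[OF vertex(1)] by blast
    next
      case (edge j')
      then have "s \<noteq> s'" using vertex u_less_iff[of j' j] u_less_iff[of j "Suc j'"] by auto
      moreover have "way a s \<noteq> way a' s'"
        using edge_not_vertex[OF a(2) edge] way_vertex[OF a(1) vertex(1)]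
          vertex_in_gverts[OF a(1) vertex(1)] vertex(2) by metis
      ultimately show ?thesis by blast
    qed
  next
    case (edge j)
    show ?thesis using s(2)
    proof (cases rule: level_cases)
      case (vertex j')
      then have "s \<noteq> s'" using edge u_less_iff[of j j'] u_less_iff[of j' "Suc j"] by auto
      moreover have "way a s \<noteq> way a' s'"
        using edge_not_vertex[OF a(1) edge] way_vertex[OF a(2) vertex(1)]
          vertex_in_gverts[OF a(2) vertex(1)] vertex(2) by metis
      ultimately show ?thesis by blast
    next
      case e': (edge j')
      have ix': "{i \<in> {1..d}. u i < s} = {1..j}"
      proof (intro equalityI subsetI)
        fix i assume "i \<in> {i \<in> {1..d}. u i < s}"
        then show "i \<in> {1..j}" using edge u_less_iff[of i "Suc j"] by force
      next
        fix i assume "i \<in> {1..j}"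
        then show "i \<in> {i \<in> {1..d}. u i < s}" using edge u_le[of i j] by auto
      qed
      have P: "way a s = param (B a j) ((s - u j) / (u (Suc j) - u j))"
        using way_on[OF a(1) edge(1)] edge by simp
      have P': "way a' s' = param (B a' j') ((s' - u j') / (u (Suc j') - u j'))"
        using way_on[OF a(2) e'(1)] e' by simp
      show ?thesis
      proof
        assume eq: "way a s = way a' s'"
        have arcs': "(tail (B a j), edge (B a j), head (B a j)) \<in> garcs G"
          "(tail (B a' j'), edge (B a' j'), head (B a' j')) \<in> garcs G"
          using B_in_garcs a edge e' by auto
        have "edge (B a j) = edge (B a' j')"
          by (rule edges_disjoint[OF digraph_arc(1)[OF G arcs'(1)] digraph_arc(1)[OF G arcs'(2)]
            way_edge[OF a(1) edge]]) (use eq way_edge[OF a(2) e'] in simp)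
        then have Beq: "B a j = B a' j'"
          using digraph_arc_unique[OF G, of "tail (B a j)" "edge (B a j)" "head (B a j)"
            "tail (B a' j')" "head (B a' j')"] arcs' by (simp add: prod_eq_iff)
        then have j: "j = j'" "\<forall>i\<in>{1..j}. a i = a' i" using B_eq_iff[OF a edge(1) e'(1)] by auto
        have "(s - u j) / (u (Suc j) - u j) = (s' - u j) / (u (Suc j) - u j)"
          by (rule inj_onD[OF param(2)[OF a(1) edge(1)]])
            (use P P' eq Beq j e' edge in auto)
        then have "s = s'" using edge by simp
        then show "s = s' \<and> (\<forall>i\<in>{1..d}. u i < s \<longrightarrow> a i = a' i)" using j ix' by blast
      next
        assume *: "s = s' \<and> (\<forall>i\<in>{1..d}. u i < s \<longrightarrow> a i = a' i)"
        then have "B a j = B a' j" using B_cong[of j a a'] ix' by blast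
        then show "way a s = way a' s'"
          using P way_on[OF a(2) edge(1), of s'] * edge by simp
      qed
    qed
  qed
qed

lemma gverts_eq: "gverts G = {way a (u j) |a j. address a \<and> j \<le> Suc d}"
proof (intro equalityI subsetI)
  fix v assume "v \<in> gverts G"
  then consider "v = z" | "v \<in> gverts T" using verts by auto
  then show "v \<in> {way a (u j) |a j. address a \<and> j \<le> Suc d}"
  proof cases
    case 1
    have a: "address (\<lambda>_. 0)" using n_pos unfolding address_def by simp
    have "v = way (\<lambda>_. 0) (u 0)" using 1 way_vertex[OF a, of 0] by (simp add: vertex_def)
    then show ?thesis using a by blast
  next
    case 2
    obtain a where a: "address a" "v = head (B a (depth T r v))" by (rule vertex_is_head_B[OF 2])
    have j: "Suc (depth T r v) \<le> Suc d" using balanced_tree_depth_le[OF T 2] by simp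
    then have "v = way a (u (Suc (depth T r v)))" using a way_vertex[OF a(1) j] by simp
    then show ?thesis using a j by blast
  qed
qed (use way_vertex vertex_in_gverts in auto)

lemma garcs_endpoints:
  assumes "(v, e, w) \<in> garcs G"
  obtains a j where "address a" "j \<le> d" "v = way a (u j)" "w = way a (u (Suc j))"
proof -
  obtain a j where aj: "address a" "j \<le> d" "(v, e, w) = B a j" using arc_is_B[OF assms] .
  show thesis
  proof (rule that[OF aj(1,2)])
    show "v = way a (u j)" using tail_B[OF aj(1,2)] way_vertex[of a j] aj by (metis fst_conv le_SucI)
    show "w = way a (u (Suc j))" using way_vertex[of a "Suc j"] aj
      by (metis Suc_le_mono snd_conv vertex_Suc)
  qed
qed

lemma topspace_eq: "topspace (gspace G) = {way a s |a s. address a \<and> s \<in> {u 0..u (Suc d)}}"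
proof (intro equalityI subsetI)
  fix x assume x: "x \<in> topspace (gspace G)"
  show "x \<in> {way a s |a s. address a \<and> s \<in> {u 0..u (Suc d)}}"
  proof (cases "x \<in> gverts G")
    case True
    then obtain a j where aj: "address a" "j \<le> Suc d" "x = way a (u j)"
      unfolding gverts_eq by blast
    then have "u j \<in> {u 0..u (Suc d)}" using u_le[of 0 j] u_le[of j "Suc d"] by simp
    then show ?thesis using aj by blast
  next
    case False
    then obtain e where e: "e \<in> gedges G" "x \<in> e"
      using x Union_edges[of "gspace G" "gverts G"] by blast
    obtain v w where vw: "(v, e, w) \<in> garcs G" by (rule digraph_edge_arc[OF G e(1)])
    obtain a j where aj: "address a" "j \<le> d" "(v, e, w) = B a j" using arc_is_B[OF vw] .
    have "x \<in> param (B a j) ` {0<..<1}" using param(3)[OF aj(1,2)] e(2) aj(3)[symmetric] by simp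
    then obtain t where t: "t \<in> {0<..<1}" "x = param (B a j) t" by blast
    define s where "s = u j + t * (u (Suc j) - u j)"
    have less: "u j < u (Suc j)" using u_less aj by simp
    have "s - u j \<le> u (Suc j) - u j" "0 \<le> s - u j"
      unfolding s_def using t(1) less by (simp_all add: mult_left_le_one_le)
    then have s: "s \<in> {u j..u (Suc j)}" by simp
    have "(s - u j) / (u (Suc j) - u j) = t" unfolding s_def using less by simp
    then have "x = way a s" using way_on[OF aj(1,2) s] t by simp
    moreover have "s \<in> {u 0..u (Suc d)}"
      using s u_le[of 0 j] u_le[of "Suc j" "Suc d"] aj(2) by auto
    ultimately show ?thesis using aj(1) by blast
  qed
next
  fix x assume "x \<in> {way a s |a s. address a \<and> s \<in> {u 0..u (Suc d)}}"
  then obtain a s where as: "address a" "s \<in> {u 0..u (Suc d)}" "x = way a s" by blast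
  then show "x \<in> topspace (gspace G)"
    using continuous_map_image_subset_topspace[OF continuous_way[OF as(1)]] by auto
qed

end

section \<open>Circular cylinders\<close>

lemma Euclidean_space_eq: "Euclidean_space k = top_of_set {x. \<forall>i\<ge>k. x i = 0}"
  by (simp add: Euclidean_space_def euclidean_product_topology)

lemma sum_fun_apply: "(\<Sum>i\<in>A. f i) x = (\<Sum>i\<in>A. f i x)"
  for f :: "'a \<Rightarrow> 'b \<Rightarrow> 'c::comm_monoid_add"
  by (induction A rule: infinite_finite_induct) auto

text \<open>Every intersection of tangent spaces takes this shape: either \<open>0\<close> is
  outside \<open>J\<close> and the coordinates in \<open>J\<close> are multiples of
  \<open>v 0\<close>, or \<open>0\<close> lies in \<open>J\<close> and all of them vanish.\<close>

lemma dim_coordinate_equations: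
  fixes c :: "nat \<Rightarrow> real"
  assumes J: "J \<subseteq> {..<k}" and c: "0 \<in> J \<Longrightarrow> c 0 = 0"
  shows "dim {v :: nat \<Rightarrow> real. (\<forall>i\<ge>k. v i = 0) \<and> (\<forall>i\<in>J. v i = c i * v 0)} = k - card J"
    (is "dim ?W = _")
proof -
  define I where "I = {..<k} - J"
  \<comment> \<open>The free coordinates index a basis: unit vectors, except that \<open>b 0\<close>
    also carries the entries \<open>c j\<close> which \<open>v 0 = 1\<close> forces.\<close>
  define b where "b i = (\<lambda>j. if j = i then 1 else if i = 0 \<and> j \<in> J then c j else 0)" for i
  have b_same: "b i i = 1" for i by (simp add: b_def)
  have b_other: "b i j = 0" if "i \<in> I" "j \<in> I" "i \<noteq> j" for i j
    using that by (auto simp: b_def I_def)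
  have fin: "finite I" unfolding I_def by simp
  have inj: "inj_on b I"
    by (rule inj_onI) (metis b_same b_other zero_neq_one)
  have cardI: "card I = k - card J"
    unfolding I_def using J by (simp add: card_Diff_subset finite_subset)
  show ?thesis
  proof (rule dim_unique[where B = "b ` I"])
    show "b ` I \<subseteq> ?W"
      using J c by (auto simp: b_def I_def)
    show "?W \<subseteq> span (b ` I)"
    proof
      fix v assume "v \<in> ?W"
      then have vk: "\<And>i. i \<ge> k \<Longrightarrow> v i = 0" and vJ: "\<And>i. i \<in> J \<Longrightarrow> v i = c i * v 0" by blast+
      have "v = (\<Sum>i\<in>I. v i *\<^sub>R b i)"
      proof
        fix j
        have sum: "(\<Sum>i\<in>I. v i *\<^sub>R b i) j = (\<Sum>i\<in>I. v i * b i j)"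
          unfolding sum_fun_apply by (simp add: scaleR_fun_def)
        consider "j \<in> I" | "j \<in> J" | "j \<ge> k" unfolding I_def by force
        then show "v j = (\<Sum>i\<in>I. v i *\<^sub>R b i) j"
        proof cases
          case 1
          have "(\<Sum>i\<in>I. v i * b i j) = (\<Sum>i\<in>I. if i = j then v j else 0)"
            by (rule sum.cong) (use 1 b_other b_same in auto)
          then show ?thesis using sum 1 fin by simp
        next
          case 2
          have "(\<Sum>i\<in>I. v i * b i j) = (\<Sum>i\<in>I. if i = 0 then v 0 * c j else 0)"
            by (rule sum.cong) (use 2 in \<open>auto simp: b_def I_def\<close>)
          also have "\<dots> = (if 0 \<in> I then v 0 * c j else 0)" using fin by simp
          also have "\<dots> = v j"
          proof (cases "0 \<in> I")
            case False
            then have "0 \<in> J" using 2 J unfolding I_def by auto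
            then have "v 0 = 0" using vJ[of 0] c by (metis mult_zero_left)
            then show ?thesis using False vJ[OF 2] by simp
          qed (use vJ[OF 2] in simp)
          finally show ?thesis using sum by simp
        next
          case 3
          have "(\<Sum>i\<in>I. v i * b i j) = 0"
            by (rule sum.neutral) (use 3 J in \<open>auto simp: b_def I_def\<close>)
          then show ?thesis using sum vk[OF 3] by simp
        qed
      qed
      also have "\<dots> \<in> span (b ` I)"
        by (intro span_sum span_scale span_base) auto
      finally show "v \<in> span (b ` I)" .
    qed
    show "independent (b ` I)"
    proof
      assume "dependent (b ` I)"
      then obtain w i where w: "(\<Sum>v\<in>b ` I. w v *\<^sub>R v) = 0" and i: "i \<in> I" "w (b i) \<noteq> 0"
        using dependent_finite[of "b ` I"] fin by auto
      have "(\<Sum>v\<in>b ` I. w v *\<^sub>R v) i = (\<Sum>j\<in>I. w (b j) * b j i)"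
        by (subst sum.reindex[OF inj]) (simp add: sum_fun_apply scaleR_fun_def)
      also have "\<dots> = (\<Sum>j\<in>I. if j = i then w (b i) else 0)"
        by (rule sum.cong) (use i b_other b_same in auto)
      also have "\<dots> = w (b i)" using i fin by simp
      finally show False using w i by simp
    qed
    show "card (b ` I) = k - card J" using card_image[OF inj] cardI by simp
  qed
qed

definition circ :: "real \<Rightarrow> nat \<Rightarrow> real \<Rightarrow> real \<Rightarrow> (nat \<Rightarrow> real) \<Rightarrow> real"
  where "circ R i A B x = R\<^sup>2 - (x 0 - A)\<^sup>2 - (x i - B)\<^sup>2"

definition circ_cylinder :: "nat \<Rightarrow> real \<Rightarrow> nat \<Rightarrow> real \<Rightarrow> real \<Rightarrow> (nat \<Rightarrow> real) set"
  where "circ_cylinder k R i A B = {x \<in> topspace (Euclidean_space k). circ R i A B x = 0}"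

text \<open>Differentiating the equation along a curve needs only that the curve stays in the zero
  set. Allowing any subset \<open>M\<close> makes the result available for strata of the region as
  well as for whole cylinders.\<close>

lemma tangent_space_circ_zero:
  assumes "v \<in> tangent_space M p" "M \<subseteq> {x. circ R i A B x = 0}"
  shows "(p 0 - A) * v 0 + (p i - B) * v i = 0"
proof -
  obtain g g' e where e: "e > 0" and g: "g 0 = p" "g' 0 = v"
    and M: "\<And>s. s \<in> {-e<..<e} \<Longrightarrow> g s \<in> M"
    and der: "\<And>i s. s \<in> {-e<..<e} \<Longrightarrow> ((\<lambda>s. g s i) has_real_derivative g' s i) (at s)"
    using assms(1) unfolding tangent_space_def by blast
  have [derivative_intros]: "((\<lambda>s. g s j) has_real_derivative v j) (at 0)" for j
    using der[of 0 j] e g by simp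
  have "((\<lambda>s. circ R i A B (g s)) has_real_derivative
      - (2 * (p 0 - A) * v 0) - 2 * (p i - B) * v i) (at 0)"
    unfolding circ_def by (auto intro!: derivative_eq_intros simp: g algebra_simps)
  moreover have "((\<lambda>s. circ R i A B (g s)) has_real_derivative 0) (at 0)"
  proof (rule has_field_derivative_transform_within_open[of "\<lambda>_. 0" _ _ "{-e<..<e}"])
    show "0 = circ R i A B (g s)" if "s \<in> {-e<..<e}" for s
      using M[OF that] assms(2) by auto
  qed (use e in auto)
  ultimately have "- (2 * (p 0 - A) * v 0) - 2 * (p i - B) * v i = 0" by (rule DERIV_unique)
  then show ?thesis by (simp add: algebra_simps)
qed

lemma tangent_space_circ_cylinder:
  assumes "R > 0" "0 < i" "i < k" "p \<in> circ_cylinder k R i A B"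
  shows "tangent_space (circ_cylinder k R i A B) p =
    {v. (\<forall>j\<ge>k. v j = 0) \<and> (p 0 - A) * v 0 + (p i - B) * v i = 0}" (is "?L = ?R")
proof (intro equalityI subsetI)
  fix v assume v: "v \<in> ?L"
  have "v j = 0" if "j \<ge> k" for j
  proof -
    obtain g g' e where e: "e > 0" and g: "g 0 = p" "g' 0 = v"
      and M: "\<And>s. s \<in> {-e<..<e} \<Longrightarrow> g s \<in> circ_cylinder k R i A B"
      and der: "\<And>i s. s \<in> {-e<..<e} \<Longrightarrow> ((\<lambda>s. g s i) has_real_derivative g' s i) (at s)"
      using v unfolding tangent_space_def by blast
    have "((\<lambda>s. g s j) has_real_derivative 0) (at 0)"
    proof (rule has_field_derivative_transform_within_open[of "\<lambda>_. 0" _ _ "{-e<..<e}"])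
      show "0 = g s j" if "s \<in> {-e<..<e}" for s
        using M[OF that] \<open>j \<ge> k\<close> by (auto simp: circ_cylinder_def topspace_Euclidean_space)
    qed (use e in auto)
    moreover have "((\<lambda>s. g s j) has_real_derivative v j) (at 0)" using der[of 0 j] e g by simp
    ultimately show ?thesis using DERIV_unique by blast
  qed
  moreover have "(p 0 - A) * v 0 + (p i - B) * v i = 0"
    by (rule tangent_space_circ_zero[OF v]) (auto simp: circ_cylinder_def)
  ultimately show "v \<in> ?R" by blast
next
  fix v assume "v \<in> ?R"
  then have v: "\<And>j. j \<ge> k \<Longrightarrow> v j = 0" and orth: "(p 0 - A) * v 0 + (p i - B) * v i = 0" by auto
  define a where "a = p 0 - A"
  define b where "b = p i - B"
  have p: "a\<^sup>2 + b\<^sup>2 = R\<^sup>2" "\<And>j. j \<ge> k \<Longrightarrow> p j = 0"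
    using assms(4) by (auto simp: circ_cylinder_def circ_def topspace_Euclidean_space a_def b_def)
  have R2: "R\<^sup>2 > 0" using assms(1) by simp
  \<comment> \<open>The angular velocity: rotating the radius \<open>(a, b)\<close> at rate
    \<open>w\<close> has velocity \<open>(-w b, w a)\<close>, and every vector orthogonal to the
    radius arises so.\<close>
  define w where "w = (a * v i - b * v 0) / R\<^sup>2"
  have ab: "a * v 0 + b * v i = 0" using orth by (simp add: a_def b_def)
  have "w * a * R\<^sup>2 = v i * R\<^sup>2" "- (w * b) * R\<^sup>2 = v 0 * R\<^sup>2"
  proof -
    have "w * a * R\<^sup>2 = a * a * v i - b * (a * v 0)"
      unfolding w_def using R2 by (simp add: field_simps)
    also have "a * v 0 = - (b * v i)" using ab by simp
    also have "a * a * v i - b * - (b * v i) = v i * (a\<^sup>2 + b\<^sup>2)"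
      by (simp add: algebra_simps power2_eq_square)
    finally show "w * a * R\<^sup>2 = v i * R\<^sup>2" by (simp only: p(1))
    have "- (w * b) * R\<^sup>2 = b * b * v 0 - a * (b * v i)"
      unfolding w_def using R2 by (simp add: field_simps)
    also have "b * v i = - (a * v 0)" using ab by simp
    also have "b * b * v 0 - a * - (a * v 0) = v 0 * (a\<^sup>2 + b\<^sup>2)"
      by (simp add: algebra_simps power2_eq_square)
    finally show "- (w * b) * R\<^sup>2 = v 0 * R\<^sup>2" by (simp only: p(1))
  qed
  then have wv: "w * a = v i" "- (w * b) = v 0"
    using R2 by (metis less_irrefl mult_right_cancel)+
  \<comment> \<open>Rotation about the axis in the plane of the coordinates 0 and \<open>i\<close>,
    straight motion in all other coordinates.\<close>
  define g where "g s j = (if j = 0 then A + a * cos (w * s) - b * sin (w * s)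
      else if j = i then B + b * cos (w * s) + a * sin (w * s) else p j + s * v j)" for s j
  define g' where "g' s j = (if j = 0 then - (a * w * sin (w * s)) - b * w * cos (w * s)
      else if j = i then - (b * w * sin (w * s)) + a * w * cos (w * s) else v j)" for s j
  have "g 0 = p" by (rule ext) (simp add: g_def a_def b_def)
  moreover have "g' 0 = v" by (rule ext) (use wv in \<open>auto simp: g'_def mult.commute\<close>)
  moreover have "g s \<in> circ_cylinder k R i A B" for s
  proof -
    have "(a * C - b * S)\<^sup>2 + (b * C + a * S)\<^sup>2 = (a\<^sup>2 + b\<^sup>2) * (S\<^sup>2 + C\<^sup>2)" for C S
      by (simp add: power2_eq_square algebra_simps)
    then have "(a * cos (w * s) - b * sin (w * s))\<^sup>2 + (b * cos (w * s) + a * sin (w * s))\<^sup>2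
        = (a\<^sup>2 + b\<^sup>2) * ((sin (w * s))\<^sup>2 + (cos (w * s))\<^sup>2)" .
    also have "\<dots> = R\<^sup>2" by (simp add: p)
    finally show ?thesis
      using assms(2,3) p(2) v
      by (auto simp: circ_cylinder_def circ_def topspace_Euclidean_space g_def add_diff_eq[symmetric])
  qed
  moreover have "((\<lambda>s. g s j) has_real_derivative g' s j) (at s)" for s j
    unfolding g_def g'_def
    by (cases "j = 0"; cases "j = i") (auto intro!: derivative_eq_intros)
  moreover have "continuous_on S (\<lambda>s. g' s j)" for j S
    unfolding g'_def by (cases "j = 0"; cases "j = i") (auto intro!: continuous_intros)
  ultimately show "v \<in> ?L"
    unfolding tangent_space_def mem_Collect_eq
    by (intro exI[of _ g] exI[of _ g'] exI[of _ 1]) auto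
qed

lemma cylinder_circ_cylinder:
  assumes "R > 0" "0 < i" "i < k"
  shows "cylinder k {x :: real \<times> real. norm x = R} (circ_cylinder k R i A B)"
proof -
  \<comment> \<open>The isometry \<open>T\<close> swaps the coordinates 1 and \<open>i\<close> and
    then translates the axis to \<open>(A, B)\<close>. As \<open>\<tau>\<close> is an involution,
    also when \<open>i = 1\<close>, the inverse \<open>T'\<close> is explicit.\<close>
  define \<tau> where "\<tau> j = (if j = 1 then i else if j = i then 1 else j)" for j
  define c where "c j = (if j = 0 then A else if j = i then B else 0)" for j
  define T where "T x j = x (\<tau> j) + c j" for x :: "nat \<Rightarrow> real" and j
  define T' where "T' x j = x (\<tau> j) - c (\<tau> j)" for x :: "nat \<Rightarrow> real" and j
  have \<tau>: "\<tau> (\<tau> j) = j" "\<tau> 0 = 0" "\<tau> 1 = i" "\<tau> i = 1" for j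
    using assms by (auto simp: \<tau>_def)
  have \<tau>k: "\<tau> j < k \<longleftrightarrow> j < k" for j using assms by (auto simp: \<tau>_def)
  have ck: "c j = 0" if "j \<ge> k" for j using that assms by (auto simp: c_def)
  have inE: "T x \<in> topspace (Euclidean_space k)" "T' x \<in> topspace (Euclidean_space k)"
    if "x \<in> topspace (Euclidean_space k)" for x
    using that \<tau>k ck unfolding topspace_Euclidean_space T_def T'_def by (auto simp: not_less[symmetric])
  have TT': "T (T' x) = x" for x by (rule ext) (simp add: T_def T'_def \<tau>)
  have TT: "T ` topspace (Euclidean_space k) = topspace (Euclidean_space k)"
    using inE TT' by (metis (no_types, lifting) image_eqI image_subsetI subsetI subset_antisym)
  have dist: "L2_set (\<lambda>j. T x j - T y j) {..<k} = L2_set (\<lambda>j. x j - y j) {..<k}" for x y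
  proof -
    have bij: "bij_betw \<tau> {..<k} {..<k}"
      by (rule bij_betw_byWitness[where f' = \<tau>]) (use \<tau> \<tau>k in auto)
    show ?thesis unfolding L2_set_def T_def
      using sum.reindex_bij_betw[OF bij, of "\<lambda>j. (x j - y j)\<^sup>2"] by simp
  qed
  have "circ_cylinder k R i A B = T ` {x \<in> topspace (Euclidean_space k). (x 0, x 1) \<in> {x. norm x = R}}"
  proof (intro equalityI subsetI)
    fix x assume x: "x \<in> circ_cylinder k R i A B"
    have "T' x 0 = x 0 - A" "T' x 1 = x i - B" using assms \<tau> by (auto simp: T'_def c_def)
    then have "norm (T' x 0, T' x 1) = R"
      using x assms(1) by (auto simp: norm_Pair circ_cylinder_def circ_def real_sqrt_unique)
    moreover have "T' x \<in> topspace (Euclidean_space k)"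
      using inE(2) x by (auto simp: circ_cylinder_def)
    ultimately show "x \<in> T ` {x \<in> topspace (Euclidean_space k). (x 0, x 1) \<in> {x. norm x = R}}"
      using TT'[of x] by (metis (mono_tags, lifting) image_eqI mem_Collect_eq)
  next
    fix x assume "x \<in> T ` {x \<in> topspace (Euclidean_space k). (x 0, x 1) \<in> {x. norm x = R}}"
    then obtain y where y: "y \<in> topspace (Euclidean_space k)" "norm (y 0, y 1) = R" "x = T y" by auto
    have "x 0 - A = y 0" "x i - B = y 1" using y(3) assms \<tau> by (auto simp: T_def c_def)
    moreover have "(y 0)\<^sup>2 + (y 1)\<^sup>2 = R\<^sup>2" using y(2) by (auto simp: norm_Pair)
    ultimately show "x \<in> circ_cylinder k R i A B"
      using inE(1)[OF y(1)] y(3) by (simp add: circ_cylinder_def circ_def)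
  qed
  moreover have "euclidean_isometry k T" unfolding euclidean_isometry_def using TT dist by simp
  ultimately show ?thesis unfolding cylinder_def by blast
qed

lemma real_polynomial_circ:
  assumes "0 < i" "i < k"
  shows "real_polynomial k (\<lambda>x. c * circ R i A B x)"
proof -
  have v: "real_polynomial k (\<lambda>x. x j + (- q))" if "j < k" for j q
    by (intro real_polynomial.intros that)
  have "real_polynomial k (\<lambda>x. c * (R\<^sup>2 + ((-1) * ((x 0 + - A) * (x 0 + - A)) +
      (-1) * ((x i + - B) * (x i + - B)))))"
    using assms by (intro real_polynomial.mult real_polynomial.add v real_polynomial.const) auto
  then show ?thesis by (simp add: circ_def power2_eq_square algebra_simps)
qed

text \<open>The gradient vanishes only on the axis, which the cylinder misses. The factor
  \<open>c\<close> allows either side of the cylinder to be the positive one.\<close>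

lemma nonsingular_circ_cylinder:
  assumes "R > 0" "0 < i" "i < k" "c \<noteq> 0"
  shows "nonsingular_hypersurface k (\<lambda>x. c * circ R i A B x) (circ_cylinder k R i A B)"
  unfolding nonsingular_hypersurface_def
proof (intro conjI ballI)
  show "real_polynomial k (\<lambda>x. c * circ R i A B x)" by (rule real_polynomial_circ) fact+
  have "circ_cylinder k R i A B =
    \<Union>(connected_components_of (subtopology (Euclidean_space k)
       {x \<in> topspace (Euclidean_space k). c * circ R i A B x = 0}))"
    unfolding Union_connected_components_of using assms(4) by (auto simp: circ_cylinder_def)
  then show "\<exists>\<C>\<subseteq>connected_components_of (subtopology (Euclidean_space k)
       {x \<in> topspace (Euclidean_space k). c * circ R i A B x = 0}).
       circ_cylinder k R i A B = \<Union>\<C>" by blast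
next
  fix p assume p: "p \<in> circ_cylinder k R i A B"
  have "((\<lambda>s. c * circ R i A B (p(0 := s))) has_real_derivative c * - (2 * (p 0 - A))) (at (p 0))"
    unfolding circ_def using assms(2) by (auto intro!: derivative_eq_intros)
  then have 0: "partial_deriv 0 (\<lambda>x. c * circ R i A B x) p = c * - (2 * (p 0 - A))"
    unfolding partial_deriv_def by (rule DERIV_imp_deriv)
  have "((\<lambda>s. c * circ R i A B (p(i := s))) has_real_derivative c * - (2 * (p i - B))) (at (p i))"
    unfolding circ_def using assms(2) by (auto intro!: derivative_eq_intros)
  then have i: "partial_deriv i (\<lambda>x. c * circ R i A B x) p = c * - (2 * (p i - B))"
    unfolding partial_deriv_def by (rule DERIV_imp_deriv)
  have "p 0 - A \<noteq> 0 \<or> p i - B \<noteq> 0" using p assms(1) by (auto simp: circ_cylinder_def circ_def)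
  then show "\<exists>j<k. partial_deriv j (\<lambda>x. c * circ R i A B x) p \<noteq> 0"
    using 0 i assms by (metis less_trans mult_eq_0_iff neg_equal_0_iff_equal zero_neq_numeral)
qed

section \<open>The arrangement of cylinders\<close>

text \<open>\<open>(\<bar>y\<bar> + B)\<^sup>2\<close> is the larger of the two squares on the
  right, so one inequality describes the common part of two discs with centres at \<open>B\<close>
  and \<open>-B\<close>.\<close>

lemma abs_sum_le_iff:
  fixes y B c :: real
  assumes "B \<ge> 0"
  shows "(\<bar>y\<bar> + B)\<^sup>2 \<le> c \<longleftrightarrow> (y - B)\<^sup>2 \<le> c \<and> (y + B)\<^sup>2 \<le> c"
    and "(\<bar>y\<bar> + B)\<^sup>2 < c \<longleftrightarrow> (y - B)\<^sup>2 < c \<and> (y + B)\<^sup>2 < c"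
proof -
  have "(\<bar>y\<bar> + B)\<^sup>2 = (y + B)\<^sup>2 \<and> (y - B)\<^sup>2 \<le> (y + B)\<^sup>2 \<or>
    (\<bar>y\<bar> + B)\<^sup>2 = (y - B)\<^sup>2 \<and> (y + B)\<^sup>2 \<le> (y - B)\<^sup>2"
  proof (cases "y \<ge> 0")
    case True
    then have "y * B \<ge> 0" using assms by simp
    then show ?thesis using True by (simp add: power2_eq_square algebra_simps)
  next
    case False
    then have "y * B \<le> 0" using assms by (simp add: mult_nonpos_nonneg)
    then show ?thesis using False by (simp add: power2_eq_square algebra_simps)
  qed
  then show "(\<bar>y\<bar> + B)\<^sup>2 \<le> c \<longleftrightarrow> (y - B)\<^sup>2 \<le> c \<and> (y + B)\<^sup>2 \<le> c"
    and "(\<bar>y\<bar> + B)\<^sup>2 < c \<longleftrightarrow> (y - B)\<^sup>2 < c \<and> (y + B)\<^sup>2 < c" by linarith+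
qed

text \<open>In the plane of the coordinates \<open>0\<close> and \<open>i\<close> with \<open>1 \<le> i \<le> d\<close> there are two large discs
  whose intersection (\<open>tube\<close>) contains the region, and \<open>n i - 1\<close> discs to be removed, whose
  leftmost points are \<open>(u i, cc i b)\<close>; so the fibre over a level just above \<open>u i\<close> is cut into
  \<open>n i\<close> intervals. In the last plane the region is a lens with corners over the levels \<open>u 0\<close>
  and \<open>u (d + 1)\<close>.\<close>

locale tower =
  fixes d :: nat and n :: "nat \<Rightarrow> nat" and u :: "nat \<Rightarrow> real" and R :: real
  assumes d_pos: "d > 0" and n_gt_1: "\<And>i. i \<in> {1..d} \<Longrightarrow> n i > 1"
    and u_less: "\<And>i j. i < j \<Longrightarrow> j \<le> Suc d \<Longrightarrow> u i < u j"
    and R_large: "128 * (\<Sum>i=1..d. real (n i))\<^sup>2 * (u (Suc d) - u 0) < R"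
begin

definition M :: real where "M = (\<Sum>i=1..d. real (n i))"
definition L :: real where "L = u (Suc d) - u 0"
text \<open>The distance between neighbouring removed discs. The divisor \<open>4 * M\<close> keeps
  their centres within \<open>R / 8\<close>, and discs of half-width below \<open>gap / 2\<close>
  then stay within \<open>R / 4\<close>, where the two large discs leave room.\<close>

definition gap :: real where "gap = R / (4 * M)"
definition cc :: "nat \<Rightarrow> nat \<Rightarrow> real" where "cc i b = (real b - real (n i) / 2) * gap"
definition mid :: real where "mid = (u 0 + u (Suc d)) / 2"
text \<open>Circles of radius \<open>R\<close> with centres \<open>(mid, lh)\<close> and
  \<open>(mid, -lh)\<close> cross exactly over the first and the last level.\<close>

definition lh :: real where "lh = sqrt (R\<^sup>2 - (L / 2)\<^sup>2)"

abbreviation range_u :: "real set" where "range_u \<equiv> {u 0..u (Suc d)}"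

lemma u_le: "i \<le> j \<Longrightarrow> j \<le> Suc d \<Longrightarrow> u i \<le> u j"
  using u_less by (metis less_eq_real_def order_le_less)

lemma u_in_range: "j \<le> Suc d \<Longrightarrow> u j \<in> range_u"
  using u_le[of 0 j] u_le[of j "Suc d"] by simp

lemma u_inj: "i \<le> Suc d \<Longrightarrow> j \<le> Suc d \<Longrightarrow> u i = u j \<Longrightarrow> i = j"
  using u_less by (metis less_irrefl linorder_less_linear)

lemma n_le_M: "i \<in> {1..d} \<Longrightarrow> real (n i) \<le> M"
  unfolding M_def by (rule member_le_sum) auto

lemma M_ge_1: "M \<ge> 1"
  using n_le_M[of 1] n_gt_1[of 1] d_pos by simp

lemma L_pos: "L > 0"
  unfolding L_def using u_less[of 0 "Suc d"] by simp

lemma R_bound: "128 * M\<^sup>2 * L < R"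
  using R_large unfolding M_def L_def .

lemma L_R: "128 * L < R"
proof -
  have "1 \<le> M\<^sup>2" using M_ge_1 by simp
  then have "1 * L \<le> M\<^sup>2 * L" using L_pos by (intro mult_right_mono) auto
  then show ?thesis using R_bound by simp
qed

lemma R_pos: "R > 0"
  using L_R L_pos by simp

lemma gap_pos: "gap > 0" and gap_le: "gap \<le> R / 4"
  unfolding gap_def using R_pos M_ge_1 by (auto simp: field_simps)

text \<open>The origin of the constant 128: up to a distance \<open>L\<close> beyond its leftmost
  point a disc of radius \<open>R\<close> has half-width at most the root of
  \<open>2 * R * L\<close>, while \<open>(gap / 2)\<^sup>2\<close> is
  \<open>R\<^sup>2 / (64 * M\<^sup>2)\<close>.\<close>

lemma gap_sq: "2 * R * L < (gap / 2)\<^sup>2"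
proof -
  have "(gap / 2)\<^sup>2 = R * R / (64 * M\<^sup>2)" unfolding gap_def by (simp add: power2_eq_square)
  moreover have "2 * R * L * (64 * M\<^sup>2) < R * R"
    using mult_strict_left_mono[OF R_bound R_pos] by (simp add: algebra_simps)
  moreover have "0 < 64 * M\<^sup>2" using M_ge_1 by simp
  ultimately show ?thesis by (simp only: pos_less_divide_eq)
qed

lemma scaled_gap_bound:
  assumes "i \<in> {1..d}" "\<bar>t\<bar> \<le> real (n i) / 2"
  shows "\<bar>t * gap\<bar> \<le> R / 8"
proof -
  have "\<bar>t\<bar> * gap \<le> (M / 2) * gap"
    using assms(2) n_le_M[OF assms(1)] gap_pos by (intro mult_right_mono) auto
  also have "\<dots> = R / 8" unfolding gap_def using M_ge_1 by simp
  finally show ?thesis using gap_pos by (simp add: abs_mult)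
qed

lemma cc_bound: "i \<in> {1..d} \<Longrightarrow> b \<le> n i \<Longrightarrow> \<bar>cc i b\<bar> \<le> R / 8"
  unfolding cc_def by (rule scaled_gap_bound) (simp, linarith)

lemma cc_diff: "cc i b - cc i b' = (real b - real b') * gap"
  unfolding cc_def by (simp add: algebra_simps)

lemma cc_less_iff: "cc i b < cc i b' \<longleftrightarrow> b < b'"
  unfolding cc_def using gap_pos by simp

lemma range_dist_u0: "s \<in> range_u \<Longrightarrow> (s - u 0)\<^sup>2 \<le> L\<^sup>2"
  unfolding L_def by (rule power_mono) auto

lemma L_sq: "128 * L\<^sup>2 \<le> R\<^sup>2"
proof -
  have "(128 * L)\<^sup>2 \<le> R\<^sup>2" using L_R L_pos by (intro power_mono) auto
  then have "16384 * L\<^sup>2 \<le> R\<^sup>2" by (simp add: power_mult_distrib)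
  then show ?thesis using zero_le_power2[of L] by linarith
qed

lemma lh_sq: "lh\<^sup>2 = R\<^sup>2 - (L / 2)\<^sup>2" and lh_pos: "lh > 0"
proof -
  have "(L / 2)\<^sup>2 < R\<^sup>2" using L_R L_pos by (intro power_strict_mono) auto
  then show "lh\<^sup>2 = R\<^sup>2 - (L / 2)\<^sup>2" "lh > 0" unfolding lh_def by auto
qed

text \<open>Here and below the plain condition is the weak one, for the closure, and the primed one
  its strict form, for the open region.\<close>

definition tube :: "real \<Rightarrow> real \<Rightarrow> bool"
  where "tube s y \<longleftrightarrow> (\<bar>y\<bar> + R / 2)\<^sup>2 \<le> R\<^sup>2 - (s - u 0)\<^sup>2"
definition tube' :: "real \<Rightarrow> real \<Rightarrow> bool"
  where "tube' s y \<longleftrightarrow> (\<bar>y\<bar> + R / 2)\<^sup>2 < R\<^sup>2 - (s - u 0)\<^sup>2"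
definition off :: "nat \<Rightarrow> nat \<Rightarrow> real \<Rightarrow> real \<Rightarrow> bool"
  where "off i b s y \<longleftrightarrow> R\<^sup>2 \<le> (s - (u i + R))\<^sup>2 + (y - cc i b)\<^sup>2"
definition off' :: "nat \<Rightarrow> nat \<Rightarrow> real \<Rightarrow> real \<Rightarrow> bool"
  where "off' i b s y \<longleftrightarrow> R\<^sup>2 < (s - (u i + R))\<^sup>2 + (y - cc i b)\<^sup>2"
definition lens :: "real \<Rightarrow> real \<Rightarrow> bool"
  where "lens s y \<longleftrightarrow> (\<bar>y\<bar> + lh)\<^sup>2 \<le> R\<^sup>2 - (s - mid)\<^sup>2"
definition lens' :: "real \<Rightarrow> real \<Rightarrow> bool"
  where "lens' s y \<longleftrightarrow> (\<bar>y\<bar> + lh)\<^sup>2 < R\<^sup>2 - (s - mid)\<^sup>2"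

lemma lh_sq_le: "(\<bar>y\<bar> + lh)\<^sup>2 \<ge> R\<^sup>2 - (L / 2)\<^sup>2"
proof -
  have "lh\<^sup>2 \<le> (\<bar>y\<bar> + lh)\<^sup>2" using lh_pos by (intro power_mono) auto
  then show ?thesis using lh_sq by simp
qed

lemma mid_dist: "(s - mid)\<^sup>2 \<le> (L / 2)\<^sup>2 \<longleftrightarrow> s \<in> range_u" "(s - mid)\<^sup>2 < (L / 2)\<^sup>2 \<longleftrightarrow> s \<in> {u 0<..<u (Suc d)}"
proof -
  have "(s - mid)\<^sup>2 \<le> (L / 2)\<^sup>2 \<longleftrightarrow> \<bar>s - mid\<bar> \<le> L / 2"
    using L_pos abs_le_square_iff[of "s - mid" "L / 2"] by simp
  then show "(s - mid)\<^sup>2 \<le> (L / 2)\<^sup>2 \<longleftrightarrow> s \<in> range_u"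
    unfolding mid_def L_def by (auto simp: abs_le_iff field_simps)
  have "(s - mid)\<^sup>2 < (L / 2)\<^sup>2 \<longleftrightarrow> \<bar>s - mid\<bar> < L / 2"
    using L_pos abs_square_less_1 power2_less_imp_less[of "\<bar>s - mid\<bar>" "L / 2"]
      power_strict_mono[of "\<bar>s - mid\<bar>" "L / 2" 2] by auto
  then show "(s - mid)\<^sup>2 < (L / 2)\<^sup>2 \<longleftrightarrow> s \<in> {u 0<..<u (Suc d)}"
    unfolding mid_def L_def by (auto simp: abs_less_iff field_simps)
qed

lemma lens_range: "lens s y \<Longrightarrow> s \<in> range_u"
  using lh_sq_le[of y] mid_dist(1)[of s] unfolding lens_def by linarith

lemma lens'_range: "lens' s y \<Longrightarrow> s \<in> {u 0<..<u (Suc d)}"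
  using lh_sq_le[of y] mid_dist(2)[of s] unfolding lens'_def by linarith

lemma lens_0: "s \<in> range_u \<Longrightarrow> lens s 0"
  using mid_dist(1)[of s] lh_sq unfolding lens_def by simp

lemma lens'_0: "s \<in> {u 0<..<u (Suc d)} \<Longrightarrow> lens' s 0"
  using mid_dist(2)[of s] lh_sq unfolding lens'_def by simp

lemma lens_corner:
  assumes "lens s y" "s = u 0 \<or> s = u (Suc d)"
  shows "y = 0"
proof -
  have "(s - mid)\<^sup>2 = (L / 2)\<^sup>2" using assms(2) unfolding mid_def L_def
    by (auto simp: power2_eq_square field_simps)
  then have "(\<bar>y\<bar> + lh)\<^sup>2 \<le> lh\<^sup>2" using assms(1) lh_sq unfolding lens_def by simp
  then have "\<bar>y\<bar> + lh \<le> lh" using lh_pos power2_le_imp_le by force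
  then show ?thesis by simp
qed

lemma tube'_small:
  assumes "s \<in> range_u" "\<bar>y\<bar> \<le> R / 4"
  shows "tube' s y"
proof -
  have "(\<bar>y\<bar> + R / 2)\<^sup>2 \<le> (3 * R / 4)\<^sup>2" using assms(2) R_pos by (intro power_mono) auto
  then have "16 * (\<bar>y\<bar> + R / 2)\<^sup>2 \<le> 9 * R\<^sup>2" by (simp add: power_divide power_mult_distrib)
  moreover have "R\<^sup>2 > 0" using R_pos by simp
  ultimately show ?thesis using L_sq range_dist_u0[OF assms(1)] unfolding tube'_def by linarith
qed

lemma tube'_imp_tube: "tube' s y \<Longrightarrow> tube s y"
  and off'_imp_off: "off' i b s y \<Longrightarrow> off i b s y"
  and lens'_imp_lens: "lens' s y \<Longrightarrow> lens s y"
  unfolding tube_def tube'_def off_def off'_def lens_def lens'_def by auto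

lemma tube_decrease:
  assumes "tube s y" "u 0 \<le> s'" "s' < s"
  shows "tube' s' y"
proof -
  have "(s' - u 0)\<^sup>2 < (s - u 0)\<^sup>2" using assms by (intro power_strict_mono) auto
  then show ?thesis using assms(1) unfolding tube_def tube'_def by simp
qed

text \<open>Since \<open>L < R\<close>, every height in range lies to the left of the disc's centre.
  Only the left half of the disc is seen, and its sections grow with the height.\<close>

lemma disc_sq:
  assumes "i \<in> {1..d}" "s \<in> range_u" "s' < s"
  shows "(s - (u i + R))\<^sup>2 < (s' - (u i + R))\<^sup>2"
proof -
  have "s - u i \<le> L" using assms(1,2) u_le[of 0 i] unfolding L_def by simp
  then have "s < u i + R" using L_R L_pos by simp
  then have "((u i + R) - s)\<^sup>2 < ((u i + R) - s')\<^sup>2" using assms by (intro power_strict_mono) auto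
  then show ?thesis by (simp add: power2_commute)
qed

lemma off_decrease:
  assumes "off i b s y" "i \<in> {1..d}" "s \<in> range_u" "s' < s"
  shows "off' i b s' y"
  using disc_sq[OF assms(2-4)] assms(1) unfolding off_def off'_def by linarith

lemma off_at:
  assumes "i \<in> {1..d}"
  shows "off i b (u i) y" "off' i b (u i) y \<longleftrightarrow> y \<noteq> cc i b"
  unfolding off_def off'_def by auto

lemma off'_before:
  assumes "i \<in> {1..d}" "s < u i"
  shows "off' i b s y"
  by (rule off_decrease[OF off_at(1)[OF assms(1)]]) (use assms u_in_range[of i] in auto)

lemma off_after:
  assumes "i \<in> {1..d}" "s \<in> range_u" "u i < s" "off i b s y"
  shows "y \<noteq> cc i b"
proof
  assume "y = cc i b"
  then have "off' i b (u i) y" using off_decrease[OF assms(4,1-3)] by simp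
  then show False using off_at(2)[OF assms(1)] \<open>y = cc i b\<close> by simp
qed

lemma near_disc:
  assumes i: "i \<in> {1..d}" and s: "s \<in> range_u" and no: "\<not> off' i b s y"
  shows "\<bar>y - cc i b\<bar> < gap / 2" "u i \<le> s"
proof -
  show us: "u i \<le> s" using off'_before[OF i, of s b y] no by (meson not_less)
  have "s - u i \<le> L" using i s u_le[of 0 i] unfolding L_def by simp
  then have *: "2 * R * (s - u i) \<le> 2 * R * L" using R_pos by simp
  have "R\<^sup>2 - (s - (u i + R))\<^sup>2 = 2 * R * (s - u i) - (s - u i)\<^sup>2"
    by (simp add: power2_eq_square algebra_simps)
  then have "(y - cc i b)\<^sup>2 < (gap / 2)\<^sup>2"
    using no gap_sq * zero_le_power2[of "s - u i"] unfolding off'_def by linarith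
  then have "\<bar>y - cc i b\<bar>\<^sup>2 < (gap / 2)\<^sup>2" by simp
  then show "\<bar>y - cc i b\<bar> < gap / 2" by (rule power2_less_imp_less) (use gap_pos in simp)
qed

lemma near_disc_small:
  assumes "i \<in> {1..d}" "b \<le> n i" "s \<in> range_u" "\<not> off' i b s y"
  shows "\<bar>y\<bar> \<le> R / 4"
  using near_disc(1)[OF assms(1,3,4)] cc_bound[OF assms(1,2)] gap_le by linarith

text \<open>The centres are at least \<open>gap\<close> apart and the half-widths stay below
  \<open>gap / 2\<close>.\<close>

lemma near_disc_unique:
  assumes "i \<in> {1..d}" "s \<in> range_u" "\<not> off' i b s y" "\<not> off' i b' s y"
  shows "b = b'"
proof (rule ccontr)
  assume "b \<noteq> b'"
  then have "1 \<le> \<bar>real b - real b'\<bar>" by linarith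
  then have "1 * gap \<le> \<bar>real b - real b'\<bar> * gap" using gap_pos by (intro mult_right_mono) auto
  then have "gap \<le> \<bar>cc i b - cc i b'\<bar>" unfolding cc_diff using gap_pos by (simp add: abs_mult)
  then show False using near_disc(1)[OF assms(1-3)] near_disc(1)[OF assms(1,2,4)] by linarith
qed

text \<open>The centre of the interval between the discs \<open>b\<close> and \<open>b + 1\<close>.\<close>

definition slot :: "nat \<Rightarrow> nat \<Rightarrow> real"
  where "slot i b = (real b + 1 / 2 - real (n i) / 2) * gap"

lemma slot:
  assumes "i \<in> {1..d}" "b < n i" "s \<in> range_u"
  shows "tube' s (slot i b)" "off' i c s (slot i b)" "cc i c < slot i b \<longleftrightarrow> c \<le> b"
proof -
  have "\<bar>slot i b\<bar> \<le> R / 8"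
    unfolding slot_def by (rule scaled_gap_bound) (use assms in \<open>simp, linarith\<close>)
  then show "tube' s (slot i b)" using tube'_small assms(3) R_pos by simp
  have diff: "slot i b - cc i c = (real b + 1 / 2 - real c) * gap"
    unfolding slot_def cc_def by (simp add: algebra_simps)
  have "real c \<le> real b \<or> real b + 1 \<le> real c" by (cases "c \<le> b") auto
  then have "1 / 2 \<le> \<bar>real b + 1 / 2 - real c\<bar>" by linarith
  then have "1 / 2 * gap \<le> \<bar>real b + 1 / 2 - real c\<bar> * gap"
    using gap_pos by (intro mult_right_mono) auto
  then have "gap / 2 \<le> \<bar>slot i b - cc i c\<bar>" unfolding diff using gap_pos by (simp add: abs_mult)
  then show "off' i c s (slot i b)" using near_disc(1)[OF assms(1,3)] by force
  have "cc i c < slot i b \<longleftrightarrow> 0 < (real b + 1 / 2 - real c) * gap" using diff by linarith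
  also have "\<dots> \<longleftrightarrow> 0 < real b + 1 / 2 - real c" using gap_pos by (simp add: zero_less_mult_iff)
  also have "\<dots> \<longleftrightarrow> c \<le> b" by linarith
  finally show "cc i c < slot i b \<longleftrightarrow> c \<le> b" .
qed

end

text \<open>Convexity of the square, with strictness inherited from the second end: a segment from
  the closed intersection of two discs to a point of its interior is interior right after its start.
  It serves the tube and the lens alike.\<close>

lemma disc_segment:
  fixes y y' s s' B c R t :: real
  assumes in1: "(\<bar>y\<bar> + B)\<^sup>2 \<le> R\<^sup>2 - (s - c)\<^sup>2" and in2: "(\<bar>y'\<bar> + B)\<^sup>2 < R\<^sup>2 - (s' - c)\<^sup>2"
    and B: "B \<ge> 0" and t: "0 < t" "t \<le> 1"
  shows "(\<bar>(1 - t) * y + t * y'\<bar> + B)\<^sup>2 < R\<^sup>2 - ((1 - t) * s + t * s' - c)\<^sup>2"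
proof -
  have conv: "((1 - t) * a + t * b)\<^sup>2 \<le> (1 - t) * a\<^sup>2 + t * b\<^sup>2" for a b :: real
  proof -
    have "(1 - t) * a\<^sup>2 + t * b\<^sup>2 - ((1 - t) * a + t * b)\<^sup>2 = (1 - t) * t * (a - b)\<^sup>2"
      by (simp add: power2_eq_square algebra_simps)
    also have "\<dots> \<ge> 0" using t by simp
    finally show ?thesis by simp
  qed
  have "\<bar>(1 - t) * y + t * y'\<bar> \<le> (1 - t) * \<bar>y\<bar> + t * \<bar>y'\<bar>"
    using abs_triangle_ineq[of "(1 - t) * y" "t * y'"] t by (simp add: abs_mult)
  then have "\<bar>(1 - t) * y + t * y'\<bar> + B \<le> (1 - t) * (\<bar>y\<bar> + B) + t * (\<bar>y'\<bar> + B)"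
    by (simp add: algebra_simps)
  then have "(\<bar>(1 - t) * y + t * y'\<bar> + B)\<^sup>2 \<le> ((1 - t) * (\<bar>y\<bar> + B) + t * (\<bar>y'\<bar> + B))\<^sup>2"
    using B by (intro power_mono) auto
  also have "\<dots> \<le> (1 - t) * (\<bar>y\<bar> + B)\<^sup>2 + t * (\<bar>y'\<bar> + B)\<^sup>2" by (rule conv)
  finally have 1: "(\<bar>(1 - t) * y + t * y'\<bar> + B)\<^sup>2 \<le> (1 - t) * (\<bar>y\<bar> + B)\<^sup>2 + t * (\<bar>y'\<bar> + B)\<^sup>2" .
  have "(1 - t) * s + t * s' - c = (1 - t) * (s - c) + t * (s' - c)" by (simp add: algebra_simps)
  then have 2: "((1 - t) * s + t * s' - c)\<^sup>2 \<le> (1 - t) * (s - c)\<^sup>2 + t * (s' - c)\<^sup>2"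
    using conv[of "s - c" "s' - c"] by simp
  have 3: "(1 - t) * (\<bar>y\<bar> + B)\<^sup>2 \<le> (1 - t) * (R\<^sup>2 - (s - c)\<^sup>2)"
    using in1 t by (intro mult_left_mono) auto
  have 4: "t * (\<bar>y'\<bar> + B)\<^sup>2 < t * (R\<^sup>2 - (s' - c)\<^sup>2)"
    using in2 t by (intro mult_strict_left_mono) auto
  have "(1 - t) * (R\<^sup>2 - (s - c)\<^sup>2) + t * (R\<^sup>2 - (s' - c)\<^sup>2) =
    R\<^sup>2 - ((1 - t) * (s - c)\<^sup>2 + t * (s' - c)\<^sup>2)" by (simp add: algebra_simps)
  then show ?thesis using 1 2 3 4 by linarith
qed

lemma curve_start_in_closure:
  fixes g :: "real \<Rightarrow> nat \<Rightarrow> real"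
  assumes "\<And>i. continuous_on {0..1} (\<lambda>t. g t i)" "\<And>t. 0 < t \<Longrightarrow> t < 1 \<Longrightarrow> g t \<in> S"
  shows "g 0 \<in> closure S"
proof -
  have "continuous_on (closure {0<..<1}) g"
    using continuous_on_coordinatewise_then_product[of "{0..1}" g] assms(1) by simp
  then have "g ` closure {0<..<1} \<subseteq> closure S"
    by (rule image_closure_subset) (use assms(2) closure_subset[of S] in auto)
  then show ?thesis by auto
qed

lemma connected_component_curve:
  fixes g :: "real \<Rightarrow> nat \<Rightarrow> real"
  assumes "\<And>i. continuous_on {0..1} (\<lambda>t. g t i)" "\<And>t. 0 \<le> t \<Longrightarrow> t \<le> 1 \<Longrightarrow> g t \<in> S"
  shows "connected_component S (g 0) (g 1)"
  unfolding connected_component_def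
proof (intro exI conjI)
  show "connected (g ` {0..1})"
    by (intro connected_continuous_image continuous_on_coordinatewise_then_product assms(1)) simp
qed (use assms(2) in auto)

section \<open>The region, its closure and its connectedness\<close>

context tower
begin

text \<open>Index pairs of the walls. For \<open>i \<le> d\<close> the extreme values
  \<open>b = 0\<close> and \<open>b = n i\<close> stand for the large discs and those between for
  the removed ones, which makes \<open>n i + 1\<close> walls; the last plane adds the two of the
  lens.\<close>

definition planes :: "(nat \<times> nat) set"
  where "planes = (SIGMA i:{1..Suc d}. {0..if i = Suc d then 1 else n i})"

definition centre0 :: "nat \<times> nat \<Rightarrow> real"
  where "centre0 = (\<lambda>(i, b). if i = Suc d then mid else if b = 0 \<or> b = n i then u 0 else u i + R)"

definition centre1 :: "nat \<times> nat \<Rightarrow> real"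
  where "centre1 = (\<lambda>(i, b). if i = Suc d then (if b = 0 then lh else - lh)
    else if b = 0 then R / 2 else if b = n i then - (R / 2) else cc i b)"

text \<open>Removed discs are entered with the opposite sign, so that the region is where all walls
  are positive.\<close>

definition sign :: "nat \<times> nat \<Rightarrow> real"
  where "sign = (\<lambda>(i, b). if i \<noteq> Suc d \<and> b \<noteq> 0 \<and> b \<noteq> n i then -1 else 1)"

definition wall :: "nat \<times> nat \<Rightarrow> (nat \<Rightarrow> real) \<Rightarrow> real"
  where "wall q x = sign q * circ R (fst q) (centre0 q) (centre1 q) x"

abbreviation E :: "(nat \<Rightarrow> real) set"
  where "E \<equiv> {x. \<forall>i\<ge>d + 2. x i = 0}"

definition K :: "(nat \<Rightarrow> real) set"
  where "K = {x \<in> E. (\<forall>i\<in>{1..d}. tube (x 0) (x i) \<and> (\<forall>b\<in>{1..<n i}. off i b (x 0) (x i))) \<and>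
    lens (x 0) (x (Suc d))}"

definition D :: "(nat \<Rightarrow> real) set"
  where "D = {x \<in> E. (\<forall>i\<in>{1..d}. tube' (x 0) (x i) \<and> (\<forall>b\<in>{1..<n i}. off' i b (x 0) (x i))) \<and>
    lens' (x 0) (x (Suc d))}"

lemma planes_cases:
  assumes "(i, b) \<in> planes"
  obtains (low) "i \<in> {1..d}" "b = 0" | (high) "i \<in> {1..d}" "b = n i" "b \<noteq> 0"
    | (disc) "i \<in> {1..d}" "b \<in> {1..<n i}" | (last) "i = Suc d" "b = 0 \<or> b = 1"
  using assms unfolding planes_def by (force split: if_splits)

lemma planes_iff:
  "(i, b) \<in> planes \<longleftrightarrow> i \<in> {1..d} \<and> b \<le> n i \<or> i = Suc d \<and> b \<le> 1"
  unfolding planes_def by auto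

lemma finite_planes: "finite planes"
  unfolding planes_def by auto

lemma wall_simps:
  "i \<in> {1..d} \<Longrightarrow> wall (i, 0) x = R\<^sup>2 - (x 0 - u 0)\<^sup>2 - (x i - R / 2)\<^sup>2"
  "i \<in> {1..d} \<Longrightarrow> wall (i, n i) x = R\<^sup>2 - (x 0 - u 0)\<^sup>2 - (x i + R / 2)\<^sup>2"
  "i \<in> {1..d} \<Longrightarrow> b \<in> {1..<n i} \<Longrightarrow>
    wall (i, b) x = (x 0 - (u i + R))\<^sup>2 + (x i - cc i b)\<^sup>2 - R\<^sup>2"
  "wall (Suc d, 0) x = R\<^sup>2 - (x 0 - mid)\<^sup>2 - (x (Suc d) - lh)\<^sup>2"
  "wall (Suc d, 1) x = R\<^sup>2 - (x 0 - mid)\<^sup>2 - (x (Suc d) + lh)\<^sup>2"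
  using n_gt_1[of i]
  by (auto simp: wall_def sign_def centre0_def centre1_def circ_def)

lemma ball_planes:
  "(\<forall>q\<in>planes. P q) \<longleftrightarrow>
    (\<forall>i\<in>{1..d}. P (i, 0) \<and> P (i, n i) \<and> (\<forall>b\<in>{1..<n i}. P (i, b))) \<and> P (Suc d, 0) \<and> P (Suc d, 1)"
  (is "?l \<longleftrightarrow> ?r")
proof
  assume ?l
  then show ?r by (auto simp: planes_iff)
next
  assume r: ?r
  show ?l
  proof
    fix q assume "q \<in> planes"
    moreover obtain i b where q: "q = (i, b)" by (cases q)
    ultimately have "(i, b) \<in> planes" by simp
    then show "P q" unfolding q by (cases rule: planes_cases) (use r in auto)
  qed
qed

lemma wall_tube:
  assumes "i \<in> {1..d}"
  shows "0 \<le> wall (i, 0) x \<and> 0 \<le> wall (i, n i) x \<longleftrightarrow> tube (x 0) (x i)"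
    "0 < wall (i, 0) x \<and> 0 < wall (i, n i) x \<longleftrightarrow> tube' (x 0) (x i)"
proof -
  have "R / 2 \<ge> 0" using R_pos by simp
  note * = abs_sum_le_iff[OF this]
  show "0 \<le> wall (i, 0) x \<and> 0 \<le> wall (i, n i) x \<longleftrightarrow> tube (x 0) (x i)"
    "0 < wall (i, 0) x \<and> 0 < wall (i, n i) x \<longleftrightarrow> tube' (x 0) (x i)"
    using assms unfolding tube_def tube'_def * by (auto simp: wall_simps)
qed

lemma wall_lens:
  "0 \<le> wall (Suc d, 0) x \<and> 0 \<le> wall (Suc d, 1) x \<longleftrightarrow> lens (x 0) (x (Suc d))"
  "0 < wall (Suc d, 0) x \<and> 0 < wall (Suc d, 1) x \<longleftrightarrow> lens' (x 0) (x (Suc d))"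
proof -
  have "lh \<ge> 0" using lh_pos by simp
  note * = abs_sum_le_iff[OF this]
  show "0 \<le> wall (Suc d, 0) x \<and> 0 \<le> wall (Suc d, 1) x \<longleftrightarrow> lens (x 0) (x (Suc d))"
    "0 < wall (Suc d, 0) x \<and> 0 < wall (Suc d, 1) x \<longleftrightarrow> lens' (x 0) (x (Suc d))"
    unfolding lens_def lens'_def * wall_simps by auto
qed

lemma wall_off:
  assumes "i \<in> {1..d}" "b \<in> {1..<n i}"
  shows "0 \<le> wall (i, b) x \<longleftrightarrow> off i b (x 0) (x i)" "0 < wall (i, b) x \<longleftrightarrow> off' i b (x 0) (x i)"
  unfolding off_def off'_def wall_simps(3)[OF assms] by auto

lemma K_wall: "K = {x \<in> E. \<forall>q\<in>planes. 0 \<le> wall q x}"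
  unfolding K_def ball_planes using wall_tube(1) wall_lens(1) wall_off(1) by blast

lemma D_wall: "D = {x \<in> E. \<forall>q\<in>planes. 0 < wall q x}"
  unfolding D_def ball_planes using wall_tube(2) wall_lens(2) wall_off(2) by blast

lemma K_range: "x \<in> K \<Longrightarrow> x 0 \<in> range_u"
  unfolding K_def using lens_range by blast

lemma continuous_wall: "continuous_on S (wall q)"
  unfolding wall_def circ_def
  by (intro continuous_intros continuous_on_subset[OF continuous_on_product_coordinates]) auto

lemma closed_E: "closed E"
  using closedin_Euclidean_imp_closed[OF closedin_topspace, of "d + 2"]
  by (simp add: topspace_Euclidean_space)

lemma closed_K: "closed K"
proof -
  have "K = E \<inter> (\<Inter>q\<in>planes. {x. 0 \<le> wall q x})" unfolding K_wall by auto
  moreover have "closed {x. 0 \<le> wall q x}" for q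
    by (intro closed_Collect_le continuous_wall continuous_on_const)
  ultimately show ?thesis by (simp only:) (intro closed_Int closed_E closed_INT ballI)
qed

lemma open_D: "openin (Euclidean_space (d + 2)) D"
proof -
  have "D = E \<inter> (\<Inter>q\<in>planes. {x. 0 < wall q x})" unfolding D_wall by auto
  moreover have "open {x. 0 < wall q x}" for q
    by (intro open_Collect_less continuous_wall continuous_on_const)
  ultimately show ?thesis unfolding Euclidean_space_eq
    by (simp only:) (intro openin_open_Int open_INT ballI finite_planes)
qed

lemma D_subset_K: "D \<subseteq> K"
  unfolding D_def K_def using tube'_imp_tube off'_imp_off lens'_imp_lens by blast

lemma K_coordinate_bound:
  assumes "x \<in> K" "i \<in> {1..Suc d}"
  shows "\<bar>x i\<bar> \<le> R"
proof (cases "i = Suc d")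
  case True
  have "(\<bar>x i\<bar> + lh)\<^sup>2 \<le> R\<^sup>2 - (x 0 - mid)\<^sup>2"
    using assms True unfolding K_def lens_def by simp
  then have "(\<bar>x i\<bar> + lh)\<^sup>2 \<le> R\<^sup>2" using zero_le_power2[of "x 0 - mid"] by linarith
  then have "\<bar>x i\<bar> + lh \<le> R" by (rule power2_le_imp_le) (use R_pos in simp)
  then show ?thesis using lh_pos by simp
next
  case False
  have "(\<bar>x i\<bar> + R / 2)\<^sup>2 \<le> R\<^sup>2 - (x 0 - u 0)\<^sup>2"
    using assms False unfolding K_def tube_def by simp
  then have "(\<bar>x i\<bar> + R / 2)\<^sup>2 \<le> R\<^sup>2" using zero_le_power2[of "x 0 - u 0"] by linarith
  then have "\<bar>x i\<bar> + R / 2 \<le> R" by (rule power2_le_imp_le) (use R_pos in simp)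
  then show ?thesis using R_pos by simp
qed

text \<open>The ambient type is an infinite product, so compactness comes from enclosing
  \<open>K\<close> in a product of compact intervals, with factor \<open>{0}\<close> beyond the
  coordinate \<open>d + 1\<close>.\<close>

lemma compact_K: "compact K"
proof -
  define box where "box i = (if i = 0 then range_u else if i \<le> Suc d then {-R..R} else {0})" for i
  have "compactin (product_topology (\<lambda>i. euclidean) UNIV) (PiE UNIV box)"
    unfolding compactin_PiE by (auto simp: box_def)
  then have "compact (PiE UNIV box)" 
    unfolding euclidean_product_topology compactin_euclidean_iff .
  moreover have "K \<subseteq> PiE UNIV box"
  proof
    fix x assume x: "x \<in> K"
    then have "x i \<in> box i" for i
      using K_range[OF x] K_coordinate_bound[OF x, of i] unfolding box_def K_def
      by (auto simp: abs_le_iff)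
    then show "x \<in> PiE UNIV box" by auto
  qed
  ultimately show ?thesis using closed_K compact_Int_closed by (metis inf.absorb_iff2)
qed

text \<open>Lowers the height, keeps the coordinates \<open>1\<close>, ..., \<open>d\<close> and
  contracts the last one to the axis of the lens. The tube and disc conditions become strict by
  monotonicity in the height, the lens condition by convexity.\<close>

definition descent :: "real \<Rightarrow> (nat \<Rightarrow> real) \<Rightarrow> real \<Rightarrow> nat \<Rightarrow> real"
  where "descent s x t i = (if i = 0 then (1 - t) * x 0 + t * s
    else if i = Suc d then (1 - t) * x (Suc d) else x i)"

lemma continuous_descent: "continuous_on S (\<lambda>t. descent s x t i)"
  unfolding descent_def by (cases "i = 0"; cases "i = Suc d") (auto intro!: continuous_intros)

lemma descent_0: "descent s x 0 = x"
  by (rule ext) (simp add: descent_def)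

lemma descent_level:
  assumes "u 0 < s" "s < x 0" "0 < t" "t \<le> 1"
  shows "u 0 < descent s x t 0" "descent s x t 0 < x 0"
proof -
  have "(1 - t) * s \<le> (1 - t) * x 0" "t * s < t * x 0" using assms by (auto intro: mult_left_mono)
  then have "s \<le> (1 - t) * x 0 + t * s" "(1 - t) * x 0 + t * s < x 0"
    by (simp_all add: algebra_simps)
  then show "u 0 < descent s x t 0" "descent s x t 0 < x 0" using assms by (auto simp: descent_def)
qed

lemma descent_in_D:
  assumes x: "x \<in> K" and s: "u 0 < s" "s < x 0" and t: "0 < t" "t \<le> 1"
  shows "descent s x t \<in> D"
proof -
  note lev = descent_level[of s x t, OF s t]
  have r: "x 0 \<in> range_u" using K_range[OF x] .
  have E: "descent s x t \<in> E" using x unfolding K_def descent_def by auto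
  have "tube' (descent s x t 0) (descent s x t i)"
    "\<And>b. b \<in> {1..<n i} \<Longrightarrow> off' i b (descent s x t 0) (descent s x t i)" if i: "i \<in> {1..d}" for i
  proof -
    have xi: "descent s x t i = x i" using i by (simp add: descent_def)
    show "tube' (descent s x t 0) (descent s x t i)"
      unfolding xi by (rule tube_decrease) (use x i lev in \<open>auto simp: K_def\<close>)
    show "off' i b (descent s x t 0) (descent s x t i)" if "b \<in> {1..<n i}" for b
      unfolding xi by (rule off_decrease[of _ _ "x 0"]) (use x i lev that r in \<open>auto simp: K_def\<close>)
  qed
  moreover have "lens' (descent s x t 0) (descent s x t (Suc d))"
  proof -
    have "lens (x 0) (x (Suc d))" using x unfolding K_def by blast
    moreover have "lens' s 0" using lens'_0 s r by simp
    ultimately show ?thesis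
      using disc_segment[of "x (Suc d)" lh R "x 0" mid 0 s t] lh_pos t
      unfolding lens_def lens'_def by (simp add: descent_def)
  qed
  ultimately show ?thesis unfolding D_def using E by blast
qed

text \<open>Below \<open>u 1\<close> no removed disc has begun, so only the convex conditions
  remain.\<close>

lemma segment_in_D:
  assumes x: "x \<in> K" and y: "y \<in> D" and low: "x 0 < u 1" "y 0 < u 1" and t: "0 < t" "t \<le> 1"
  shows "(\<lambda>i. (1 - t) * x i + t * y i) \<in> D" (is "?z \<in> _")
proof -
  have "?z \<in> E" using x D_subset_K y unfolding K_def by auto
  moreover have z0: "?z 0 < u 1"
  proof -
    have "(1 - t) * x 0 \<le> (1 - t) * u 1" "t * y 0 < t * u 1"
      using low t by (auto intro: mult_left_mono)
    then show ?thesis by (simp add: algebra_simps)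
  qed
  moreover have "tube' (?z 0) (?z i)" if "i \<in> {1..d}" for i
    using disc_segment[of "x i" "R / 2" R "x 0" "u 0" "y i" "y 0" t] x y that R_pos t
    unfolding K_def D_def tube_def tube'_def by simp
  moreover have "off' i b (?z 0) (?z i)" if "i \<in> {1..d}" for i b
    by (rule off'_before[OF that]) (use z0 u_le[of 1 i] that in auto)
  moreover have "lens' (?z 0) (?z (Suc d))"
    using disc_segment[of "x (Suc d)" lh R "x 0" mid "y (Suc d)" "y 0" t] x y lh_pos t
    unfolding K_def D_def lens_def lens'_def by simp
  ultimately show ?thesis unfolding D_def by blast
qed

definition base :: "nat \<Rightarrow> real"
  where "base i = (if i = 0 then (u 0 + u 1) / 2 else 0)"

lemma base: "base \<in> D" "base 0 < u 1"
proof -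
  have u: "u 0 < u 1" "u 1 < u (Suc d)" using u_less d_pos by auto
  then have s: "u 0 < base 0" "base 0 < u 1" by (auto simp: base_def)
  then show "base 0 < u 1" by simp
  have "tube' (base 0) (base i)" if "i \<in> {1..d}" for i
    by (rule tube'_small) (use that s u R_pos in \<open>auto simp: base_def\<close>)
  moreover have "off' i b (base 0) (base i)" if "i \<in> {1..d}" for i b
    by (rule off'_before[OF that]) (use s u_le[of 1 i] that in auto)
  moreover have "lens' (base 0) (base (Suc d))"
    using lens'_0[of "base 0"] s u by (auto simp: base_def)
  ultimately show "base \<in> D" unfolding D_def by (auto simp: base_def)
qed

lemma K_subset_closure_D: "K \<subseteq> closure D"
proof
  fix x assume x: "x \<in> K"
  show "x \<in> closure D"
  proof (cases "u 0 < x 0")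
    case True
    have "descent ((u 0 + x 0) / 2) x 0 \<in> closure D"
      by (rule curve_start_in_closure[OF continuous_descent])
        (rule descent_in_D[OF x], use True in auto)
    then show ?thesis by (simp add: descent_0)
  next
    case False
    \<comment> \<open>Over the lowest height no descent is possible; a segment to an interior point
      replaces it.\<close>
    then have "x 0 < u 1" using u_less[of 0 1] by simp
    then have "(\<lambda>i. (1 - 0) * x i + 0 * base i) \<in> closure D"
      using base by (intro curve_start_in_closure[of "\<lambda>t i. (1 - t) * x i + t * base i"]
          continuous_intros segment_in_D[OF x]) auto
    then show ?thesis by simp
  qed
qed

lemma closure_of_D: "Euclidean_space (d + 2) closure_of D = K"
proof (rule subset_antisym)
  have "closedin (Euclidean_space (d + 2)) K"
    unfolding closedin_Euclidean_space_iff using closed_K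
    by (auto simp: K_def topspace_Euclidean_space)
  then show "Euclidean_space (d + 2) closure_of D \<subseteq> K"
    using D_subset_K by (intro closure_of_minimal)
  have "D \<subseteq> E" unfolding D_def by blast
  then have "E \<inter> D = D" by blast
  then have "Euclidean_space (d + 2) closure_of D = E \<inter> closure D"
    unfolding Euclidean_space_eq by (simp add: closure_of_subtopology)
  moreover have "K \<subseteq> E" unfolding K_def by blast
  ultimately show "K \<subseteq> Euclidean_space (d + 2) closure_of D" using K_subset_closure_D by blast
qed

text \<open>Every point descends inside \<open>D\<close> to a height below \<open>u 1\<close>, from
  where a segment leads to \<open>base\<close>.\<close>

lemma connected_D: "connected D"
  unfolding connected_iff_connected_component
proof -
  have low: "connected_component D y base" if "y \<in> D" "y 0 < u 1" for y
  proof -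
    have "connected_component D ((\<lambda>t i. (1 - t) * y i + t * base i) 0)
        ((\<lambda>t i. (1 - t) * y i + t * base i) 1)"
    proof (rule connected_component_curve)
      fix t :: real assume t: "0 \<le> t" "t \<le> 1"
      show "(\<lambda>i. (1 - t) * y i + t * base i) \<in> D"
      proof (cases "t = 0")
        case False
        then show ?thesis
          using segment_in_D[of y base t] D_subset_K that base t by auto
      qed (use that in simp)
    qed (intro continuous_intros)
    then show ?thesis by simp
  qed
  have all: "connected_component D y base" if y: "y \<in> D" for y
  proof -
    have y0: "u 0 < y 0" using y lens'_range unfolding D_def by auto
    define s where "s = (u 0 + min (y 0) (u 1)) / 2"
    have s: "u 0 < s" "s < y 0" "s < u 1"
      using y0 u_less[of 0 1] unfolding s_def by (auto simp: min_def)
    have "connected_component D (descent s y 0) (descent s y 1)"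
    proof (rule connected_component_curve[OF continuous_descent])
      fix t :: real assume t: "0 \<le> t" "t \<le> 1"
      show "descent s y t \<in> D"
        using descent_in_D[of y s t] y D_subset_K s t descent_0[of s y] by (cases "t = 0") auto
    qed
    moreover have "descent s y 1 \<in> D" using descent_in_D[of y s 1] y D_subset_K s by auto
    moreover have "descent s y 1 0 < u 1" using s by (simp add: descent_def)
    ultimately show ?thesis using low connected_component_trans descent_0 by metis
  qed
  then show "\<forall>x\<in>D. \<forall>y\<in>D. connected_component D x y"
    using connected_component_trans connected_component_sym by metis
qed

end

section \<open>Components of the level sets\<close>

lemma connected_component_of_top_of_set:
  "connected_component_of_set (top_of_set S) x = connected_component_set S x"
  by (auto simp: connected_component_of_def connected_component_def connectedin_subtopology)

lemma abs_convex_le: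
  fixes y z t :: real
  assumes "0 \<le> t" "t \<le> 1"
  shows "\<bar>(1 - t) * y + t * z\<bar> \<le> max \<bar>y\<bar> \<bar>z\<bar>"
proof -
  have "\<bar>(1 - t) * y + t * z\<bar> \<le> (1 - t) * \<bar>y\<bar> + t * \<bar>z\<bar>"
    using abs_triangle_ineq[of "(1 - t) * y" "t * z"] assms by (simp add: abs_mult)
  also have "\<dots> \<le> max \<bar>y\<bar> \<bar>z\<bar>" by (rule convex_bound_le) (use assms in auto)
  finally show ?thesis .
qed

text \<open>The complement of an interval around \<open>c\<close> is not convex, but each of its two
  sides is.\<close>

lemma convex_interval_sq:
  fixes y z c t q :: real
  assumes t: "0 \<le> t" "t \<le> 1" and side: "c < y \<longleftrightarrow> c < z" and q: "q \<le> (y - c)\<^sup>2" "q \<le> (z - c)\<^sup>2"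
  shows "q \<le> ((1 - t) * y + t * z - c)\<^sup>2"
proof -
  have eq: "(1 - t) * y + t * z - c = (1 - t) * (y - c) + t * (z - c)" by (simp add: algebra_simps)
  have "min \<bar>y - c\<bar> \<bar>z - c\<bar> \<le> \<bar>(1 - t) * (y - c) + t * (z - c)\<bar>"
  proof (cases "c < y")
    case True
    then have "- ((1 - t) * (y - c) + t * (z - c)) \<le> - min \<bar>y - c\<bar> \<bar>z - c\<bar>"
      using convex_bound_le[of "- (y - c)" "- min \<bar>y - c\<bar> \<bar>z - c\<bar>" "- (z - c)" "1 - t" t] side t
      by (auto simp: min_def algebra_simps)
    then show ?thesis by linarith
  next
    case False
    then have "(1 - t) * (y - c) + t * (z - c) \<le> - min \<bar>y - c\<bar> \<bar>z - c\<bar>"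
      using side t by (intro convex_bound_le) (auto simp: min_def)
    then show ?thesis by linarith
  qed
  then have "(min \<bar>y - c\<bar> \<bar>z - c\<bar>)\<^sup>2 \<le> \<bar>(1 - t) * (y - c) + t * (z - c)\<bar>\<^sup>2"
    by (intro power_mono) auto
  moreover have "q \<le> (min \<bar>y - c\<bar> \<bar>z - c\<bar>)\<^sup>2" using q by (simp add: min_def)
  ultimately show ?thesis unfolding eq by simp
qed

lemma shrink_le:
  fixes y z B X :: real
  assumes "(\<bar>y\<bar> + B)\<^sup>2 \<le> X" "(\<bar>z\<bar> + B)\<^sup>2 \<le> X" "B \<ge> 0" "0 \<le> t" "t \<le> 1"
  shows "(\<bar>(1 - t) * y + t * z\<bar> + B)\<^sup>2 \<le> X"
proof -
  have "(\<bar>(1 - t) * y + t * z\<bar> + B)\<^sup>2 \<le> (max \<bar>y\<bar> \<bar>z\<bar> + B)\<^sup>2"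
    using abs_convex_le[OF assms(4,5), of y z] assms(3) by (intro power_mono) auto
  also have "\<dots> \<le> X" using assms(1,2) by (simp add: max_def)
  finally show ?thesis .
qed

context tower
begin

text \<open>The candidate for the component through \<open>x\<close>: the same height and the same
  side of every disc already begun. The inequality \<open>u i < x 0\<close> is strict because over
  \<open>u i\<close> itself a disc shows only its leftmost point, which belongs to \<open>K\<close>
  and separates nothing.\<close>

definition cell :: "(nat \<Rightarrow> real) \<Rightarrow> (nat \<Rightarrow> real) set"
  where "cell x = {y \<in> K. y 0 = x 0 \<and>
    (\<forall>i\<in>{1..d}. u i < x 0 \<longrightarrow> (\<forall>b\<in>{1..<n i}. cc i b < y i \<longleftrightarrow> cc i b < x i))}"

lemma off_upto: "i \<in> {1..d} \<Longrightarrow> s \<le> u i \<Longrightarrow> off i b s y"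
  using off'_before[of i s b y] off_at(1)[of i b y] off'_imp_off by (cases "s < u i") auto

lemma cell_segment:
  assumes x: "x \<in> K" and y: "y \<in> cell x" and t: "0 \<le> t" "t \<le> 1"
  shows "(\<lambda>i. (1 - t) * x i + t * y i) \<in> cell x" (is "?z \<in> _")
proof -
  have yK: "y \<in> K" and y0: "y 0 = x 0" using y unfolding cell_def by auto
  have z0: "?z 0 = x 0" using y0 by (simp add: algebra_simps)
  have "?z \<in> E" using x yK unfolding K_def by auto
  moreover have "tube (?z 0) (?z i)" if i: "i \<in> {1..d}" for i
    unfolding z0 tube_def
    by (rule shrink_le) (use x yK y0 i t R_pos in \<open>auto simp: K_def tube_def\<close>)
  moreover have "lens (?z 0) (?z (Suc d))"
    unfolding z0 lens_def
    by (rule shrink_le) (use x yK y0 t lh_pos in \<open>auto simp: K_def lens_def\<close>)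
  moreover have "off i b (?z 0) (?z i)" if i: "i \<in> {1..d}" and b: "b \<in> {1..<n i}" for i b
  proof (cases "x 0 \<le> u i")
    case True
    then show ?thesis unfolding z0 using off_upto i by simp
  next
    case False
    have "off i b (x 0) (x i)" "off i b (x 0) (y i)" using x yK y0 i b unfolding K_def by auto
    moreover have "cc i b < x i \<longleftrightarrow> cc i b < y i" using y False i b unfolding cell_def by auto
    ultimately show ?thesis unfolding z0 off_def
      using convex_interval_sq[of t "cc i b" "x i" "y i" "R\<^sup>2 - (x 0 - (u i + R))\<^sup>2"] t by simp
  qed
  ultimately have zK: "?z \<in> K" unfolding K_def by blast
  have "cc i b < ?z i \<longleftrightarrow> cc i b < x i" if "i \<in> {1..d}" "u i < x 0" "b \<in> {1..<n i}" for i b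
  proof -
    have side: "cc i b < y i \<longleftrightarrow> cc i b < x i" using y that unfolding cell_def by auto
    show ?thesis
    proof (cases "cc i b < x i")
      case True
      then have "- ?z i < - cc i b"
        using convex_bound_lt[of "- x i" "- cc i b" "- y i" "1 - t" t] side t by simp
      then show ?thesis using True by simp
    next
      case False
      then have "?z i \<le> cc i b" using side t by (intro convex_bound_le) auto
      then show ?thesis using False by simp
    qed
  qed
  then show ?thesis unfolding cell_def using zK z0 by blast
qed

text \<open>A connected part of a level set projects to an interval in coordinate \<open>i\<close>,
  and this interval avoids the centre of every disc already begun, so sides cannot change.
  Conversely, the cell contains the segment from \<open>x\<close> to each of its points.\<close>

lemma reeb_class_eq:
  assumes x: "x \<in> K"
  shows "reeb_class (d + 2) D x = cell x"
proof -
  have "E \<inter> {y \<in> K. y 0 = x 0} = {y \<in> K. y 0 = x 0}" unfolding K_def by blast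
  then have eq: "reeb_class (d + 2) D x = connected_component_set {y \<in> K. y 0 = x 0} x"
    unfolding reeb_class_def closure_of_D
    by (simp only: Euclidean_space_eq subtopology_subtopology connected_component_of_top_of_set)
  show ?thesis unfolding eq
  proof (intro equalityI subsetI)
    fix y assume "y \<in> connected_component_set {y \<in> K. y 0 = x 0} x"
    then obtain T where T: "connected T" "T \<subseteq> {y \<in> K. y 0 = x 0}" "x \<in> T" "y \<in> T"
      unfolding connected_component_def by blast
    have "cc i b < y i \<longleftrightarrow> cc i b < x i" if i: "i \<in> {1..d}" "u i < x 0" "b \<in> {1..<n i}" for i b
    proof -
      have conn: "connected ((\<lambda>z. z i) ` T)"
        by (rule connected_continuous_image[OF _ T(1)])
          (rule continuous_on_subset[OF continuous_on_product_coordinates], simp)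
      have "z i \<noteq> cc i b" if "z \<in> T" for z
      proof (rule off_after)
        show "off i b (x 0) (z i)" using that T(2) i unfolding K_def by auto
      qed (use i K_range[OF x] in auto)
      then have "cc i b \<notin> (\<lambda>z. z i) ` T" by (metis imageE)
      then have no: "\<not> (v \<le> cc i b \<and> cc i b \<le> w)" if "v \<in> (\<lambda>z. z i) ` T" "w \<in> (\<lambda>z. z i) ` T" for v w
        using connected_contains_Icc[OF conn that] by auto
      have "x i \<in> (\<lambda>z. z i) ` T" "y i \<in> (\<lambda>z. z i) ` T" using T by auto
      then show ?thesis using no[of "x i" "y i"] no[of "y i" "x i"] by linarith
    qed
    then show "y \<in> cell x" using T unfolding cell_def by blast
  next
    fix y assume y: "y \<in> cell x"
    have "connected_component {y \<in> K. y 0 = x 0} ((\<lambda>t i. (1 - t) * x i + t * y i) 0)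
        ((\<lambda>t i. (1 - t) * x i + t * y i) 1)"
    proof (rule connected_component_curve)
      fix t :: real assume "0 \<le> t" "t \<le> 1"
      then show "(\<lambda>i. (1 - t) * x i + t * y i) \<in> {y \<in> K. y 0 = x 0}"
        using cell_segment[OF x y] unfolding cell_def by blast
    qed (intro continuous_intros)
    then show "y \<in> connected_component_set {y \<in> K. y 0 = x 0} x" by simp
  qed
qed

section \<open>Labels and closed sectors\<close>

definition label :: "(nat \<Rightarrow> real) \<Rightarrow> nat \<Rightarrow> nat"
  where "label x i = card {b \<in> {1..<n i}. cc i b < x i}"

lemma label_less: "i \<in> {1..d} \<Longrightarrow> label x i < n i"
proof -
  assume i: "i \<in> {1..d}"
  have "label x i \<le> card {1..<n i}" unfolding label_def by (rule card_mono) auto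
  then show ?thesis using n_gt_1[OF i] by simp
qed

text \<open>The centres increase with \<open>b\<close>, so the discs below \<open>x i\<close> form
  an initial segment and their number determines them.\<close>

lemma cc_less_label:
  assumes "b \<in> {1..<n i}"
  shows "cc i b < x i \<longleftrightarrow> b \<le> label x i"
proof
  assume less: "cc i b < x i"
  have "cc i c < x i" if "c \<le> b" for c
    using less cc_less_iff[of i c b] that by (cases "c = b") auto
  then have "{1..b} \<subseteq> {b \<in> {1..<n i}. cc i b < x i}" using assms by auto
  then have "card {1..b} \<le> label x i" unfolding label_def by (rule card_mono[rotated]) auto
  then show "b \<le> label x i" by simp
next
  assume le: "b \<le> label x i"
  show "cc i b < x i"
  proof (rule ccontr)
    assume no: "\<not> cc i b < x i"
    have "c < b" if "cc i c < x i" for c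
    proof -
      have "cc i c < cc i b" using no that by linarith
      then show ?thesis using cc_less_iff by simp
    qed
    then have "{b \<in> {1..<n i}. cc i b < x i} \<subseteq> {1..<b}" by auto
    then have "label x i \<le> card {1..<b}" unfolding label_def by (rule card_mono[rotated]) auto
    then show False using le assms by auto
  qed
qed

lemma label_eqI:
  assumes "a < n i" "\<And>b. b \<in> {1..<n i} \<Longrightarrow> cc i b < x i \<longleftrightarrow> b \<le> a"
  shows "label x i = a"
proof -
  have "{b \<in> {1..<n i}. cc i b < x i} = {1..a}" using assms by auto
  then show ?thesis unfolding label_def by simp
qed

text \<open>Puts the components into the form of \<open>way_eq_iff\<close>, with the label of a
  point in the role of the address.\<close>

lemma cell_iff_label:
  "y \<in> cell x \<longleftrightarrow> y \<in> K \<and> y 0 = x 0 \<and> (\<forall>i\<in>{1..d}. u i < x 0 \<longrightarrow> label y i = label x i)"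
proof -
  have "(\<forall>b\<in>{1..<n i}. cc i b < y i \<longleftrightarrow> cc i b < x i) \<longleftrightarrow> label y i = label x i"
    if "i \<in> {1..d}" for i
  proof
    assume "\<forall>b\<in>{1..<n i}. cc i b < y i \<longleftrightarrow> cc i b < x i"
    then have "{b \<in> {1..<n i}. cc i b < y i} = {b \<in> {1..<n i}. cc i b < x i}" by blast
    then show "label y i = label x i" by (simp add: label_def)
  next
    assume "label y i = label x i"
    then show "\<forall>b\<in>{1..<n i}. cc i b < y i \<longleftrightarrow> cc i b < x i"
      using cc_less_label by metis
  qed
  then show ?thesis unfolding cell_def by blast
qed

definition sample :: "(nat \<Rightarrow> nat) \<Rightarrow> real \<Rightarrow> nat \<Rightarrow> real"
  where "sample a s i = (if i = 0 then s else if i \<le> d then slot i (a i) else 0)"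

lemma sample:
  assumes "\<And>i. i \<in> {1..d} \<Longrightarrow> a i < n i" "s \<in> range_u"
  shows "sample a s \<in> K" "\<And>i. i \<in> {1..d} \<Longrightarrow> label (sample a s) i = a i"
proof -
  have si: "sample a s i = slot i (a i)" if "i \<in> {1..d}" for i using that by (simp add: sample_def)
  have s0: "sample a s 0 = s" by (simp add: sample_def)
  have "sample a s (Suc d) = 0" "sample a s \<in> E" by (auto simp: sample_def)
  then show "sample a s \<in> K"
    unfolding K_def using slot(1,2) assms si s0 lens_0[OF assms(2)] tube'_imp_tube off'_imp_off
    by auto
  show "label (sample a s) i = a i" if i: "i \<in> {1..d}" for i
    by (rule label_eqI) (use slot(3)[OF i assms(1)[OF i] assms(2)] si[OF i] assms(1)[OF i] in auto)
qed

text \<open>Labels jump, so continuity of a map defined through them is not visible directly. The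
  weak inequalities give closed sets on which the address can be held fixed; a point not yet above
  \<open>u i\<close> may lie in several of them, where the corresponding ways still agree.\<close>

definition sector :: "(nat \<Rightarrow> nat) \<Rightarrow> (nat \<Rightarrow> real) set"
  where "sector a = {x \<in> K. \<forall>i\<in>{1..d}. \<forall>b\<in>{1..<n i}.
    (b \<le> a i \<longrightarrow> cc i b \<le> x i) \<and> (a i < b \<longrightarrow> x i \<le> cc i b)}"

lemma closed_sector: "closed (sector a)"
proof -
  have cont: "continuous_on UNIV (\<lambda>x. x i)" for i :: nat
    by (rule continuous_on_product_coordinates)
  have "closed {x. (b \<le> a i \<longrightarrow> cc i b \<le> x i) \<and> (a i < b \<longrightarrow> x i \<le> cc i b)}" for i b
    by (intro closed_Collect_conj closed_Collect_imp closed_Collect_le cont continuous_on_const) auto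
  moreover have "sector a = K \<inter> (\<Inter>i\<in>{1..d}. \<Inter>b\<in>{1..<n i}.
      {x. (b \<le> a i \<longrightarrow> cc i b \<le> x i) \<and> (a i < b \<longrightarrow> x i \<le> cc i b)})"
    unfolding sector_def by auto
  ultimately show ?thesis by (simp only:) (intro closed_Int closed_K closed_INT ballI)
qed

lemma sector_label:
  assumes "x \<in> sector a" "i \<in> {1..d}" "u i < x 0" "a i < n i"
  shows "label x i = a i"
proof (rule label_eqI)
  fix b assume b: "b \<in> {1..<n i}"
  have x: "x \<in> K" using assms(1) unfolding sector_def by blast
  have "x i \<noteq> cc i b"
    by (rule off_after) (use assms x b K_range[OF x] in \<open>auto simp: K_def\<close>)
  moreover have "(b \<le> a i \<longrightarrow> cc i b \<le> x i) \<and> (a i < b \<longrightarrow> x i \<le> cc i b)"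
    using assms(1,2) b unfolding sector_def by blast
  ultimately show "cc i b < x i \<longleftrightarrow> b \<le> a i" by linarith
qed fact

lemma in_sector_label:
  assumes "x \<in> K"
  shows "x \<in> sector (label x)"
proof -
  have "(b \<le> label x i \<longrightarrow> cc i b \<le> x i) \<and> (label x i < b \<longrightarrow> x i \<le> cc i b)"
    if "b \<in> {1..<n i}" for i b
    using cc_less_label[OF that, of x] by linarith
  then show ?thesis unfolding sector_def using assms by blast
qed

end

section \<open>Transversality\<close>

context tower
begin

definition surf :: "nat \<times> nat \<Rightarrow> (nat \<Rightarrow> real) set"
  where "surf q = circ_cylinder (d + 2) R (fst q) (centre0 q) (centre1 q)"

lemma planes_fst: "q \<in> planes \<Longrightarrow> fst q \<in> {1..Suc d}"
  unfolding planes_def by auto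

lemma sign_nonzero: "sign q \<noteq> 0"
  unfolding sign_def by (auto split: prod.split)

lemma wall_eq_0_iff:
  "wall q x = 0 \<longleftrightarrow> (x 0 - centre0 q)\<^sup>2 + (x (fst q) - centre1 q)\<^sup>2 = R\<^sup>2"
  unfolding wall_def circ_def using sign_nonzero[of q] by auto

lemma surf_iff: "x \<in> surf q \<longleftrightarrow> x \<in> E \<and> wall q x = 0"
  unfolding surf_def circ_cylinder_def wall_def topspace_Euclidean_space
  using sign_nonzero[of q] by simp

text \<open>Removed discs of one plane are disjoint and stay where the large discs hold strictly,
  and the two large circles cross only at height differences from \<open>u 0\<close> that exceed the
  range.\<close>

lemma incident_unique:
  assumes p: "p \<in> K" and i: "i \<in> {1..d}" and q: "(i, b) \<in> planes" "(i, b') \<in> planes"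
    and zero: "wall (i, b) p = 0" "wall (i, b') p = 0"
  shows "b = b'"
proof -
  have r: "p 0 \<in> range_u" using K_range[OF p] .
  have disc: "b'' = c" if c: "c \<in> {1..<n i}" and z: "wall (i, c) p = 0"
    and q': "(i, b'') \<in> planes" and z': "wall (i, b'') p = 0" for c b''
  proof -
    have no: "\<not> off' i c (p 0) (p i)" using wall_off(2)[OF i c, of p] z by simp
    have "tube' (p 0) (p i)"
      using near_disc_small[OF i _ r no] c tube'_small[OF r] by simp
    then have pos: "0 < wall (i, 0) p" "0 < wall (i, n i) p" using wall_tube(2)[OF i] by auto
    show ?thesis using q'
    proof (cases rule: planes_cases)
      case disc
      then have "\<not> off' i b'' (p 0) (p i)" using wall_off(2)[OF i, of b'' p] z' by simp
      then show ?thesis using near_disc_unique[OF i r _ no] by simp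
    qed (use pos z' i in auto)
  qed
  have tube: False if "wall (i, 0) p = 0" "wall (i, n i) p = 0"
  proof -
    have "(p i - R / 2)\<^sup>2 = (p i + R / 2)\<^sup>2" using that i by (simp add: wall_simps)
    then have "R * p i = 0" by (simp add: power2_eq_square algebra_simps)
    then have "p i = 0" using R_pos by simp
    then have "tube' (p 0) (p i)" using tube'_small[OF r] R_pos by simp
    then show False using wall_tube(2)[OF i, of p] that by simp
  qed
  show ?thesis using q(1)
  proof (cases rule: planes_cases)
    case low
    show ?thesis using q(2)
      by (cases rule: planes_cases) (use low disc[of b' b] tube zero q i in auto)
  next
    case high
    show ?thesis using q(2)
      by (cases rule: planes_cases) (use high disc[of b' b] tube zero q i in auto)
  next
    case disc
    then show ?thesis using \<open>\<And>c b''. c \<in> {1..<n i} \<Longrightarrow> wall (i, c) p = 0 \<Longrightarrow> (i, b'') \<in> planes \<Longrightarrow>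
      wall (i, b'') p = 0 \<Longrightarrow> b'' = c\<close>[of b b'] zero q by simp
  qed (use i in simp)
qed

lemma incident_last:
  assumes "wall (Suc d, 0) p = 0" "wall (Suc d, 1) p = 0"
  shows "p (Suc d) = 0" "p 0 = u 0 \<or> p 0 = u (Suc d)"
proof -
  have "(p (Suc d) - lh)\<^sup>2 = (p (Suc d) + lh)\<^sup>2" using assms unfolding wall_simps by simp
  then have "lh * p (Suc d) = 0" by (simp add: power2_eq_square algebra_simps)
  then show y: "p (Suc d) = 0" using lh_pos by simp
  have "(p 0 - mid)\<^sup>2 = (L / 2)\<^sup>2" using assms(1) y lh_sq unfolding wall_simps by simp
  then have "p 0 - mid = L / 2 \<or> p 0 - mid = - (L / 2)" by (simp add: power2_eq_iff)
  then show "p 0 = u 0 \<or> p 0 = u (Suc d)" unfolding mid_def L_def by (auto simp: field_simps)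
qed

lemma wall_corner:
  assumes "p \<in> K" "p 0 = u 0 \<or> p 0 = u (Suc d)"
  shows "wall (Suc d, 0) p = 0" "wall (Suc d, 1) p = 0" "p (Suc d) = 0" "p 0 \<noteq> mid"
proof -
  show y: "p (Suc d) = 0" using lens_corner assms unfolding K_def by blast
  have dist: "(p 0 - mid)\<^sup>2 = (L / 2)\<^sup>2" using assms(2) unfolding mid_def L_def
    by (auto simp: power2_eq_square field_simps)
  then show "wall (Suc d, 0) p = 0" "wall (Suc d, 1) p = 0" unfolding wall_simps y using lh_sq by auto
  show "p 0 \<noteq> mid" using dist L_pos by auto
qed

text \<open>The condition \<open>p (fst q) = centre1 q\<close> says that the height is critical on
  the wall, so that \<open>p 0\<close> is at distance \<open>R\<close> from the centre. The range is
  too short for this except at the leftmost point of a removed disc.\<close>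

lemma incident_vertical:
  assumes p: "p \<in> K" and q: "q \<in> planes" "wall q p = 0" "p (fst q) = centre1 q"
  shows "fst q \<in> {1..d}" "p 0 = u (fst q)"
proof -
  obtain i b where ib: "q = (i, b)" by (cases q)
  have r: "p 0 \<in> range_u" using K_range[OF p] .
  have sq: "(p 0 - centre0 q)\<^sup>2 = R\<^sup>2" using q(2,3) unfolding wall_eq_0_iff by simp
  have small: "x\<^sup>2 \<noteq> R\<^sup>2" if "\<bar>x\<bar> \<le> L" for x
  proof
    assume "x\<^sup>2 = R\<^sup>2"
    then have "\<bar>x\<bar> = R" using R_pos by (auto simp: power2_eq_iff abs_if)
    then show False using that L_R L_pos by linarith
  qed
  have u0: "\<bar>p 0 - u 0\<bar> \<le> L" using r unfolding L_def by auto
  have m: "\<bar>p 0 - mid\<bar> \<le> L" using r unfolding L_def mid_def by (auto simp: abs_le_iff field_simps)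
  have "i \<in> {1..d} \<and> p 0 = u i"
    using q(1) unfolding ib
  proof (cases rule: planes_cases)
    case low
    then show ?thesis using sq small[OF u0] by (simp add: ib centre0_def)
  next
    case high
    then show ?thesis using sq small[OF u0] by (simp add: ib centre0_def)
  next
    case disc
    have "(p 0 - (u i + R))\<^sup>2 = R\<^sup>2" using sq disc by (simp add: ib centre0_def)
    then have "p 0 - (u i + R) = R \<or> p 0 - (u i + R) = - R" by (simp add: power2_eq_iff)
    moreover have "p 0 - u i \<le> L" using r u_le[of 0 i] disc unfolding L_def by simp
    ultimately have "p 0 = u i" using L_R L_pos R_pos by linarith
    then show ?thesis using disc by simp
  next
    case last
    then show ?thesis using sq small[OF m] by (simp add: ib centre0_def)
  qed
  then show "fst q \<in> {1..d}" "p 0 = u (fst q)" by (auto simp: ib)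
qed

text \<open>Two walls through one point of \<open>K\<close> share a plane only at a corner of the
  lens.\<close>

lemma incident_inj:
  assumes p: "p \<in> K" and I: "I \<subseteq> planes" "\<And>q. q \<in> I \<Longrightarrow> wall q p = 0"
    and ninj: "\<not> inj_on fst I"
  shows "(Suc d, 0) \<in> I" "(Suc d, 1) \<in> I" "p 0 = u 0 \<or> p 0 = u (Suc d)"
proof -
  obtain i b b' where q: "(i, b) \<in> I" "(i, b') \<in> I" "b \<noteq> b'"
    using ninj unfolding inj_on_def by fastforce
  then have pl: "(i, b) \<in> planes" "(i, b') \<in> planes" using I by auto
  then have "i \<notin> {1..d}" using incident_unique[OF p _ pl] I(2) q by blast
  then have "i = Suc d" "b \<le> 1" "b' \<le> 1" using pl unfolding planes_iff by auto
  then show 1: "(Suc d, 0) \<in> I" "(Suc d, 1) \<in> I" using q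
    by (metis One_nat_def le_Suc_eq le_zero_eq)+
  show "p 0 = u 0 \<or> p 0 = u (Suc d)" using incident_last(2) 1 I(2) by blast
qed

lemma tangent_surf:
  assumes "q \<in> planes" "p \<in> surf q"
  shows "tangent_space (surf q) p = {v. (\<forall>j\<ge>d + 2. v j = 0) \<and>
    (p 0 - centre0 q) * v 0 + (p (fst q) - centre1 q) * v (fst q) = 0}"
  using tangent_space_circ_cylinder[OF R_pos, of "fst q" "d + 2" p] planes_fst[OF assms(1)] assms(2)
  unfolding surf_def by auto

text \<open>Each wall contributes one equation in \<open>v 0\<close> and the coordinate of its
  plane. If the planes are distinct and no \<open>\<beta> q\<close> vanishes, each equation is
  solved for its own coordinate. Otherwise \<open>v 0 = 0\<close> is forced, and all coordinates
  belonging to the walls other than one chosen wall vanish.\<close>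

lemma dim_tangent_Int:
  assumes p: "p \<in> K" and I: "I \<subseteq> planes" "I \<noteq> {}" and zero: "\<And>q. q \<in> I \<Longrightarrow> wall q p = 0"
  shows "int (dim (\<Inter>q\<in>I. tangent_space (surf q) p)) = int (d + 2) - int (card I)"
proof -
  define \<alpha> where "\<alpha> q = p 0 - centre0 q" for q
  define \<beta> where "\<beta> q = p (fst q) - centre1 q" for q
  define W where "W = {v. (\<forall>j\<ge>d + 2. v j = 0) \<and> (\<forall>q\<in>I. \<alpha> q * v 0 + \<beta> q * v (fst q) = 0)}"
  have finI: "finite I" using I(1) finite_planes finite_subset by blast
  have fstI: "fst ` I \<subseteq> {1..Suc d}" using I(1) planes_fst by blast
  have pE: "p \<in> E" using p unfolding K_def by blast
  have "(\<Inter>q\<in>I. tangent_space (surf q) p) = (\<Inter>q\<in>I. {v. (\<forall>j\<ge>d + 2. v j = 0) \<and>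
      \<alpha> q * v 0 + \<beta> q * v (fst q) = 0})"
    using tangent_surf I(1) zero pE unfolding \<alpha>_def \<beta>_def
    by (intro INF_cong refl) (auto simp: surf_iff subset_iff)
  also have "\<dots> = W" unfolding W_def using I(2) by blast
  finally have W: "(\<Inter>q\<in>I. tangent_space (surf q) p) = W" .
  show ?thesis
  proof (cases "inj_on fst I \<and> (\<forall>q\<in>I. \<beta> q \<noteq> 0)")
    case True
    define c where "c i = - \<alpha> (inv_into I fst i) / \<beta> (inv_into I fst i)" for i
    have c: "c (fst q) = - \<alpha> q / \<beta> q" if "q \<in> I" for q
      unfolding c_def using True that by simp
    have "W = {v. (\<forall>i\<ge>d + 2. v i = 0) \<and> (\<forall>i\<in>fst ` I. v i = c i * v 0)}"
    proof -
      have "\<alpha> q * v 0 + \<beta> q * v (fst q) = 0 \<longleftrightarrow> v (fst q) = c (fst q) * v 0" if "q \<in> I" for q v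
      proof -
        have "\<beta> q \<noteq> 0" using True that by blast
        then show ?thesis unfolding c[OF that] by (auto simp: field_simps)
      qed
      then show ?thesis unfolding W_def by blast
    qed
    moreover have "0 \<notin> fst ` I" using fstI by auto
    ultimately have "dim W = (d + 2) - card (fst ` I)"
      using dim_coordinate_equations[of "fst ` I" "d + 2" c] fstI by force
    moreover have "card (fst ` I) = card I" using True card_image by blast
    moreover have "card (fst ` I) \<le> card {1..Suc d}" using fstI by (intro card_mono) auto
    ultimately show ?thesis unfolding W by simp
  next
    case False
    \<comment> \<open>\<open>q0\<close> is the wall to be traded for the equation
      \<open>v 0 = 0\<close>: the one at its leftmost point, or one of the two lens walls at a
      corner.\<close>
    have "\<exists>q0\<in>I. inj_on fst (I - {q0}) \<and> (\<forall>q\<in>I - {q0}. \<beta> q \<noteq> 0) \<and> (\<forall>v\<in>W. v 0 = 0) \<and>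
      (\<beta> q0 = 0 \<or> fst q0 \<in> fst ` (I - {q0}))"
    proof (cases "\<exists>q0\<in>I. \<beta> q0 = 0")
      case True
      then obtain q0 where q0: "q0 \<in> I" "\<beta> q0 = 0" by blast
      have v: "fst q0 \<in> {1..d}" "p 0 = u (fst q0)"
        by (rule incident_vertical[OF p _ zero[OF q0(1)]]; use q0 I(1) in \<open>auto simp: \<beta>_def\<close>)+
      have inj: "inj_on fst I"
      proof (rule ccontr)
        assume "\<not> inj_on fst I"
        then have "p 0 = u 0 \<or> p 0 = u (Suc d)" using incident_inj(3)[OF p I(1) zero] by blast
        then show False using v u_inj[of 0 "fst q0"] u_inj[of "Suc d" "fst q0"] by auto
      qed
      have "\<beta> q \<noteq> 0" if "q \<in> I - {q0}" for q
      proof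
        assume "\<beta> q = 0"
        then have eq: "p (fst q) = centre1 q" by (simp add: \<beta>_def)
        have q: "q \<in> planes" "wall q p = 0" using that I(1) zero by auto
        have "fst q = fst q0"
          by (rule u_inj) (use incident_vertical[OF p q eq] v in auto)
        then show False using inj q0 that unfolding inj_on_def by blast
      qed
      moreover have "v 0 = 0" if "v \<in> W" for v
      proof -
        have "\<alpha> q0 * v 0 = 0" using that q0 unfolding W_def by force
        moreover have "(\<alpha> q0)\<^sup>2 = R\<^sup>2"
          using zero[OF q0(1)] q0(2) unfolding wall_eq_0_iff \<alpha>_def \<beta>_def by simp
        ultimately show ?thesis using R_pos by auto
      qed
      ultimately show ?thesis using q0 inj inj_on_subset[OF inj] by blast
    next
      case no: False
      then have ninj: "\<not> inj_on fst I" using False by blast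
      note last = incident_inj[OF p I(1) zero ninj]
      note corner = wall_corner[OF p last(3)]
      let ?q0 = "(Suc d, 1::nat)"
      have "inj_on fst (I - {?q0})"
      proof (rule ccontr)
        assume "\<not> inj_on fst (I - {?q0})"
        then have "?q0 \<in> I - {?q0}" using incident_inj(2)[OF p, of "I - {?q0}"] I(1) zero by auto
        then show False by blast
      qed
      moreover have "v 0 = 0" if "v \<in> W" for v
      proof -
        have "\<alpha> (Suc d, 0) * v 0 + \<beta> (Suc d, 0) * v (Suc d) = 0"
          "\<alpha> (Suc d, 1) * v 0 + \<beta> (Suc d, 1) * v (Suc d) = 0"
          using that last unfolding W_def by force+
        then have "(p 0 - mid) * v 0 - lh * v (Suc d) = 0" "(p 0 - mid) * v 0 + lh * v (Suc d) = 0"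
          using corner(3) by (auto simp: \<alpha>_def \<beta>_def centre0_def centre1_def)
        then have "(p 0 - mid) * v 0 = 0" by linarith
        then show ?thesis using corner(4) by simp
      qed
      moreover have "fst ?q0 \<in> fst ` (I - {?q0})"
        using last(1) by (intro image_eqI[of _ _ "(Suc d, 0)"]) auto
      ultimately show ?thesis using last(2) no by blast
    qed
    then obtain q0 where q0: "q0 \<in> I" and inj: "inj_on fst (I - {q0})"
      and \<beta>: "\<And>q. q \<in> I - {q0} \<Longrightarrow> \<beta> q \<noteq> 0" and v0: "\<And>v. v \<in> W \<Longrightarrow> v 0 = 0"
      and q0': "\<beta> q0 = 0 \<or> fst q0 \<in> fst ` (I - {q0})" by blast
    \<comment> \<open>Once \<open>v 0\<close> and the coordinates of the remaining walls vanish, the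
      equation of \<open>q0\<close> holds by itself, so \<open>J\<close> has as many elements as
      \<open>I\<close>.\<close>
    define J where "J = insert 0 (fst ` (I - {q0}))"
    have "W = {v. (\<forall>i\<ge>d + 2. v i = 0) \<and> (\<forall>i\<in>J. v i = 0 * v 0)}"
    proof (intro equalityI subsetI)
      fix v assume v: "v \<in> W"
      have "v (fst q) = 0" if "q \<in> I - {q0}" for q
      proof -
        have "\<alpha> q * v 0 + \<beta> q * v (fst q) = 0" using v that unfolding W_def by blast
        then show ?thesis using v0[OF v] \<beta>[OF that] by simp
      qed
      then show "v \<in> {v. (\<forall>i\<ge>d + 2. v i = 0) \<and> (\<forall>i\<in>J. v i = 0 * v 0)}"
        using v v0[OF v] unfolding W_def J_def by auto
    next
      fix v :: "nat \<Rightarrow> real" assume v: "v \<in> {v. (\<forall>i\<ge>d + 2. v i = 0) \<and> (\<forall>i\<in>J. v i = 0 * v 0)}"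
      have "\<alpha> q * v 0 + \<beta> q * v (fst q) = 0" if "q \<in> I" for q
      proof -
        have "v 0 = 0" using v unfolding J_def by simp
        moreover have "\<beta> q = 0 \<or> fst q \<in> J" using q0' that unfolding J_def by (cases "q = q0") auto
        then have "\<beta> q * v (fst q) = 0" using v by auto
        ultimately show ?thesis by simp
      qed
      then show "v \<in> W" using v unfolding W_def by blast
    qed
    moreover have J: "J \<subseteq> {..<d + 2}" unfolding J_def using fstI by fastforce
    ultimately have "dim W = (d + 2) - card J"
      using dim_coordinate_equations[of J "d + 2" "\<lambda>_. 0"] by simp
    moreover have "card J = card I"
    proof -
      have "0 \<notin> fst ` (I - {q0})" using fstI by auto
      then have "card J = Suc (card (I - {q0}))"
        unfolding J_def using finI card_image[OF inj] by simp
      then show ?thesis using finI q0 by (metis card_Suc_Diff1)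
    qed
    moreover have "card J \<le> d + 2" using J card_mono[of "{..<d + 2}" J] by simp
    ultimately show ?thesis unfolding W by simp
  qed
qed

end

section \<open>The RA-region and its singular points\<close>

lemma (in tower) card_planes: "card planes = (\<Sum>i = 1..d. (n i + 1)) + 2"
proof -
  have "card planes = (\<Sum>i = 1..Suc d. card {0..if i = Suc d then 1 else n i})"
    unfolding planes_def by (rule card_SigmaI) auto
  also have "\<dots> = (\<Sum>i = 1..d. card {0..if i = Suc d then 1 else n i}) + 2" by simp
  also have "(\<Sum>i = 1..d. card {0..if i = Suc d then 1 else n i}) = (\<Sum>i = 1..d. (n i + 1))"
    by (rule sum.cong) auto
  finally show ?thesis .
qed

locale enumerated_tower = tower +
  fixes l :: nat and e :: "nat \<Rightarrow> nat \<times> nat"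
  assumes e: "bij_betw e {1..l} planes"
begin

definition S :: "nat \<Rightarrow> (nat \<Rightarrow> real) set"
  where "S j = surf (e j)"

lemma e_in: "j \<in> {1..l} \<Longrightarrow> e j \<in> planes"
  using e bij_betwE by blast

lemma ball_e: "(\<forall>j\<in>{1..l}. P (e j)) \<longleftrightarrow> (\<forall>q\<in>planes. P q)"
  using bij_betw_imp_surj_on[OF e] by (metis imageE image_eqI)

lemma inj_e: "inj_on e {1..l}"
  using e bij_betw_imp_inj_on by blast

lemma surf_meets_K:
  assumes "q \<in> planes"
  shows "surf q \<inter> K \<noteq> {}"
proof -
  obtain i b where ib: "q = (i, b)" by (cases q)
  have a0: "\<And>i. i \<in> {1..d} \<Longrightarrow> (\<lambda>_. 0) i < n i" using n_gt_1 by fastforce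
  have u0: "u 0 \<in> range_u" using u_in_range by simp
  have upd: "(sample (\<lambda>_. 0) s)(i := y) \<in> K"
    if i: "i \<in> {1..d}" and s: "s \<in> range_u" and t: "tube s y" and o: "\<And>b. off i b s y" for i s y
  proof -
    have k: "sample (\<lambda>_. 0) s \<in> K" using sample(1)[OF a0 s] .
    have s0: "sample (\<lambda>_. 0) s 0 = s" by (simp add: sample_def)
    show ?thesis using k s0 t o i unfolding K_def by auto
  qed
  have tube0: "tube (u 0) (R / 2)" "tube (u 0) (- (R / 2))"
    unfolding tube_def using R_pos by (auto simp: power2_eq_square)
  have "\<exists>x\<in>K. wall (i, b) x = 0"
    using assms unfolding ib
  proof (cases rule: planes_cases)
    case low
    \<comment> \<open>The circle centred at \<open>R / 2\<close> bounds the tube from below, hence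
      the negative sign. Over \<open>u 0\<close> the tube reaches \<open>R / 2\<close> on both
      sides.\<close>
    let ?x = "(sample (\<lambda>_. 0) (u 0))(i := - (R / 2))"
    have "?x \<in> K" using upd[OF low(1) u0 tube0(2)] off_upto[OF low(1)] u_le[of 0 i] low by simp
    moreover have "wall (i, b) ?x = 0" using low by (simp add: wall_simps sample_def)
    ultimately show ?thesis by blast
  next
    case high
    let ?x = "(sample (\<lambda>_. 0) (u 0))(i := R / 2)"
    have "?x \<in> K" using upd[OF high(1) u0 tube0(1)] off_upto[OF high(1)] u_le[of 0 i] high by simp
    moreover have "wall (i, b) ?x = 0" using high by (simp add: wall_simps sample_def)
    ultimately show ?thesis by blast
  next
    case disc
    let ?x = "(sample (\<lambda>_. 0) (u i))(i := cc i b)"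
    have r: "u i \<in> range_u" using u_in_range disc by simp
    have "tube (u i) (cc i b)"
      using tube'_small[OF r] cc_bound[of i b] disc R_pos by (auto intro: tube'_imp_tube)
    then have "?x \<in> K" using upd[OF disc(1) r] off_at(1)[OF disc(1)] by simp
    moreover have "wall (i, b) ?x = 0" using disc by (simp add: wall_simps sample_def)
    ultimately show ?thesis by blast
  next
    case last
    have k: "sample (\<lambda>_. 0) (u 0) \<in> K" using sample(1)[OF a0 u0] .
    have "sample (\<lambda>_. 0) (u 0) 0 = u 0" by (simp add: sample_def)
    then have "wall (i, b) (sample (\<lambda>_. 0) (u 0)) = 0" using wall_corner(1,2)[OF k] last by auto
    then show ?thesis using k by blast
  qed
  then show ?thesis unfolding ib surf_iff[abs_def] using surf_iff K_def by blast
qed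

lemma ra_region: "ra_region (d + 2) l D S"
  unfolding ra_region_def closure_of_D
proof (intro conjI)
  show "D \<noteq> {}" using base(1) by blast
  show "openin (Euclidean_space (d + 2)) D" by (rule open_D)
  show "connectedin (Euclidean_space (d + 2)) D"
    unfolding Euclidean_space_eq connectedin_subtopology using connected_D
    by (auto simp: D_def)
  show "\<exists>f. (\<forall>j\<in>{1..l}. nonsingular_hypersurface (d + 2) (f j) (S j) \<and> S j \<inter> K \<noteq> {}) \<and>
    (\<exists>U. openin (Euclidean_space (d + 2)) U \<and> K \<subseteq> U \<and> D = U \<inter> {x. \<forall>j\<in>{1..l}. 0 < f j x} \<and>
      (\<forall>j\<in>{1..l}. U \<inter> S j = U \<inter> {x. f j x = 0}))"
  \<comment> \<open>The inequalities cut out \<open>D\<close> globally, so the whole space serves as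
    the neighbourhood.\<close>
  proof (rule exI[of _ "\<lambda>j. wall (e j)"], intro conjI ballI exI[of _ "topspace (Euclidean_space (d + 2))"])
    fix j assume j: "j \<in> {1..l}"
    have "nonsingular_hypersurface (d + 2) (\<lambda>x. sign (e j) * circ R (fst (e j)) (centre0 (e j)) (centre1 (e j)) x)
        (circ_cylinder (d + 2) R (fst (e j)) (centre0 (e j)) (centre1 (e j)))"
      by (rule nonsingular_circ_cylinder[OF R_pos _ _ sign_nonzero])
        (use planes_fst[OF e_in[OF j]] in auto)
    then show "nonsingular_hypersurface (d + 2) (wall (e j)) (S j)"
      unfolding S_def surf_def wall_def[abs_def] .
    show "S j \<inter> K \<noteq> {}" unfolding S_def by (rule surf_meets_K[OF e_in[OF j]])
    show "topspace (Euclidean_space (d + 2)) \<inter> S j =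
        topspace (Euclidean_space (d + 2)) \<inter> {x. wall (e j) x = 0}"
      unfolding topspace_Euclidean_space S_def by (auto simp: surf_iff)
  next
    show "openin (Euclidean_space (d + 2)) (topspace (Euclidean_space (d + 2)))" by simp
    show "K \<subseteq> topspace (Euclidean_space (d + 2))"
      unfolding topspace_Euclidean_space K_def by blast
    show "D = topspace (Euclidean_space (d + 2)) \<inter> {x. \<forall>j\<in>{1..l}. 0 < wall (e j) x}"
      unfolding topspace_Euclidean_space D_wall ball_e[of "\<lambda>q. 0 < wall q _"] by blast
  qed
  show "\<forall>I p. I \<subseteq> {1..l} \<and> I \<noteq> {} \<and> p \<in> K \<inter> (\<Inter>j\<in>I. S j) \<longrightarrow>
    int (dim (\<Inter>j\<in>I. tangent_space (S j) p)) = int (d + 2) - int (card I)"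
  proof (intro allI impI)
    fix I p assume *: "I \<subseteq> {1..l} \<and> I \<noteq> {} \<and> p \<in> K \<inter> (\<Inter>j\<in>I. S j)"
    have "int (dim (\<Inter>q\<in>e ` I. tangent_space (surf q) p)) = int (d + 2) - int (card (e ` I))"
    proof (rule dim_tangent_Int)
      show "wall q p = 0" if "q \<in> e ` I" for q using that * unfolding S_def by (auto simp: surf_iff)
    qed (use * e_in in auto)
    moreover have "card (e ` I) = card I" using * inj_on_subset[OF inj_e] card_image by blast
    ultimately show "int (dim (\<Inter>j\<in>I. tangent_space (S j) p)) = int (d + 2) - int (card I)"
      unfolding S_def by (simp add: image_image)
  qed
qed

lemma incident_iff: "x \<in> K \<Longrightarrow> j \<in> incident l S x \<longleftrightarrow> j \<in> {1..l} \<and> wall (e j) x = 0"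
  unfolding incident_def S_def surf_iff K_def by auto

lemma tangent_stratum:
  assumes "v \<in> tangent_space (stratum (d + 2) l D S I) p" "j \<in> I"
  shows "(p 0 - centre0 (e j)) * v 0 + (p (fst (e j)) - centre1 (e j)) * v (fst (e j)) = 0"
proof (rule tangent_space_circ_zero[OF assms(1)])
  show "stratum (d + 2) l D S I \<subseteq> {x. circ R (fst (e j)) (centre0 (e j)) (centre1 (e j)) x = 0}"
  proof
    fix x assume "x \<in> stratum (d + 2) l D S I"
    then have "x \<in> surf (e j)" using assms(2) unfolding stratum_def incident_def S_def by auto
    then show "x \<in> {x. circ R (fst (e j)) (centre0 (e j)) (centre1 (e j)) x = 0}"
      unfolding surf_def circ_cylinder_def by simp
  qed
qed

text \<open>Covers both kinds of singular points: with fewer than \<open>d + 2\<close> incident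
  walls the assumption is criticality, and otherwise the point is singular by count.\<close>

lemma singular_pointI:
  assumes p: "p \<in> K"
    and v: "\<And>v. v \<in> tangent_space (stratum (d + 2) l D S (incident l S p)) p \<Longrightarrow> v 0 = 0"
  shows "singular_point (d + 2) l D S p"
proof -
  have "p \<in> stratum (d + 2) l D S (incident l S p)" unfolding stratum_def closure_of_D using p by simp
  then have "critical_point (stratum (d + 2) l D S (incident l S p)) p"
    unfolding critical_point_def using v by blast
  then show ?thesis unfolding singular_point_def closure_of_D using p by auto
qed

text \<open>Over an end of the range \<open>p\<close> itself lies on both lens walls, whose
  equations force \<open>v 0 = 0\<close>. Over an inner level \<open>u j\<close> the point is moved
  to the leftmost point of the disc 1, which exists because \<open>n j > 1\<close>; changing
  coordinate \<open>j\<close> does not leave the component, since discs of plane \<open>j\<close>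
  separate only strictly above \<open>u j\<close>.\<close>

lemma singular_at_level:
  assumes p: "p \<in> K" and j: "p 0 = u j" "j \<le> Suc d"
  obtains p' where "p' \<in> cell p" "singular_point (d + 2) l D S p'"
proof (cases "j = 0 \<or> j = Suc d")
  case True
  then have c: "p 0 = u 0 \<or> p 0 = u (Suc d)" using j by auto
  note corner = wall_corner[OF p c]
  have "(Suc d, 0) \<in> planes" "(Suc d, 1) \<in> planes" by (auto simp: planes_iff)
  then have "\<exists>j0\<in>{1..l}. e j0 = (Suc d, 0)" "\<exists>j1\<in>{1..l}. e j1 = (Suc d, 1)"
    using bij_betw_imp_surj_on[OF e] by (metis imageE)+
  then obtain j0 j1 where jj: "j0 \<in> {1..l}" "e j0 = (Suc d, 0)" "j1 \<in> {1..l}" "e j1 = (Suc d, 1)"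
    by blast
  then have inc: "j0 \<in> incident l S p" "j1 \<in> incident l S p" using incident_iff[OF p] corner by auto
  have "singular_point (d + 2) l D S p"
  proof (rule singular_pointI[OF p])
    fix v assume v: "v \<in> tangent_space (stratum (d + 2) l D S (incident l S p)) p"
    have "(p 0 - mid) * v 0 - lh * v (Suc d) = 0" "(p 0 - mid) * v 0 + lh * v (Suc d) = 0"
      using tangent_stratum[OF v inc(1)] tangent_stratum[OF v inc(2)] jj corner(3)
      by (auto simp: centre0_def centre1_def)
    then have "(p 0 - mid) * v 0 = 0" by linarith
    then show "v 0 = 0" using corner(4) by simp
  qed
  moreover have "p \<in> cell p" using p unfolding cell_def by blast
  ultimately show thesis using that by blast
next
  case False
  then have i: "j \<in> {1..d}" using j(2) by auto
  have b: "1 \<in> {1..<n j}" using n_gt_1[OF i] by simp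
  have r: "u j \<in> range_u" using u_in_range[OF j(2)] .
  define p' where "p' = p(j := cc j 1)"
  have p'0: "p' 0 = u j" "p' j = cc j 1" using i j unfolding p'_def by auto
  have "tube (u j) (cc j 1)"
    using tube'_small[OF r] cc_bound[OF i, of 1] n_gt_1[OF i] R_pos by (auto intro: tube'_imp_tube)
  then have p'K: "p' \<in> K" using p i j off_at(1)[OF i] unfolding K_def p'_def by auto
  have "p' \<in> cell p"
    unfolding cell_def using p'K p'0 j by (auto simp: p'_def)
  moreover have "singular_point (d + 2) l D S p'"
  proof (rule singular_pointI[OF p'K])
    fix v assume v: "v \<in> tangent_space (stratum (d + 2) l D S (incident l S p')) p'"
    have q: "(j, 1) \<in> planes" using i n_gt_1[OF i] by (simp add: planes_iff)
    then obtain j1 where j1: "j1 \<in> {1..l}" "e j1 = (j, 1)"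
      using bij_betw_imp_surj_on[OF e] by (metis imageE)
    have "wall (j, 1) p' = 0" using wall_simps(3)[OF i b, of p'] p'0 by simp
    then have inc: "j1 \<in> incident l S p'" using incident_iff[OF p'K] j1 by simp
    have "(p' 0 - (u j + R)) * v 0 = 0"
      using tangent_stratum[OF v inc] j1(2) i b p'0 by (auto simp: centre0_def centre1_def)
    then show "v 0 = 0" using p'0 R_pos by simp
  qed
  ultimately show thesis using that by blast
qed

text \<open>Away from the levels the walls through \<open>p\<close> lie in distinct planes, hence
  are fewer than \<open>d + 2\<close>, and each can be solved for its own coordinate as a function
  of the height. This yields a curve in the stratum along which the height has speed one.\<close>

lemma regular_off_levels:
  assumes p: "p \<in> K" and off: "\<And>j. j \<le> Suc d \<Longrightarrow> p 0 \<noteq> u j"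
  shows "\<not> singular_point (d + 2) l D S p"
proof -
  define I where "I = {q \<in> planes. wall q p = 0}"
  have fin: "finite I" unfolding I_def using finite_planes by simp
  have I: "I \<subseteq> planes" "\<And>q. q \<in> I \<Longrightarrow> wall q p = 0" unfolding I_def by blast+
  have inj: "inj_on fst I"
  proof (rule ccontr)
    assume ninj: "\<not> inj_on fst I"
    have "p 0 = u 0 \<or> p 0 = u (Suc d)" by (rule incident_inj(3)[OF p I ninj])
    then show False using off[of 0] off[of "Suc d"] by simp
  qed
  have \<beta>: "p (fst q) \<noteq> centre1 q" if q: "q \<in> I" for q
  proof
    assume *: "p (fst q) = centre1 q"
    have "q \<in> planes" using q I(1) by blast
    then have "fst q \<in> {1..d}" "p 0 = u (fst q)" using incident_vertical[OF p _ I(2)[OF q] *] by auto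
    then show False using off[of "fst q"] by simp
  qed
  have eI: "e ` incident l S p = I"
  proof -
    have "incident l S p = {j \<in> {1..l}. wall (e j) p = 0}" using incident_iff[OF p] by blast
    then show ?thesis unfolding I_def bij_betw_imp_surj_on[OF e, symmetric] by blast
  qed
  have "incident l S p \<subseteq> {1..l}" unfolding incident_def by blast
  then have "card (incident l S p) = card I"
    using card_image[OF inj_on_subset[OF inj_e]] eI by metis
  also have "\<dots> = card (fst ` I)" using card_image[OF inj] by simp
  also have "\<dots> \<le> card {1..Suc d}" using planes_fst unfolding I_def by (intro card_mono) auto
  finally have card: "card (incident l S p) < d + 2" by simp
  define c where "c = inv_into I fst"
  have c: "c (fst q) = q" if "q \<in> I" for q unfolding c_def using inj that by simp
  \<comment> \<open>In each plane with a wall through \<open>p\<close> the coordinate follows that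
    circle, where \<open>sgn\<close> selects the half containing \<open>p\<close>; the other
    coordinates of index above 0 stay fixed.\<close>
  define g where "g s i = (if i = 0 then p 0 + s else if i \<in> fst ` I
    then centre1 (c i) + sgn (p i - centre1 (c i)) * sqrt (R\<^sup>2 - (p 0 + s - centre0 (c i))\<^sup>2)
    else p i)" for s i
  define g' where "g' s i = (if i = 0 then 1 else if i \<in> fst ` I
    then sgn (p i - centre1 (c i)) *
      (- (p 0 + s - centre0 (c i)) / sqrt (R\<^sup>2 - (p 0 + s - centre0 (c i))\<^sup>2))
    else 0)" for s i
  have g_cont: "continuous_on A (\<lambda>s. g s i)" for A i
    unfolding g_def by (cases "i = 0"; cases "i \<in> fst ` I") (auto intro!: continuous_intros)
  have no0: "0 \<notin> fst ` I" using planes_fst unfolding I_def by force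
  have gI: "g s (fst q) = centre1 q + sgn (p (fst q) - centre1 q) * sqrt (R\<^sup>2 - (p 0 + s - centre0 q)\<^sup>2)"
    if "q \<in> I" for s q
    using that no0 c[OF that] unfolding g_def by force
  have eq: "R\<^sup>2 - (p 0 - centre0 q)\<^sup>2 = (p (fst q) - centre1 q)\<^sup>2" if "q \<in> I" for q
    using that wall_eq_0_iff[of q p] unfolding I_def by simp
  have g0: "g 0 = p"
  proof
    fix i
    show "g 0 i = p i"
    proof (cases "i \<in> fst ` I")
      case True
      then obtain q where q: "q \<in> I" "i = fst q" by blast
      show ?thesis using gI[OF q(1), of 0] eq[OF q(1)] q(2)
        by (simp add: sgn_mult_abs)
    qed (auto simp: g_def)
  qed
  have wall_cont: "continuous_on UNIV (\<lambda>s. wall q (g s))" for q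
    unfolding wall_def circ_def by (intro continuous_intros g_cont)
  have ev: "\<forall>\<^sub>F s in nhds 0. 0 < h s" if "continuous_on UNIV h" "0 < h 0" for h :: "real \<Rightarrow> real"
    unfolding eventually_nhds
    using open_Collect_less[OF continuous_on_const that(1), of 0] that(2) by blast
  have ev1: "\<forall>\<^sub>F s in nhds 0. 0 < wall q (g s)" if "q \<in> planes - I" for q
  proof (rule ev[OF wall_cont])
    have "0 \<le> wall q p" using p that unfolding K_wall by blast
    moreover have "wall q p \<noteq> 0" using that unfolding I_def by blast
    ultimately show "0 < wall q (g 0)" using g0 by simp
  qed
  have ev2: "\<forall>\<^sub>F s in nhds 0. 0 < R\<^sup>2 - (p 0 + s - centre0 q)\<^sup>2" if "q \<in> I" for q
  proof (rule ev)
    have "0 < (p (fst q) - centre1 q)\<^sup>2" using \<beta>[OF that] by simp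
    then show "0 < R\<^sup>2 - (p 0 + 0 - centre0 q)\<^sup>2" using eq[OF that] by simp
  qed (intro continuous_intros)
  \<comment> \<open>One neighbourhood on which the other walls stay positive and the radicands stay
    nonzero: the curve then neither leaves the closure nor meets a further wall, and it is
    differentiable.\<close>
  have "\<forall>\<^sub>F s in nhds 0. (\<forall>q\<in>planes - I. 0 < wall q (g s)) \<and>
      (\<forall>q\<in>I. 0 < R\<^sup>2 - (p 0 + s - centre0 q)\<^sup>2)"
    using ev1 ev2 fin finite_planes by (auto intro!: eventually_conj eventually_ball_finite)
  then obtain \<epsilon> where \<epsilon>: "\<epsilon> > 0" and near: "\<And>s. dist s 0 < \<epsilon> \<Longrightarrow> (\<forall>q\<in>planes - I. 0 < wall q (g s)) \<and>
      (\<forall>q\<in>I. 0 < R\<^sup>2 - (p 0 + s - centre0 q)\<^sup>2)"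
    unfolding eventually_nhds_metric by blast
  have zero: "wall q (g s) = 0" if q: "q \<in> I" and s: "dist s 0 < \<epsilon>" for q s
  proof -
    have pos: "0 < R\<^sup>2 - (p 0 + s - centre0 q)\<^sup>2" using near[OF s] q by blast
    have "(g s (fst q) - centre1 q)\<^sup>2 = (sgn (p (fst q) - centre1 q))\<^sup>2 * (R\<^sup>2 - (p 0 + s - centre0 q)\<^sup>2)"
      unfolding gI[OF q] using pos by (simp add: power_mult_distrib)
    also have "(sgn (p (fst q) - centre1 q))\<^sup>2 = 1" using \<beta>[OF q] by (simp add: sgn_if)
    finally show ?thesis unfolding wall_eq_0_iff by (simp add: g_def)
  qed
  have "g s \<in> stratum (d + 2) l D S (incident l S p)" if "s \<in> {-\<epsilon><..<\<epsilon>}" for s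
  proof -
    have s: "dist s 0 < \<epsilon>" using that by (auto simp: dist_real_def)
    have w: "0 \<le> wall q (g s) \<and> (wall q (g s) = 0 \<longleftrightarrow> q \<in> I)" if "q \<in> planes" for q
    proof (cases "q \<in> I")
      case True
      then show ?thesis using zero[OF True s] by simp
    next
      case False
      then have "0 < wall q (g s)" using near[OF s] that by blast
      then show ?thesis using False by simp
    qed
    have "g s i = 0" if "i \<ge> d + 2" for i
    proof -
      have "i \<notin> fst ` I" using that planes_fst unfolding I_def by force
      moreover have "p i = 0" using p that unfolding K_def by blast
      ultimately show ?thesis using that by (simp add: g_def)
    qed
    then have gK: "g s \<in> K" unfolding K_wall using w by blast
    have "incident l S (g s) = incident l S p"
      using incident_iff[OF gK] incident_iff[OF p] w e_in unfolding I_def by blast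
    then show ?thesis unfolding stratum_def closure_of_D using gK by blast
  qed
  moreover have "((\<lambda>s. g s i) has_real_derivative g' s i) (at s)" if "s \<in> {-\<epsilon><..<\<epsilon>}" for s i
  proof -
    have s: "dist s 0 < \<epsilon>" using that by (auto simp: dist_real_def)
    consider "i = 0" | q where "i \<noteq> 0" "q \<in> I" "i = fst q" | "i \<noteq> 0" "i \<notin> fst ` I" by blast
    then show ?thesis
    proof cases
      case 2
      have pos: "0 < R\<^sup>2 - (p 0 + s - centre0 q)\<^sup>2" using near[OF s] 2 by blast
      have "((\<lambda>s. centre1 q + sgn (p (fst q) - centre1 q) * sqrt (R\<^sup>2 - (p 0 + s - centre0 q)\<^sup>2))
        has_real_derivative sgn (p (fst q) - centre1 q) *
          (- (p 0 + s - centre0 q) / sqrt (R\<^sup>2 - (p 0 + s - centre0 q)\<^sup>2))) (at s)"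
        using pos by (auto intro!: derivative_eq_intros simp: field_simps)
      then show ?thesis using 2 c[OF 2(2)] unfolding g_def g'_def by force
    qed (auto simp: g_def g'_def intro!: derivative_eq_intros)
  qed
  moreover have "continuous_on {-\<epsilon><..<\<epsilon>} (\<lambda>s. g' s i)" for i
  proof -
    consider "i = 0" | q where "i \<noteq> 0" "q \<in> I" "i = fst q" | "i \<noteq> 0" "i \<notin> fst ` I" by blast
    then show ?thesis
    proof cases
      case 2
      have "0 < R\<^sup>2 - (p 0 + s - centre0 q)\<^sup>2" if "s \<in> {-\<epsilon><..<\<epsilon>}" for s
        using near[of s] 2 that by (auto simp: dist_real_def)
      then have "continuous_on {-\<epsilon><..<\<epsilon>} (\<lambda>s. sgn (p (fst q) - centre1 q) *
          (- (p 0 + s - centre0 q) / sqrt (R\<^sup>2 - (p 0 + s - centre0 q)\<^sup>2)))"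
        by (intro continuous_intros) force
      then show ?thesis using 2 c[OF 2(2)] unfolding g'_def by force
    qed (auto simp: g'_def)
  qed
  ultimately have "g' 0 \<in> tangent_space (stratum (d + 2) l D S (incident l S p)) p"
    unfolding tangent_space_def mem_Collect_eq using \<epsilon> g0
    by (intro exI[of _ g] exI[of _ g'] exI[of _ \<epsilon>]) blast
  moreover have "g' 0 0 \<noteq> 0" by (simp add: g'_def)
  ultimately have "\<not> critical_point (stratum (d + 2) l D S (incident l S p)) p"
    unfolding critical_point_def by blast
  then show ?thesis unfolding singular_point_def using card by auto
qed

end

section \<open>The Poincare-Reeb digraph\<close>

text \<open>Both spaces are the quotient of \<open>X\<close> by one equivalence relation, so each
  map descends along the other and the two induced maps are inverse.\<close>

lemma quotient_maps_same_fibres: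
  assumes f: "quotient_map X Y f" and g: "quotient_map X Z g"
    and fg: "\<And>x y. x \<in> topspace X \<Longrightarrow> y \<in> topspace X \<Longrightarrow> f x = f y \<longleftrightarrow> g x = g y"
  obtains h k where "homeomorphic_maps Y Z h k" "\<And>x. x \<in> topspace X \<Longrightarrow> h (f x) = g x"
    "\<And>x. x \<in> topspace X \<Longrightarrow> k (g x) = f x"
proof -
  define h where "h y = g (SOME x. x \<in> topspace X \<and> f x = y)" for y
  define k where "k z = f (SOME x. x \<in> topspace X \<and> g x = z)" for z
  have hf: "h (f x) = g x" if x: "x \<in> topspace X" for x
  proof -
    let ?y = "SOME y. y \<in> topspace X \<and> f y = f x"
    have "?y \<in> topspace X \<and> f ?y = f x" by (rule someI[of _ x]) (use x in simp)
    then show ?thesis unfolding h_def using fg x by blast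
  qed
  have kg: "k (g x) = f x" if x: "x \<in> topspace X" for x
  proof -
    let ?y = "SOME y. y \<in> topspace X \<and> g y = g x"
    have "?y \<in> topspace X \<and> g ?y = g x" by (rule someI[of _ x]) (use x in simp)
    then show ?thesis unfolding k_def using fg x by blast
  qed
  have "continuous_map X Z (h \<circ> f)"
    by (rule continuous_map_eq[OF quotient_imp_continuous_map[OF g]]) (simp add: hf)
  then have "continuous_map Y Z h" by (rule continuous_compose_quotient_map[OF f])
  moreover have "continuous_map X Y (k \<circ> g)"
    by (rule continuous_map_eq[OF quotient_imp_continuous_map[OF f]]) (simp add: kg)
  then have "continuous_map Z Y k" by (rule continuous_compose_quotient_map[OF g])
  moreover have "k (h y) = y" if y: "y \<in> topspace Y" for y
  proof -
    obtain x where "x \<in> topspace X" "y = f x"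
      using y quotient_imp_surjective_map[OF f] by blast
    then show ?thesis using hf kg by simp
  qed
  moreover have "h (k z) = z" if z: "z \<in> topspace Z" for z
  proof -
    obtain x where "x \<in> topspace X" "z = g x"
      using z quotient_imp_surjective_map[OF g] by blast
    then show ?thesis using hf kg by simp
  qed
  ultimately have "homeomorphic_maps Y Z h k" unfolding homeomorphic_maps_def by blast
  then show thesis using that hf kg by blast
qed

text \<open>Edges are connected components of a complement, so a homeomorphism that matches the
  vertex sets matches them too.\<close>

lemma homeomorphic_map_edges:
  assumes h: "homeomorphic_map X Y h" and V: "V \<subseteq> topspace X"
  shows "edges Y (h ` V) = (image h) ` edges X V"
  unfolding edges_def
proof (rule homeomorphic_map_connected_components_of, rule homeomorphic_map_subtopologies[OF h])
  have inj: "inj_on h (topspace X)" and surj: "h ` topspace X = topspace Y"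
    using h homeomorphic_imp_injective_map homeomorphic_imp_surjective_map by blast+
  have "h ` (topspace X - V) = h ` topspace X - h ` V"
    using inj_on_image_set_diff[OF inj, of "topspace X" V] V by blast
  then show "h ` (topspace X \<inter> (topspace X - V)) = topspace Y \<inter> (topspace Y - h ` V)"
    unfolding surj[symmetric] by auto
qed

lemma homeomorphic_map_endpoints:
  assumes h: "homeomorphic_map X Y h" and e: "e \<subseteq> topspace X"
  shows "endpoints Y (h ` e) = h ` endpoints X e"
proof -
  have inj: "inj_on h (topspace X)" using h homeomorphic_imp_injective_map by blast
  show ?thesis unfolding endpoints_def homeomorphic_map_closure_of[OF h e]
    using inj_on_image_set_diff[OF inj, of "X closure_of e" e] e closure_of_subset_topspace[of X e]
    by blast
qed

section \<open>Identification of the Reeb space with the tree\<close>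

locale realization =
  tree: levelled_tree T G r n d z e0 u + tower: enumerated_tower d n u R l e
  for T G :: "'a tdigraph" and r :: 'a and n :: "nat \<Rightarrow> nat" and d :: nat and z :: 'a
    and e0 :: "'a set" and u :: "nat \<Rightarrow> real" and R :: real and l :: nat
    and e :: "nat \<Rightarrow> nat \<times> nat"
begin

text \<open>The quotient map in terms of the tree: the labels of a point are read as an address, and
  its first coordinate as the height reached on that way.\<close>

definition F :: "(nat \<Rightarrow> real) \<Rightarrow> 'a"
  where "F x = tree.way (tower.label x) (x 0)"

abbreviation q :: "(nat \<Rightarrow> real) \<Rightarrow> (nat \<Rightarrow> real) set"
  where "q \<equiv> reeb_class (d + 2) tower.D"

lemma address_label: "tree.address (tower.label x)"
  unfolding tree.address_def using tower.label_less by blast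

lemma F_eq_iff:
  assumes "x \<in> tower.K" "y \<in> tower.K"
  shows "q x = q y \<longleftrightarrow> F x = F y"
proof -
  have "F x = F y \<longleftrightarrow> x 0 = y 0 \<and> (\<forall>i\<in>{1..d}. u i < x 0 \<longrightarrow> tower.label x i = tower.label y i)"
    unfolding F_def
    by (rule tree.way_eq_iff[OF address_label address_label]) (use tower.K_range assms in blast)+
  also have "\<dots> \<longleftrightarrow> tower.cell x = tower.cell y"
  proof
    assume *: "x 0 = y 0 \<and> (\<forall>i\<in>{1..d}. u i < x 0 \<longrightarrow> tower.label x i = tower.label y i)"
    then have "v \<in> tower.cell x \<longleftrightarrow> v \<in> tower.cell y" for v
      unfolding tower.cell_iff_label by auto
    then show "tower.cell x = tower.cell y" by blast
  next
    assume "tower.cell x = tower.cell y"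
    moreover have "x \<in> tower.cell x" using assms unfolding tower.cell_iff_label by simp
    ultimately have "x \<in> tower.cell y" by simp
    then show "x 0 = y 0 \<and> (\<forall>i\<in>{1..d}. u i < x 0 \<longrightarrow> tower.label x i = tower.label y i)"
      unfolding tower.cell_iff_label by auto
  qed
  finally show ?thesis using tower.reeb_class_eq assms by simp
qed

lemma F_sample:
  assumes "tree.address a" "s \<in> {u 0..u (Suc d)}"
  shows "tower.sample a s \<in> tower.K" "tower.sample a s 0 = s" "F (tower.sample a s) = tree.way a s"
proof -
  have a: "\<And>i. i \<in> {1..d} \<Longrightarrow> a i < n i" using assms(1) unfolding tree.address_def by blast
  show "tower.sample a s \<in> tower.K" by (rule tower.sample(1)[OF a assms(2)])
  show s: "tower.sample a s 0 = s" by (simp add: tower.sample_def)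
  have lab: "\<And>i. i \<in> {1..d} \<Longrightarrow> tower.label (tower.sample a s) i = a i"
    by (rule tower.sample(2)[OF a assms(2)])
  show "F (tower.sample a s) = tree.way a s"
    unfolding F_def s using tree.way_eq_iff[OF address_label assms(1,2,2)] lab by blast
qed

lemma F_image: "F ` {x \<in> tower.K. P (x 0)} = {tree.way a s |a s. tree.address a \<and> s \<in> {u 0..u (Suc d)} \<and> P s}"
proof (intro equalityI subsetI)
  fix y assume "y \<in> F ` {x \<in> tower.K. P (x 0)}"
  then obtain x where "x \<in> tower.K" "P (x 0)" "y = F x" by blast
  then show "y \<in> {tree.way a s |a s. tree.address a \<and> s \<in> {u 0..u (Suc d)} \<and> P s}"
    unfolding F_def using address_label tower.K_range by blast
next
  fix y assume "y \<in> {tree.way a s |a s. tree.address a \<and> s \<in> {u 0..u (Suc d)} \<and> P s}"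
  then obtain a s where as: "tree.address a" "s \<in> {u 0..u (Suc d)}" "P s" "y = tree.way a s" by blast
  note S = F_sample[OF as(1,2)]
  have "tower.sample a s \<in> {x \<in> tower.K. P (x 0)}" using S as(3) by simp
  then show "y \<in> F ` {x \<in> tower.K. P (x 0)}" unfolding as(4) S(3)[symmetric] by (rule imageI)
qed

text \<open>On a sector \<open>F\<close> is a fixed way composed with the first coordinate; finitely
  many closed sectors cover \<open>K\<close>.\<close>

lemma F_continuous: "continuous_map (top_of_set tower.K) (gspace G) F"
proof (rule pasting_lemma_closed[where I = "PiE {1..d} (\<lambda>i. {..<n i})" and T = tower.sector
      and f = "\<lambda>a. F"])
  fix a assume "a \<in> PiE {1..d} (\<lambda>i. {..<n i})"
  then have an: "\<And>i. i \<in> {1..d} \<Longrightarrow> a i < n i" by (auto dest: PiE_mem)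
  then have a: "tree.address a" unfolding tree.address_def by blast
  have sub: "tower.sector a \<subseteq> tower.K" unfolding tower.sector_def by blast
  then show "closedin (top_of_set tower.K) (tower.sector a)"
    using tower.closed_sector by (simp add: closed_subset)
  have "continuous_map (top_of_set (tower.sector a)) (top_of_set {u 0..u (Suc d)}) (\<lambda>x. x 0)"
    unfolding continuous_map_in_subtopology continuous_map_iff_continuous
    using sub tower.K_range
    by (auto intro: continuous_on_subset[OF continuous_on_product_coordinates])
  from continuous_map_compose[OF this tree.continuous_way[OF a]]
  have "continuous_map (top_of_set (tower.sector a)) (gspace G) (\<lambda>x. tree.way a (x 0))"
    by (simp add: comp_def)
  then have "continuous_map (top_of_set (tower.sector a)) (gspace G) F"
  proof (rule continuous_map_eq)
    fix x assume "x \<in> topspace (top_of_set (tower.sector a))"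
    then have x: "x \<in> tower.sector a" by simp
    then have r: "x 0 \<in> {u 0..u (Suc d)}" using sub tower.K_range by blast
    show "tree.way a (x 0) = F x"
      unfolding F_def using tree.way_eq_iff[OF a address_label r r] tower.sector_label[OF x] an by simp
  qed
  then show "continuous_map (subtopology (top_of_set tower.K) (tower.sector a)) (gspace G) F"
    unfolding subtopology_subtopology Int_absorb1[OF sub] .
next
  fix x assume "x \<in> topspace (top_of_set tower.K)"
  then have x: "x \<in> tower.K" by simp
  \<comment> \<open>Restriction makes the address an element of the finite index set, whose
    functions are fixed outside \<open>{1..d}\<close>.\<close>
  let ?a = "restrict (tower.label x) {1..d}"
  have "?a \<in> PiE {1..d} (\<lambda>i. {..<n i})" using tower.label_less by auto
  moreover have "x \<in> tower.sector ?a"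
    using tower.in_sector_label[OF x] unfolding tower.sector_def by auto
  ultimately show "\<exists>a. a \<in> PiE {1..d} (\<lambda>i. {..<n i}) \<and> x \<in> tower.sector a \<and> F x = F x" by blast
qed (auto intro: finite_PiE)

lemma topspace_K: "subtopology (Euclidean_space (d + 2)) (Euclidean_space (d + 2) closure_of tower.D)
    = top_of_set tower.K"
proof -
  have "{x. \<forall>i\<ge>d + 2. x i = 0} \<inter> tower.K = tower.K" unfolding tower.K_def by blast
  then show ?thesis unfolding tower.closure_of_D
    by (simp only: Euclidean_space_eq subtopology_subtopology)
qed

lemma quotient_q: "quotient_map (top_of_set tower.K) (reeb_space (d + 2) tower.D) q"
  unfolding reeb_space_def topspace_K by (rule quotient_map_quotient_topology)

text \<open>A continuous surjection from a compact space onto a Hausdorff space is a quotient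
  map.\<close>

lemma quotient_F: "quotient_map (top_of_set tower.K) (gspace G) F"
proof (rule continuous_imp_quotient_map[OF F_continuous])
  show "compact_space (top_of_set tower.K)"
    using tower.compact_K by (simp add: compact_space_subtopology)
  show "Hausdorff_space (gspace G)" using tree.G unfolding digraph_def graph_def by blast
  show "F ` topspace (top_of_set tower.K) = topspace (gspace G)"
    using F_image[of "\<lambda>_. True"] tree.topspace_eq by simp
qed

lemma vertices_eq:
  "reeb_vertices (d + 2) l tower.D tower.S = q ` {x \<in> tower.K. \<exists>j\<le>Suc d. x 0 = u j}"
proof -
  have top: "topspace (reeb_space (d + 2) tower.D) = q ` tower.K"
    using quotient_imp_surjective_map[OF quotient_q] by simp
  have "(\<exists>p\<in>q x. singular_point (d + 2) l tower.D tower.S p) \<longleftrightarrow> (\<exists>j\<le>Suc d. x 0 = u j)"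
    if x: "x \<in> tower.K" for x
  proof
    assume "\<exists>p\<in>q x. singular_point (d + 2) l tower.D tower.S p"
    then obtain p where p: "p \<in> tower.cell x" "singular_point (d + 2) l tower.D tower.S p"
      using tower.reeb_class_eq[OF x] by blast
    then have pK: "p \<in> tower.K" "p 0 = x 0" unfolding tower.cell_def by auto
    show "\<exists>j\<le>Suc d. x 0 = u j"
    proof (rule ccontr)
      assume "\<not> (\<exists>j\<le>Suc d. x 0 = u j)"
      then have "\<And>j. j \<le> Suc d \<Longrightarrow> p 0 \<noteq> u j" using pK by auto
      then show False using tower.regular_off_levels[OF pK(1)] p(2) by blast
    qed
  next
    assume "\<exists>j\<le>Suc d. x 0 = u j"
    then obtain j where j: "x 0 = u j" "j \<le> Suc d" by blast
    obtain p' where "p' \<in> tower.cell x" "singular_point (d + 2) l tower.D tower.S p'"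
      by (rule tower.singular_at_level[OF x j])
    then show "\<exists>p\<in>q x. singular_point (d + 2) l tower.D tower.S p"
      using tower.reeb_class_eq[OF x] by blast
  qed
  then show ?thesis unfolding reeb_vertices_def top by blast
qed

lemma q_value: "x \<in> tower.K \<Longrightarrow> reeb_value (q x) = x 0"
  using reeb_value_reeb_class[of x "d + 2" tower.D] tower.closure_of_D by simp

lemma reeb_values: "reeb_value ` reeb_vertices (d + 2) l tower.D tower.S = u ` {0..Suc d}"
proof (intro equalityI subsetI)
  fix s assume "s \<in> reeb_value ` reeb_vertices (d + 2) l tower.D tower.S"
  then show "s \<in> u ` {0..Suc d}" unfolding vertices_eq using q_value by auto
next
  fix s assume "s \<in> u ` {0..Suc d}"
  then obtain j where j: "j \<le> Suc d" "s = u j" by auto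
  let ?x = "tower.sample (tower.label (\<lambda>_. 0)) (u j)"
  note S = F_sample[OF address_label[of "\<lambda>_. 0"] tower.u_in_range[OF j(1)]]
  have "q ?x \<in> reeb_vertices (d + 2) l tower.D tower.S" unfolding vertices_eq using S j by blast
  moreover have "reeb_value (q ?x) = s" using q_value[OF S(1)] S(2) j by simp
  ultimately show "s \<in> reeb_value ` reeb_vertices (d + 2) l tower.D tower.S" by force
qed

text \<open>The homeomorphism carries vertices to vertices, hence edges to edges, so only
  orientations remain. Pulled back to \<open>G\<close>, \<open>reeb_value\<close> is the height, and
  every arc of \<open>G\<close> leads from \<open>u j\<close> to \<open>u (Suc j)\<close>, which
  excludes the reversed matching of ends.\<close>

lemma reeb_digraph_isomorphic: "digraph_isomorphic (reeb_digraph (d + 2) l tower.D tower.S) G"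
proof -
  let ?X = "reeb_space (d + 2) tower.D" and ?V = "reeb_vertices (d + 2) l tower.D tower.S"
  obtain h k where hk: "homeomorphic_maps ?X (gspace G) h k"
    and hq: "\<And>x. x \<in> tower.K \<Longrightarrow> h (q x) = F x" and kF: "\<And>x. x \<in> tower.K \<Longrightarrow> k (F x) = q x"
    using quotient_maps_same_fibres[OF quotient_q quotient_F] F_eq_iff by (metis topspace_euclidean_subtopology)
  have h: "homeomorphic_map ?X (gspace G) h" using hk homeomorphic_map_maps by blast
  have kh: "k (h c) = c" if "c \<in> topspace ?X" for c using hk that unfolding homeomorphic_maps_def by blast
  have hk': "h (k y) = y" if "y \<in> topspace (gspace G)" for y
    using hk that unfolding homeomorphic_maps_def by blast
  have VX: "?V \<subseteq> topspace ?X" unfolding reeb_vertices_def by blast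
  have hV: "h ` ?V = gverts G"
  proof -
    have "h ` ?V = F ` {x \<in> tower.K. \<exists>j\<le>Suc d. x 0 = u j}"
      unfolding vertices_eq image_image using hq by (intro image_cong) auto
    also have "\<dots> = {tree.way a s |a s. tree.address a \<and> s \<in> {u 0..u (Suc d)} \<and> (\<exists>j\<le>Suc d. s = u j)}"
      by (rule F_image)
    also have "\<dots> = gverts G" unfolding tree.gverts_eq using tower.u_in_range by blast
    finally show ?thesis .
  qed
  have edges: "gedges G = (image h) ` edges ?X ?V" using homeomorphic_map_edges[OF h VX] hV by simp
  have eX: "f \<subseteq> topspace ?X" if "f \<in> edges ?X ?V" for f using Union_edges[of ?X ?V] that by blast
  have ends: "endpoints (gspace G) (h ` f) = h ` endpoints ?X f" if "f \<in> edges ?X ?V" for f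
    using homeomorphic_map_endpoints[OF h eX[OF that]] .
  have endX: "endpoints ?X f \<subseteq> topspace ?X" for f
    unfolding endpoints_def using closure_of_subset_topspace[of ?X f] by blast
  have val: "reeb_value (k (tree.way a s)) = s" if "tree.address a" "s \<in> {u 0..u (Suc d)}" for a s
  proof -
    note S = F_sample[OF that]
    have "k (tree.way a s) = q (tower.sample a s)" using kF[OF S(1)] S(3) by simp
    then show ?thesis using q_value[OF S(1)] S(2) by simp
  qed
  have arc_less: "reeb_value (k v) < reeb_value (k w)" if vfw: "(v, f, w) \<in> garcs G" for v f w
  proof -
    obtain a j where aj: "tree.address a" "j \<le> d" "v = tree.way a (u j)" "w = tree.way a (u (Suc j))"
      by (rule tree.garcs_endpoints[OF vfw])
    then have "reeb_value (k v) = u j" "reeb_value (k w) = u (Suc j)"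
      using val[OF aj(1)] tower.u_in_range[of j] tower.u_in_range[of "Suc j"] by auto
    then show ?thesis using tree.u_less[of j "Suc j"] aj(2) by simp
  qed
  let ?A = "{(v, f, w). f \<in> edges ?X ?V \<and> endpoints ?X f = {v, w} \<and> reeb_value v < reeb_value w}"
  have "(\<lambda>(v, f, w). (h v, h ` f, h w)) ` ?A = garcs G"
  proof (intro equalityI subsetI)
    fix y assume "y \<in> (\<lambda>(v, f, w). (h v, h ` f, h w)) ` ?A"
    then obtain v f w where f: "f \<in> edges ?X ?V" "endpoints ?X f = {v, w}" "reeb_value v < reeb_value w"
      and y: "y = (h v, h ` f, h w)" by auto
    have vw: "v \<in> topspace ?X" "w \<in> topspace ?X" using endX[of f] f(2) by auto
    have "h ` f \<in> gedges G" using edges f(1) by blast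
    then obtain a b where ab: "(a, h ` f, b) \<in> garcs G" by (rule digraph_edge_arc[OF tree.G])
    have "{a, b} = {h v, h w}"
      using digraph_arc(2)[OF tree.G ab] ends[OF f(1)] f(2) by simp
    then have "a = h v \<and> b = h w \<or> a = h w \<and> b = h v" by (auto simp: doubleton_eq_iff)
    moreover have "\<not> (a = h w \<and> b = h v)"
      using arc_less[OF ab] f(3) kh[OF vw(1)] kh[OF vw(2)] by auto
    ultimately show "y \<in> garcs G" using ab y by blast
  next
    fix y assume y: "y \<in> garcs G"
    obtain a f b where abf: "y = (a, f, b)" by (cases y)
    then have ab: "(a, f, b) \<in> garcs G" using y by simp
    obtain f' where f': "f' \<in> edges ?X ?V" "f = h ` f'"
      using digraph_arc(1)[OF tree.G ab] edges by blast
    have hf: "h ` endpoints ?X f' = {a, b}"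
      using ends[OF f'(1)] digraph_arc(2)[OF tree.G ab] f'(2) by simp
    have "endpoints ?X f' = k ` h ` endpoints ?X f'"
      using endX[of f'] kh by (force simp: image_image)
    then have "endpoints ?X f' = {k a, k b}" unfolding hf by simp
    moreover have "a \<in> topspace (gspace G)" "b \<in> topspace (gspace G)"
      using digraph_arc(3,4)[OF tree.G ab] tree.G unfolding digraph_def graph_def by blast+
    then have "h (k a) = a" "h (k b) = b" using hk' by auto
    moreover have "(k a, f', k b) \<in> ?A" using calculation(1) f'(1) arc_less[OF ab] by simp
    ultimately show "y \<in> (\<lambda>(v, f, w). (h v, h ` f, h w)) ` ?A"
      unfolding abf f'(2) by (intro image_eqI[of _ _ "(k a, f', k b)"]) auto
  qed
  then show ?thesis
    unfolding digraph_isomorphic_def reeb_digraph_def using h hV by auto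
qed

end

theorem theorem1:
  fixes d l :: nat and t :: "nat \<Rightarrow> real" and n :: "nat \<Rightarrow> nat"
    and T G :: "'a tdigraph" and r :: 'a
  assumes "d > 0"
    and "strict_mono_on {1..d + 2} t"
    and "\<forall>i \<in> {1..d}. n i > 1"
    and "balanced_tree T r n d"
    and "adds_source T r G"
    and "l = (\<Sum>i = 1..d. (n i + 1)) + 2"
  shows "\<exists>R0>0. \<forall>R>R0. \<exists>k\<ge>2. \<exists>D S.
    ra_region k l D S \<and>
    compactin (Euclidean_space k) (Euclidean_space k closure_of D) \<and>
    (\<forall>j \<in> {1..l}. cylinder k {x :: real \<times> real. norm x = R} (S j)) \<and>
    digraph_isomorphic (reeb_digraph k l D S) G \<and>
    reeb_value ` reeb_vertices k l D S = t ` {1..d + 2}"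
proof -
  obtain z e0 where z: "z \<notin> gverts T" "gverts G = insert z (gverts T)"
    "garcs G = insert (z, e0, r) (garcs T)"
    using assms(5) unfolding adds_source_def by blast
  have G: "digraph G" using assms(5) unfolding adds_source_def by blast
  define u where "u i = t (Suc i)" for i
  have u_less: "u i < u j" if "i < j" "j \<le> Suc d" for i j
    unfolding u_def using that by (intro strict_mono_onD[OF assms(2)]) auto
  have n: "n i > 1" if "i \<in> {1..d}" for i using assms(3) that by blast
  \<comment> \<open>The bound demanded by \<open>tower\<close>, increased by 1 so that positivity
    follows from nonnegativity of the product.\<close>
  define R0 where "R0 = 128 * (\<Sum>i=1..d. real (n i))\<^sup>2 * (u (Suc d) - u 0) + 1"
  have "u 0 < u (Suc d)" by (rule u_less) auto
  then have "R0 > 0" unfolding R0_def by (intro add_nonneg_pos mult_nonneg_nonneg) auto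
  moreover have "\<exists>k\<ge>2. \<exists>D S. ra_region k l D S \<and>
    compactin (Euclidean_space k) (Euclidean_space k closure_of D) \<and>
    (\<forall>j \<in> {1..l}. cylinder k {x :: real \<times> real. norm x = R} (S j)) \<and>
    digraph_isomorphic (reeb_digraph k l D S) G \<and>
    reeb_value ` reeb_vertices k l D S = t ` {1..d + 2}" if R: "R > R0" for R
  proof -
    interpret tw: tower d n u R
      by standard (use assms(1) n u_less R in \<open>auto simp: R0_def\<close>)
    obtain e where e: "bij_betw e {1..l} tw.planes"
      using ex_bij_betw_nat_finite_1[OF tw.finite_planes] tw.card_planes assms(6) by auto
    interpret realization T G r n d z e0 u R l e
      by standard (use assms(4) n z G u_less e in \<open>auto intro: order_less_trans\<close>)
    have "compactin (Euclidean_space (d + 2)) tw.K"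
      unfolding Euclidean_space_eq compactin_subtopology using tw.compact_K
      by (auto simp: tw.K_def)
    then have "compactin (Euclidean_space (d + 2)) (Euclidean_space (d + 2) closure_of tw.D)"
      by (simp only: tw.closure_of_D)
    moreover have "cylinder (d + 2) {x :: real \<times> real. norm x = R} (tower.S j)" if "j \<in> {1..l}" for j
      unfolding tower.S_def tw.surf_def
      by (rule cylinder_circ_cylinder[OF tw.R_pos])
        (use tw.planes_fst[OF tower.e_in[OF that]] in auto)
    moreover have "t ` {1..d + 2} = u ` {0..Suc d}"
    proof -
      have "{1..d + 2} = Suc ` {0..Suc d}" unfolding image_Suc_atLeastAtMost by simp
      then show ?thesis unfolding u_def by (simp only: image_image)
    qed
    ultimately show ?thesis
      using tower.ra_region reeb_digraph_isomorphic reeb_values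
      by (intro exI[of _ "d + 2"] exI[of _ tw.D] exI[of _ tower.S] conjI) auto
  qed
  ultimately show ?thesis by blast
qed

end
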